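(* For every $\epsilon>0$ there is a randomized $(3+\epsilon)$-approximation algorithm for the capacitated fair-range $k$-median problem running in time $(O(2^t k\epsilon^{-1}\log n))^{O(k)}\cdot n^{O(1)}$, and a randomized $(9+\epsilon)$-approximation algorithm for the capacitated fair-range $k$-means problem with the same running time.
   Context: Capacitated fair-range $k$-clustering: an instance consists of positive integers $k,t$, clients $C$, facilities $F$, a metric $d$ on $C\cup F$ (the shortest-path metric of a weighted graph; $n$ = number of its vertices), groups $G_1,\dots,G_t\subseteq F$ (possibly intersecting) with integers $\alpha_i\le\beta_i$, and capacities $\zeta:F\to\mathbb{Z}_{\ge0}$. A solution $(S,\rho)$, $S\subseteq F$, $|S|\le k$, $\rho:C\to S$, is feasible if $\alpha_i\le|S\cap G_i|\le\beta_i$ for all $i$ and each $f\in S$ is assigned at most $\zeta(f)$ clients. The $k$-median objective is $\sum_c d(c,\rho(c))$, the $k$-means objective $\sum_c d(c,\rho(c))^2$. Standing assumption: the distance aspect ratio (ratio of maximum to minimum pairwise distance) is $n^{O(1)}$. *)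

theory Defs
  imports "HOL-Probability.Probability" "HOL-Library.Log_Nat"
begin

section \<open>Capacitated fair-range clustering\<close>

text \<open>
  Clients and facilities are vertices of a graph with vertex set \<open>{0..<n}\<close>; the two sets may
  overlap and need not exhaust the vertices. The shortest-path metric enters only through its
  restriction to clients and facilities, and only this restriction is constrained below. No
  generality is lost or gained by this: every finite metric is the shortest-path metric of the
  complete graph weighted by it, and pendant vertices can be added freely.
  Groups are indexed by \<open>{0..<t}\<close>.
\<close>

record cfr_instance =
  nverts :: nat
  ncenters :: nat
  ngroups :: nat
  clients :: "nat set"
  facilities :: "nat set"
  distance :: "nat \<Rightarrow> nat \<Rightarrow> real"
  group_set :: "nat \<Rightarrow> nat set"
  lower_bound :: "nat \<Rightarrow> int"
  upper_bound :: "nat \<Rightarrow> int"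
  capacity :: "nat \<Rightarrow> nat"

definition points :: "cfr_instance \<Rightarrow> nat set" where
  "points I = clients I \<union> facilities I"

definition wf_instance :: "cfr_instance \<Rightarrow> bool" where
  "wf_instance I \<longleftrightarrow>
     0 < nverts I \<and> 0 < ncenters I \<and> 0 < ngroups I \<and>
     points I \<subseteq> {..<nverts I} \<and>
     Metric_space (points I) (distance I) \<and>
     (\<forall>i<ngroups I. group_set I i \<subseteq> facilities I \<and> lower_bound I i \<le> upper_bound I i)"

definition pairwise_distances :: "cfr_instance \<Rightarrow> real set" where
  "pairwise_distances I =
     {distance I x y | x y. x \<in> points I \<and> y \<in> points I \<and> x \<noteq> y}"

definition aspect_ratio :: "cfr_instance \<Rightarrow> real" where
  "aspect_ratio I = Max (pairwise_distances I) / Min (pairwise_distances I)"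

text \<open>
  The aspect ratio is meaningful only if there are two distinct points. A constant factor in
  front of the power would be redundant, since then \<open>n \<ge> 2\<close>.
\<close>

definition aspect_ratio_bounded :: "nat \<Rightarrow> cfr_instance \<Rightarrow> bool" where
  "aspect_ratio_bounded a I \<longleftrightarrow>
     pairwise_distances I \<noteq> {} \<longrightarrow> aspect_ratio I \<le> real (nverts I) ^ a"

definition feasible :: "cfr_instance \<Rightarrow> nat set \<Rightarrow> (nat \<Rightarrow> nat) \<Rightarrow> bool" where
  "feasible I S \<rho> \<longleftrightarrow>
     S \<subseteq> facilities I \<and> card S \<le> ncenters I \<and> \<rho> \<in> clients I \<rightarrow> S \<and>
     (\<forall>i<ngroups I. lower_bound I i \<le> int (card (S \<inter> group_set I i)) \<and>
                    int (card (S \<inter> group_set I i)) \<le> upper_bound I i) \<and>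
     (\<forall>f\<in>S. card {c \<in> clients I. \<rho> c = f} \<le> capacity I f)"

type_synonym objective = "cfr_instance \<Rightarrow> (nat \<Rightarrow> nat) \<Rightarrow> real"

definition kmedian_cost :: objective where
  "kmedian_cost I \<rho> = (\<Sum>c\<in>clients I. distance I c (\<rho> c))"

definition kmeans_cost :: objective where
  "kmeans_cost I \<rho> = (\<Sum>c\<in>clients I. (distance I c (\<rho> c))\<^sup>2)"

definition opt :: "objective \<Rightarrow> cfr_instance \<Rightarrow> real" where
  "opt obj I = (INF (S, \<rho>)\<in>{(S, \<rho>). feasible I S \<rho>}. obj I \<rho>)"


section \<open>Randomized real RAM\<close>

text \<open>
  Programs are finite syntactic objects over two banks of named, unbounded arrays: one of
  integers (used for indices and control) and one of reals (used for distances). Expressions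
  \<open>IGet x e\<close> and \<open>RGet x e\<close> read cell \<open>e\<close> of array \<open>x\<close>; array names are fixed in the program
  text, so a program accesses finitely many arrays and these amount to indirect addressing.

  As usual for a real RAM, field operations and comparisons on reals take unit time, whereas
  there is no rounding or any other conversion from reals to integers, and the only real
  constants are integers. Multiplication, division and random choice on the integer bank
  additionally cost the bit lengths of their operands, so that the integers produced within
  time \<open>T\<close> are at most \<open>O(T)\<close> bits longer than those in the input; unit-cost integer
  multiplication would be unreasonably powerful.
\<close>

datatype iexp =
    IConst int
  | IGet nat iexp
  | IAdd iexp iexp
  | ISub iexp iexp
  | IMul iexp iexp
  | IDiv iexp iexp

datatype rexp =
    ROfInt iexp
  | RGet nat iexp
  | RAdd rexp rexp
  | RSub rexp rexp
  | RMul rexp rexp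
  | RDiv rexp rexp

datatype bexp =
    ILess iexp iexp
  | RLess rexp rexp
  | BNot bexp
  | BAnd bexp bexp

text \<open>
  \<open>ISet x e e'\<close> stores the value of \<open>e'\<close> in cell \<open>e\<close> of the integer array \<open>x\<close>, similarly
  \<open>RSet\<close>; \<open>Rand x e e'\<close> stores a uniformly random element of \<open>{0..<m}\<close>, where \<open>m\<close> is the value
  of \<open>e'\<close> (and \<open>0\<close> if \<open>m \<le> 0\<close>).
\<close>

datatype com =
    Skip
  | ISet nat iexp iexp
  | RSet nat iexp rexp
  | Rand nat iexp iexp
  | Seq com com
  | If bexp com com
  | While bexp com

type_synonym state = "(nat \<Rightarrow> int \<Rightarrow> int) \<times> (nat \<Rightarrow> int \<Rightarrow> real)"

definition int_length :: "int \<Rightarrow> nat" where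
  "int_length x = floorlog 2 (nat \<bar>x\<bar>)"

fun ival :: "iexp \<Rightarrow> state \<Rightarrow> int" where
  "ival (IConst c) s = c"
| "ival (IGet x e) s = fst s x (ival e s)"
| "ival (IAdd e e') s = ival e s + ival e' s"
| "ival (ISub e e') s = ival e s - ival e' s"
| "ival (IMul e e') s = ival e s * ival e' s"
| "ival (IDiv e e') s = ival e s div ival e' s"

fun icost :: "iexp \<Rightarrow> state \<Rightarrow> nat" where
  "icost (IConst c) s = 1"
| "icost (IGet x e) s = 1 + icost e s"
| "icost (IAdd e e') s = 1 + icost e s + icost e' s"
| "icost (ISub e e') s = 1 + icost e s + icost e' s"
| "icost (IMul e e') s =
     1 + int_length (ival e s) + int_length (ival e' s) + icost e s + icost e' s"
| "icost (IDiv e e') s =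
     1 + int_length (ival e s) + int_length (ival e' s) + icost e s + icost e' s"

fun rval :: "rexp \<Rightarrow> state \<Rightarrow> real" where
  "rval (ROfInt e) s = real_of_int (ival e s)"
| "rval (RGet x e) s = snd s x (ival e s)"
| "rval (RAdd e e') s = rval e s + rval e' s"
| "rval (RSub e e') s = rval e s - rval e' s"
| "rval (RMul e e') s = rval e s * rval e' s"
| "rval (RDiv e e') s = rval e s / rval e' s"

fun rcost :: "rexp \<Rightarrow> state \<Rightarrow> nat" where
  "rcost (ROfInt e) s = 1 + icost e s"
| "rcost (RGet x e) s = 1 + icost e s"
| "rcost (RAdd e e') s = 1 + rcost e s + rcost e' s"
| "rcost (RSub e e') s = 1 + rcost e s + rcost e' s"
| "rcost (RMul e e') s = 1 + rcost e s + rcost e' s"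
| "rcost (RDiv e e') s = 1 + rcost e s + rcost e' s"

fun bval :: "bexp \<Rightarrow> state \<Rightarrow> bool" where
  "bval (ILess e e') s \<longleftrightarrow> ival e s < ival e' s"
| "bval (RLess e e') s \<longleftrightarrow> rval e s < rval e' s"
| "bval (BNot b) s \<longleftrightarrow> \<not> bval b s"
| "bval (BAnd b b') s \<longleftrightarrow> bval b s \<and> bval b' s"

fun bcost :: "bexp \<Rightarrow> state \<Rightarrow> nat" where
  "bcost (ILess e e') s = 1 + icost e s + icost e' s"
| "bcost (RLess e e') s = 1 + rcost e s + rcost e' s"
| "bcost (BNot b) s = 1 + bcost b s"
| "bcost (BAnd b b') s = 1 + bcost b s + bcost b' s"

definition iupdate :: "nat \<Rightarrow> int \<Rightarrow> int \<Rightarrow> state \<Rightarrow> state" where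
  "iupdate x j v s = ((fst s)(x := (fst s x)(j := v)), snd s)"

definition rupdate :: "nat \<Rightarrow> int \<Rightarrow> real \<Rightarrow> state \<Rightarrow> state" where
  "rupdate x j v s = (fst s, (snd s)(x := (snd s x)(j := v)))"

definition rand_below :: "int \<Rightarrow> int pmf" where
  "rand_below m = (if 0 < m then pmf_of_set {0..<m} else return_pmf 0)"

definition add_cost :: "nat \<Rightarrow> (state \<times> nat) pmf \<Rightarrow> (state \<times> nat) pmf" where
  "add_cost m p = map_pmf (\<lambda>(s, \<tau>). (s, m + \<tau>)) p"

text \<open>
  \<open>terminates c s p\<close>: started in \<open>s\<close>, program \<open>c\<close> terminates for all outcomes of the random
  choices, and \<open>p\<close> is the joint distribution of final state and running time.
\<close>

inductive terminates :: "com \<Rightarrow> state \<Rightarrow> (state \<times> nat) pmf \<Rightarrow> bool" where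
  Skip: "terminates Skip s (return_pmf (s, 1))"
| ISet: "terminates (ISet x e e') s
     (return_pmf (iupdate x (ival e s) (ival e' s) s, 1 + icost e s + icost e' s))"
| RSet: "terminates (RSet x e e') s
     (return_pmf (rupdate x (ival e s) (rval e' s) s, 1 + icost e s + rcost e' s))"
| Rand: "terminates (Rand x e e') s
     (map_pmf (\<lambda>v. (iupdate x (ival e s) v s,
                     1 + int_length (ival e' s) + icost e s + icost e' s))
        (rand_below (ival e' s)))"
| Seq: "\<lbrakk>terminates c s p; \<forall>(s', \<tau>)\<in>set_pmf p. terminates c' s' (q s')\<rbrakk>
     \<Longrightarrow> terminates (Seq c c') s (bind_pmf p (\<lambda>(s', \<tau>). add_cost \<tau> (q s')))"
| IfTrue: "\<lbrakk>bval b s; terminates c s p\<rbrakk>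
     \<Longrightarrow> terminates (If b c c') s (add_cost (1 + bcost b s) p)"
| IfFalse: "\<lbrakk>\<not> bval b s; terminates c' s p\<rbrakk>
     \<Longrightarrow> terminates (If b c c') s (add_cost (1 + bcost b s) p)"
| WhileFalse: "\<not> bval b s
     \<Longrightarrow> terminates (While b c) s (return_pmf (s, 1 + bcost b s))"
| WhileTrue: "\<lbrakk>bval b s; terminates c s p;
      \<forall>(s', \<tau>)\<in>set_pmf p. terminates (While b c) s' (q s')\<rbrakk>
     \<Longrightarrow> terminates (While b c) s
           (add_cost (1 + bcost b s) (bind_pmf p (\<lambda>(s', \<tau>). add_cost \<tau> (q s'))))"

inductive_cases terminates_SkipE: "terminates Skip s p"
inductive_cases terminates_ISetE: "terminates (ISet x e e') s p"
inductive_cases terminates_RSetE: "terminates (RSet x e e') s p"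
inductive_cases terminates_RandE: "terminates (Rand x e e') s p"
inductive_cases terminates_SeqE: "terminates (Seq c c') s p"
inductive_cases terminates_IfE: "terminates (If b c c') s p"
inductive_cases terminates_WhileE: "terminates (While b c) s p"

lemma terminates_unique:
  "terminates c s p \<Longrightarrow> terminates c s p' \<Longrightarrow> p = p'"
proof (induction arbitrary: p' rule: terminates.induct)
  case (Seq c s p c' q)
  from Seq.prems obtain p1 q1 where
    1: "p' = bind_pmf p1 (\<lambda>(s', \<tau>). add_cost \<tau> (q1 s'))" "terminates c s p1"
       "\<forall>(s', \<tau>)\<in>set_pmf p1. terminates c' s' (q1 s')"
    by (elim terminates_SeqE)
  have "p = p1" using Seq.IH(1) 1 by blast
  with 1 Seq.IH(2) show ?case by (fastforce intro!: bind_pmf_cong)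
next
  case (WhileFalse b s c)
  then show ?case by (auto elim: terminates_WhileE)
next
  case (WhileTrue b s c p q)
  from WhileTrue.prems WhileTrue.hyps(1) obtain p1 q1 where
    1: "p' = add_cost (1 + bcost b s) (bind_pmf p1 (\<lambda>(s', \<tau>). add_cost \<tau> (q1 s')))"
       "terminates c s p1"
       "\<forall>(s', \<tau>)\<in>set_pmf p1. terminates (While b c) s' (q1 s')"
    by (auto elim!: terminates_WhileE)
  have "p = p1" using WhileTrue.IH(1) 1 by blast
  moreover have "bind_pmf p (\<lambda>(s', \<tau>). add_cost \<tau> (q s'))
      = bind_pmf p1 (\<lambda>(s', \<tau>). add_cost \<tau> (q1 s'))"
    using 1 WhileTrue.IH(2) \<open>p = p1\<close> by (fastforce intro!: bind_pmf_cong)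
  ultimately show ?case using 1 by simp
next
  case (Skip s)
  then show ?case by (rule terminates_SkipE) simp
next
  case (ISet x e e' s)
  then show ?case by (rule terminates_ISetE) simp
next
  case (RSet x e e' s)
  then show ?case by (rule terminates_RSetE) simp
next
  case (Rand x e e' s)
  then show ?case by (rule terminates_RandE) simp
next
  case (IfTrue b s c p c')
  from IfTrue.prems show ?case
    by (rule terminates_IfE) (use IfTrue.IH IfTrue.hyps(1) in simp_all)
next
  case (IfFalse b s c' p c)
  from IfFalse.prems show ?case
    by (rule terminates_IfE) (use IfFalse.IH IfFalse.hyps(1) in simp_all)
qed


section \<open>Approximation algorithms\<close>

text \<open>
  Input encoding: integer array \<open>0\<close> holds \<open>n\<close>, \<open>k\<close> and \<open>t\<close>; arrays \<open>1\<close> and \<open>2\<close> the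
  characteristic vectors of clients and facilities; array \<open>3\<close> the capacities; array \<open>4\<close> the
  group memberships as a \<open>t \<times> n\<close> matrix in row-major order; arrays \<open>5\<close> and \<open>6\<close> the bounds of
  the ranges. Real array \<open>0\<close> is the \<open>n \<times> n\<close> distance matrix, in row-major order. Everything
  else is \<open>0\<close>.
\<close>

definition vector_array :: "nat \<Rightarrow> (nat \<Rightarrow> 'a::zero) \<Rightarrow> int \<Rightarrow> 'a" where
  "vector_array m f j = (if 0 \<le> j \<and> j < int m then f (nat j) else 0)"

definition matrix_array :: "nat \<Rightarrow> nat \<Rightarrow> (nat \<Rightarrow> nat \<Rightarrow> 'a::zero) \<Rightarrow> int \<Rightarrow> 'a" where
  "matrix_array l m f = vector_array (l * m) (\<lambda>j. f (j div m) (j mod m))"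

definition encode_ints :: "cfr_instance \<Rightarrow> nat \<Rightarrow> int \<Rightarrow> int" where
  "encode_ints I = (\<lambda>_ _. 0)
     (0 := vector_array 3 (\<lambda>j. [int (nverts I), int (ncenters I), int (ngroups I)] ! j),
      1 := vector_array (nverts I) (\<lambda>v. of_bool (v \<in> clients I)),
      2 := vector_array (nverts I) (\<lambda>v. of_bool (v \<in> facilities I)),
      3 := vector_array (nverts I) (\<lambda>v. if v \<in> facilities I then int (capacity I v) else 0),
      4 := matrix_array (ngroups I) (nverts I) (\<lambda>i v. of_bool (v \<in> group_set I i)),
      5 := vector_array (ngroups I) (lower_bound I),
      6 := vector_array (ngroups I) (upper_bound I))"

definition encode_reals :: "cfr_instance \<Rightarrow> nat \<Rightarrow> int \<Rightarrow> real" where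
  "encode_reals I = (\<lambda>_ _. 0)
     (0 := matrix_array (nverts I) (nverts I)
             (\<lambda>u v. if u \<in> points I \<and> v \<in> points I then distance I u v else 0))"

definition encode :: "cfr_instance \<Rightarrow> state" where
  "encode I = (encode_ints I, encode_reals I)"

text \<open>
  Output encoding: integer array \<open>7\<close> is the characteristic vector of the set of centers,
  integer array \<open>8\<close> the assignment.
\<close>

definition out_centers :: "state \<Rightarrow> nat set" where
  "out_centers s = {v. fst s 7 (int v) \<noteq> 0}"

definition out_assignment :: "state \<Rightarrow> nat \<Rightarrow> nat" where
  "out_assignment s c = nat (fst s 8 (int c))"

text \<open>
  A randomized \<open>r\<close>-approximation algorithm with running time \<open>T\<close>: on every instance (of
  aspect ratio at most \<open>n\<^sup>a\<close>) the running time is bounded for all outcomes of the random choices,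
  and if the instance has a feasible solution then with probability at least \<open>2/3\<close> the output
  is a feasible solution of cost at most \<open>r\<close> times the optimum.
\<close>

definition randomized_approximation ::
    "nat \<Rightarrow> objective \<Rightarrow> real \<Rightarrow> (cfr_instance \<Rightarrow> real) \<Rightarrow> com \<Rightarrow> bool" where
  "randomized_approximation a obj r T P \<longleftrightarrow>
     (\<forall>I. wf_instance I \<and> aspect_ratio_bounded a I \<longrightarrow>
       (\<exists>p. terminates P (encode I) p \<and>
            (\<forall>(s, \<tau>)\<in>set_pmf p. real \<tau> \<le> T I) \<and>
            ((\<exists>S \<rho>. feasible I S \<rho>) \<longrightarrow>
               measure_pmf.prob p {(s, \<tau>).
                 feasible I (out_centers s) (out_assignment s) \<and>
                 obj I (out_assignment s) \<le> r * opt obj I} \<ge> 2 / 3)))"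

text \<open>
  \<open>(O(2\<^sup>t k \<epsilon>\<^sup>-\<^sup>1 log n))\<^sup>O\<^sup>(\<^sup>k\<^sup>) n\<^sup>O\<^sup>(\<^sup>1\<^sup>)\<close>, with \<open>A\<close>, \<open>B\<close>, \<open>D\<close> for the constants hidden in the three
  \<open>O\<close>s. Since no algorithm runs in time tending to \<open>0\<close>, the factor \<open>\<epsilon>\<^sup>-\<^sup>1\<close> is read as
  \<open>max 1 \<epsilon>\<^sup>-\<^sup>1\<close>, and \<open>log n\<close> as \<open>log (n + 1)\<close>; this matters only for \<open>\<epsilon> > 1\<close> and for \<open>n = 1\<close>.
\<close>

definition time_bound :: "real \<Rightarrow> nat \<Rightarrow> nat \<Rightarrow> real \<Rightarrow> cfr_instance \<Rightarrow> real" where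
  "time_bound A B D \<epsilon> I =
     (A * (2 ^ ngroups I * real (ncenters I) * max 1 (1 / \<epsilon>) * log 2 (real (nverts I) + 1)))
        ^ (B * ncenters I)
     * real (nverts I) ^ D"

end

theory Submission
  imports Defs
begin

text \<open>
  Fix an optimal solution. A trial first finds a set of leaders by adaptive sampling: each step
  chooses a client with probability proportional to the \<open>z\<close>-th power of its distance to the
  leaders chosen so far. As long as the optimal centers that are far from all leaders, compared with
  the cost of their clusters, contribute significantly, the next leader is with substantial
  probability close to such a center. Then, for each optimal center, the trial guesses its leader,
  the distance to this leader up to rounding (here the bound on the aspect ratio enters), and the
  set of groups to which the center belongs. The resulting ball contains a facility with the same
  groups and at least the same capacity. If it replaces the center, the group constraints are
  preserved, and a client travels the distance to its optimal center plus about twice the distance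
  of this center to the leader, which is not larger on average; this gives the factor \<open>3 ^ z\<close>.
  For the chosen centers, an optimal capacitated assignment is computed by inserting the clients
  one at a time and enumerating the \<open>k ^ (k + 1)\<close> ways to reroute clients. Finally the trial is
  repeated about as often as the inverse of its success probability.
\<close>

section \<open>Structured programs with counted loops\<close>

text \<open>The running time has to be bounded for all outcomes of the random choices. Therefore no
  guess may influence a loop bound: all bounds are computed before the first trial, and a guessed
  exponent merely switches off the rounds of a loop of fixed length. Wrong guesses lead to arbitrary
  candidates. So a solution is recorded only after its group ranges and loads have been checked, and
  only if it is cheaper than the one recorded before; one successful trial is then enough, and
  failed trials do no harm. Random choices are uniform on integers, and reals cannot be rounded.
  Sampling by real weights is therefore replaced by a random point of a grid of
  \<open>4608 * q ^ 4 * n\<close> points, where \<open>1 / q\<close> is the accuracy. Each client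
  loses at most one grid point by this, in total half of the mass that the exact weights would
  guarantee. The approximation factor is \<open>3 ^ z + 31 / q\<close>. It comes from convexity of
  the \<open>z\<close>-th power with weights 1 and \<open>2 + 1 / q\<close>, the first for the way
  of a client to its own center, the second for the way from this center to its replacement, which
  lies in a ball around the leader.\<close>

text \<open>
  The algorithm is written in a sublanguage in which all loops are counted and in which
  multiplication and division of integers do not occur. For such programs termination and running
  time can be read off the syntax, once the loop bounds are known, and the result can be described
  by a denotation that ignores time.
\<close>

datatype prog =
    PSkip
  | PI nat iexp iexp
  | PR nat iexp rexp
  | PRand nat nat
  | PSeq prog prog
  | PIf bexp prog prog
  | PFor nat nat prog

abbreviation IV :: "nat \<Rightarrow> iexp" where "IV x \<equiv> IGet x (IConst 0)"
abbreviation RV :: "nat \<Rightarrow> rexp" where "RV x \<equiv> RGet x (IConst 0)"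
abbreviation iv :: "state \<Rightarrow> nat \<Rightarrow> int" where "iv s x \<equiv> fst s x 0"
abbreviation rv :: "state \<Rightarrow> nat \<Rightarrow> real" where "rv s x \<equiv> snd s x 0"
abbreviation PIV :: "nat \<Rightarrow> iexp \<Rightarrow> prog" where "PIV x e \<equiv> PI x (IConst 0) e"
abbreviation PRV :: "nat \<Rightarrow> rexp \<Rightarrow> prog" where "PRV x e \<equiv> PR x (IConst 0) e"

fun compile :: "prog \<Rightarrow> com" where
  "compile PSkip = Skip"
| "compile (PI x e e') = ISet x e e'"
| "compile (PR x e e') = RSet x e e'"
| "compile (PRand x y) = Rand x (IConst 0) (IV y)"
| "compile (PSeq p p') = Seq (compile p) (compile p')"
| "compile (PIf b p p') = If b (compile p) (compile p')"
| "compile (PFor x y p) =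
     Seq (ISet x (IConst 0) (IConst 0))
         (While (ILess (IV x) (IV y)) (Seq (compile p) (ISet x (IConst 0) (IAdd (IV x) (IConst 1)))))"

fun forloop :: "(state \<Rightarrow> state pmf) \<Rightarrow> nat \<Rightarrow> nat \<Rightarrow> nat \<Rightarrow> state \<Rightarrow> state pmf" where
  "forloop f x i 0 s = return_pmf s"
| "forloop f x i (Suc m) s =
     bind_pmf (f s) (\<lambda>s'. forloop f x (Suc i) m (iupdate x 0 (int (Suc i)) s'))"

text \<open>The bound of a loop is read once here, whereas the compiled loop reads it again in every
  guard. That the two agree rests on the condition in \<open>runs_compile\<close> that no bound is
  ever written.\<close>

fun den :: "prog \<Rightarrow> state \<Rightarrow> state pmf" where
  "den PSkip s = return_pmf s"
| "den (PI x e e') s = return_pmf (iupdate x (ival e s) (ival e' s) s)"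
| "den (PR x e e') s = return_pmf (rupdate x (ival e s) (rval e' s) s)"
| "den (PRand x y) s = map_pmf (\<lambda>v. iupdate x 0 v s) (rand_below (iv s y))"
| "den (PSeq p p') s = bind_pmf (den p s) (den p')"
| "den (PIf b p p') s = (if bval b s then den p s else den p' s)"
| "den (PFor x y p) s = forloop (den p) x 0 (nat (iv s y)) (iupdate x 0 0 s)"

fun iw :: "prog \<Rightarrow> nat set" where
  "iw PSkip = {}"
| "iw (PI x e e') = {x}"
| "iw (PR x e e') = {}"
| "iw (PRand x y) = {x}"
| "iw (PSeq p p') = iw p \<union> iw p'"
| "iw (PIf b p p') = iw p \<union> iw p'"
| "iw (PFor x y p) = insert x (iw p)"

fun rw :: "prog \<Rightarrow> nat set" where
  "rw PSkip = {}"
| "rw (PI x e e') = {}"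
| "rw (PR x e e') = {x}"
| "rw (PRand x y) = {}"
| "rw (PSeq p p') = rw p \<union> rw p'"
| "rw (PIf b p p') = rw p \<union> rw p'"
| "rw (PFor x y p) = rw p"

text \<open>The range of a random choice is treated like a loop bound because its bit length is part
  of the running time; for the same reason \<open>PRand\<close> has \<open>depth\<close> 1.\<close>

fun bvars :: "prog \<Rightarrow> nat set" where
  "bvars PSkip = {}"
| "bvars (PI x e e') = {}"
| "bvars (PR x e e') = {}"
| "bvars (PRand x y) = {y}"
| "bvars (PSeq p p') = bvars p \<union> bvars p'"
| "bvars (PIf b p p') = bvars p \<union> bvars p'"
| "bvars (PFor x y p) = insert y (bvars p)"

fun isimple :: "iexp \<Rightarrow> bool" where
  "isimple (IConst c) \<longleftrightarrow> True"
| "isimple (IGet x e) \<longleftrightarrow> isimple e"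
| "isimple (IAdd e e') \<longleftrightarrow> isimple e \<and> isimple e'"
| "isimple (ISub e e') \<longleftrightarrow> isimple e \<and> isimple e'"
| "isimple (IMul e e') \<longleftrightarrow> False"
| "isimple (IDiv e e') \<longleftrightarrow> False"

fun rsimple :: "rexp \<Rightarrow> bool" where
  "rsimple (ROfInt e) \<longleftrightarrow> isimple e"
| "rsimple (RGet x e) \<longleftrightarrow> isimple e"
| "rsimple (RAdd e e') \<longleftrightarrow> rsimple e \<and> rsimple e'"
| "rsimple (RSub e e') \<longleftrightarrow> rsimple e \<and> rsimple e'"
| "rsimple (RMul e e') \<longleftrightarrow> rsimple e \<and> rsimple e'"
| "rsimple (RDiv e e') \<longleftrightarrow> rsimple e \<and> rsimple e'"

fun bsimple :: "bexp \<Rightarrow> bool" where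
  "bsimple (ILess e e') \<longleftrightarrow> isimple e \<and> isimple e'"
| "bsimple (RLess e e') \<longleftrightarrow> rsimple e \<and> rsimple e'"
| "bsimple (BNot b) \<longleftrightarrow> bsimple b"
| "bsimple (BAnd b b') \<longleftrightarrow> bsimple b \<and> bsimple b'"

fun psimple :: "prog \<Rightarrow> bool" where
  "psimple PSkip \<longleftrightarrow> True"
| "psimple (PI x e e') \<longleftrightarrow> isimple e \<and> isimple e'"
| "psimple (PR x e e') \<longleftrightarrow> isimple e \<and> rsimple e'"
| "psimple (PRand x y) \<longleftrightarrow> True"
| "psimple (PSeq p p') \<longleftrightarrow> psimple p \<and> psimple p'"
| "psimple (PIf b p p') \<longleftrightarrow> bsimple b \<and> psimple p \<and> psimple p'"
| "psimple (PFor x y p) \<longleftrightarrow> x \<notin> iw p \<and> psimple p"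

primrec isize :: "iexp \<Rightarrow> nat" where
  "isize (IConst c) = 1"
| "isize (IGet x e) = 1 + isize e"
| "isize (IAdd e e') = 1 + isize e + isize e'"
| "isize (ISub e e') = 1 + isize e + isize e'"
| "isize (IMul e e') = 1 + isize e + isize e'"
| "isize (IDiv e e') = 1 + isize e + isize e'"

primrec rsize :: "rexp \<Rightarrow> nat" where
  "rsize (ROfInt e) = 1 + isize e"
| "rsize (RGet x e) = 1 + isize e"
| "rsize (RAdd e e') = 1 + rsize e + rsize e'"
| "rsize (RSub e e') = 1 + rsize e + rsize e'"
| "rsize (RMul e e') = 1 + rsize e + rsize e'"
| "rsize (RDiv e e') = 1 + rsize e + rsize e'"

primrec bsize :: "bexp \<Rightarrow> nat" where
  "bsize (ILess e e') = 1 + isize e + isize e'"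
| "bsize (RLess e e') = 1 + rsize e + rsize e'"
| "bsize (BNot b) = 1 + bsize b"
| "bsize (BAnd b b') = 1 + bsize b + bsize b'"

text \<open>
  The running time is at most \<open>tcoeff p * (M + 1) ^ depth p\<close> if all loop bounds are at most \<open>M\<close>.
  The summand 21 covers the initialization, guards and increments of the loop counter.
\<close>

primrec tcoeff :: "prog \<Rightarrow> nat" where
  "tcoeff PSkip = 1"
| "tcoeff (PI x e e') = 1 + isize e + isize e'"
| "tcoeff (PR x e e') = 1 + isize e + rsize e'"
| "tcoeff (PRand x y) = 4"
| "tcoeff (PSeq p p') = tcoeff p + tcoeff p'"
| "tcoeff (PIf b p p') = 1 + bsize b + (tcoeff p + tcoeff p')"
| "tcoeff (PFor x y p) = 21 + tcoeff p"

primrec depth :: "prog \<Rightarrow> nat" where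
  "depth PSkip = 0"
| "depth (PI x e e') = 0"
| "depth (PR x e e') = 0"
| "depth (PRand x y) = 1"
| "depth (PSeq p p') = max (depth p) (depth p')"
| "depth (PIf b p p') = max (depth p) (depth p')"
| "depth (PFor x y p) = Suc (depth p)"

definition ptime :: "prog \<Rightarrow> nat \<Rightarrow> nat" where
  "ptime p M = tcoeff p * (M + 1) ^ depth p"

text \<open>Only multiplication and division have costs that depend on their operands. Without them
  the cost of an expression is its size, in every state.\<close>

lemma icost_simple: "isimple e \<Longrightarrow> icost e s = isize e"
  by (induction e) auto

lemma rcost_simple: "rsimple e \<Longrightarrow> rcost e s = rsize e"
  by (induction e) (auto simp: icost_simple)

lemma bcost_simple: "bsimple b \<Longrightarrow> bcost b s = bsize b"
  by (induction b) (auto simp: icost_simple rcost_simple)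

lemma fst_iupdate [simp]:
  "fst (iupdate x j v s) y = (if y = x then (fst s x)(j := v) else fst s y)"
  by (simp add: iupdate_def)

lemma snd_iupdate [simp]: "snd (iupdate x j v s) = snd s"
  by (simp add: iupdate_def)

lemma fst_rupdate [simp]: "fst (rupdate x j v s) = fst s"
  by (simp add: rupdate_def)

lemma snd_rupdate [simp]:
  "snd (rupdate x j v s) y = (if y = x then (snd s x)(j := v) else snd s y)"
  by (simp add: rupdate_def)

subsection \<open>Frames\<close>

definition agree :: "nat set \<Rightarrow> nat set \<Rightarrow> state \<Rightarrow> state \<Rightarrow> bool" where
  "agree X Y s s' \<longleftrightarrow> (\<forall>x. x \<notin> X \<longrightarrow> fst s' x = fst s x) \<and> (\<forall>x. x \<notin> Y \<longrightarrow> snd s' x = snd s x)"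

lemma agree_fst: "agree X Y s s' \<Longrightarrow> x \<notin> X \<Longrightarrow> fst s' x = fst s x"
  and agree_snd: "agree X Y s s' \<Longrightarrow> x \<notin> Y \<Longrightarrow> snd s' x = snd s x"
  by (auto simp: agree_def)

lemma agree_refl [simp]: "agree X Y s s"
  by (simp add: agree_def)

lemma agree_trans: "agree X Y s s' \<Longrightarrow> agree X Y s' s'' \<Longrightarrow> agree X Y s s''"
  by (simp add: agree_def)

lemma agree_mono: "agree X Y s s' \<Longrightarrow> X \<subseteq> X' \<Longrightarrow> Y \<subseteq> Y' \<Longrightarrow> agree X' Y' s s'"
  unfolding agree_def by blast

lemma agree_iupdate: "x \<in> X \<Longrightarrow> agree X Y s (iupdate x j v s)"
  by (auto simp: agree_def)

lemma forloop_agree: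
  assumes "\<And>s s'. s' \<in> set_pmf (f s) \<Longrightarrow> agree X Y s s'" "x \<in> X"
  shows "s' \<in> set_pmf (forloop f x i m s) \<Longrightarrow> agree X Y s s'"
proof (induction m arbitrary: i s)
  case (Suc m)
  then obtain s1 where s1: "s1 \<in> set_pmf (f s)"
      "s' \<in> set_pmf (forloop f x (Suc i) m (iupdate x 0 (int (Suc i)) s1))" by auto
  show ?case
    by (rule agree_trans[OF assms(1)[OF s1(1)]], rule agree_trans[OF agree_iupdate Suc.IH[OF s1(2)]])
      (rule assms(2))
qed simp

lemma den_agree: "s' \<in> set_pmf (den p s) \<Longrightarrow> agree (iw p) (rw p) s s'"
proof (induction p arbitrary: s s')
  case (PSeq p1 p2)
  then obtain s1 where "s1 \<in> set_pmf (den p1 s)" "s' \<in> set_pmf (den p2 s1)" by auto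
  with PSeq.IH[of s1 s] PSeq.IH(2)[of s' s1] show ?case by (simp add: agree_def)
next
  case (PIf b p1 p2)
  then show ?case by (auto simp: agree_def split: if_splits)
next
  case (PFor x y p)
  have "agree (insert x (iw p)) (rw p) s s'" if "s' \<in> set_pmf (den p s)" for s s'
    by (rule agree_mono[OF PFor.IH[OF that]]) auto
  from forloop_agree[where f = "den p" and x = x, OF this] PFor.prems
  have *: "agree (insert x (iw p)) (rw p) (iupdate x 0 0 s) s'" by auto
  show ?case using agree_trans[OF agree_iupdate *] by simp
qed (auto simp: agree_def)

subsection \<open>Termination and running time\<close>

text \<open>The joint law of state and time is split into the law of the state and a worst-case
  time, so that time bounds never involve probabilities.\<close>

definition runs :: "com \<Rightarrow> state \<Rightarrow> state pmf \<Rightarrow> nat \<Rightarrow> bool" where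
  "runs c s D T \<longleftrightarrow>
     (\<exists>P. terminates c s P \<and> map_pmf fst P = D \<and> (\<forall>(s', \<tau>)\<in>set_pmf P. \<tau> \<le> T))"

lemma map_fst_add_cost [simp]: "map_pmf fst (add_cost m p) = map_pmf fst p"
  by (simp add: add_cost_def map_pmf_comp case_prod_unfold)

lemma set_add_cost: "set_pmf (add_cost m p) = (\<lambda>(s, \<tau>). (s, m + \<tau>)) ` set_pmf p"
  by (simp add: add_cost_def)

lemma runsI:
  "terminates c s P \<Longrightarrow> map_pmf fst P = D \<Longrightarrow> (\<And>s' \<tau>. (s', \<tau>) \<in> set_pmf P \<Longrightarrow> \<tau> \<le> T) \<Longrightarrow> runs c s D T"
  unfolding runs_def by blast

lemma runs_mono: "runs c s D T \<Longrightarrow> T \<le> T' \<Longrightarrow> runs c s D T'"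
  unfolding runs_def by fastforce

text \<open>Common part of \<open>runs_Seq\<close> and \<open>runs_While\<close>: both continue from
  every possible intermediate state, and the choice of one continuation law for each of these states
  is made here.\<close>

lemma runs_continuation:
  assumes "map_pmf fst P = D" "\<forall>s'\<in>set_pmf D. runs c' s' (D' s') T'"
  obtains q where "\<forall>(s', \<tau>)\<in>set_pmf P. terminates c' s' (q s')"
    "map_pmf fst (bind_pmf P (\<lambda>(s', \<tau>). add_cost \<tau> (q s'))) = bind_pmf D D'"
    "\<And>T. \<forall>(s', \<tau>)\<in>set_pmf P. \<tau> \<le> T \<Longrightarrow>
      \<forall>(s', \<tau>)\<in>set_pmf (bind_pmf P (\<lambda>(s', \<tau>). add_cost \<tau> (q s'))). \<tau> \<le> T + T'"
proof -
  from assms(2) obtain q where q: "\<And>s'. s' \<in> set_pmf D \<Longrightarrow> terminates c' s' (q s') \<and>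
      map_pmf fst (q s') = D' s' \<and> (\<forall>(s'', \<tau>)\<in>set_pmf (q s'). \<tau> \<le> T')"
    unfolding runs_def by metis
  have D: "fst x \<in> set_pmf D" if "x \<in> set_pmf P" for x
    using that assms(1) by auto
  show thesis
  proof (rule that[of q])
    show "\<forall>(s', \<tau>)\<in>set_pmf P. terminates c' s' (q s')"
      using q D by fastforce
    have "map_pmf fst (bind_pmf P (\<lambda>(s', \<tau>). add_cost \<tau> (q s')))
        = bind_pmf P (\<lambda>x. map_pmf fst (q (fst x)))"
      by (simp add: map_bind_pmf case_prod_unfold)
    also have "\<dots> = bind_pmf P (\<lambda>x. D' (fst x))"
      by (intro bind_pmf_cong refl) (use q D in blast)
    also have "\<dots> = bind_pmf D D'"
      by (simp add: assms(1)[symmetric] bind_map_pmf)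
    finally show "map_pmf fst (bind_pmf P (\<lambda>(s', \<tau>). add_cost \<tau> (q s'))) = bind_pmf D D'" .
    show "\<forall>(s', \<tau>)\<in>set_pmf (bind_pmf P (\<lambda>(s', \<tau>). add_cost \<tau> (q s'))). \<tau> \<le> T + T'"
      if "\<forall>(s', \<tau>)\<in>set_pmf P. \<tau> \<le> T" for T
      using that q D by (fastforce simp: set_add_cost intro: add_mono)
  qed
qed

lemma runs_Seq:
  assumes "runs c s D T" "\<forall>s'\<in>set_pmf D. runs c' s' (D' s') T'"
  shows "runs (Seq c c') s (bind_pmf D D') (T + T')"
proof -
  from assms(1) obtain P where P: "terminates c s P" "map_pmf fst P = D"
      "\<forall>(s', \<tau>)\<in>set_pmf P. \<tau> \<le> T" unfolding runs_def by blast
  obtain q where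
    q: "\<forall>(s', \<tau>)\<in>set_pmf P. terminates c' s' (q s')"
      "map_pmf fst (bind_pmf P (\<lambda>(s', \<tau>). add_cost \<tau> (q s'))) = bind_pmf D D'"
      "\<forall>(s', \<tau>)\<in>set_pmf (bind_pmf P (\<lambda>(s', \<tau>). add_cost \<tau> (q s'))). \<tau> \<le> T + T'"
    by (rule runs_continuation[OF P(2) assms(2)]) (use P(3) in blast)
  show ?thesis by (rule runsI[OF terminates.Seq[OF P(1) q(1)] q(2)]) (use q(3) in blast)
qed

lemma runs_While:
  assumes "bval b s" "runs c s D T" "\<forall>s'\<in>set_pmf D. runs (While b c) s' (D' s') T'"
  shows "runs (While b c) s (bind_pmf D D') (1 + bcost b s + (T + T'))"
proof -
  from assms(2) obtain P where P: "terminates c s P" "map_pmf fst P = D"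
      "\<forall>(s', \<tau>)\<in>set_pmf P. \<tau> \<le> T" unfolding runs_def by blast
  obtain q where
    q: "\<forall>(s', \<tau>)\<in>set_pmf P. terminates (While b c) s' (q s')"
      "map_pmf fst (bind_pmf P (\<lambda>(s', \<tau>). add_cost \<tau> (q s'))) = bind_pmf D D'"
      "\<forall>(s', \<tau>)\<in>set_pmf (bind_pmf P (\<lambda>(s', \<tau>). add_cost \<tau> (q s'))). \<tau> \<le> T + T'"
    by (rule runs_continuation[OF P(2) assms(3)]) (use P(3) in blast)
  show ?thesis
    by (rule runsI[OF terminates.WhileTrue[OF assms(1) P(1) q(1)]])
      (use q(2,3) in \<open>fastforce simp: set_add_cost\<close>)+
qed

lemma runs_If:
  assumes "runs (if bval b s then c else c') s D T"
  shows "runs (If b c c') s D (1 + bcost b s + T)"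
proof -
  from assms obtain P where P: "terminates (if bval b s then c else c') s P" "map_pmf fst P = D"
      "\<forall>(s', \<tau>)\<in>set_pmf P. \<tau> \<le> T" unfolding runs_def by blast
  have "terminates (If b c c') s (add_cost (1 + bcost b s) P)"
    using P(1) by (cases "bval b s") (auto intro: terminates.IfTrue terminates.IfFalse simp del: plus_nat.simps add_Suc add_Suc_right One_nat_def)
  then show ?thesis by (rule runsI) (use P(2,3) in \<open>auto simp: set_add_cost\<close>)
qed

text \<open>Bounding a bit length by the number itself is crude but sufficient, as the argument of a
  random choice is bounded by \<open>M\<close> like any loop bound.\<close>

lemma int_length_le: "int_length v \<le> M" if "\<bar>v\<bar> \<le> int M"
proof -
  have "floorlog 2 m \<le> m" for m :: nat
  proof (induction m rule: less_induct)
    case (less m)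
    show ?case
    proof (cases "m < 2")
      case True
      then show ?thesis by (auto simp: floorlog_def less_2_cases_iff)
    next
      case False
      then have "floorlog 2 m = floorlog 2 (m div 2) + 1"
        by (subst compute_floorlog) auto
      then show ?thesis using less[of "m div 2"] False by linarith
    qed
  qed
  from this[of "nat \<bar>v\<bar>"] show ?thesis using that by (simp add: int_length_def)
qed

lemma ptime_Seq: "ptime p M + ptime p' M \<le> (tcoeff p + tcoeff p') * (M + 1) ^ max (depth p) (depth p')"
  unfolding ptime_def
  by (simp only: add_mult_distrib, intro add_mono mult_left_mono power_increasing) auto

text \<open>The two inequalities express that \<open>m\<close> is the truncated difference of the
  loop bound and \<open>i\<close>, also if the bound is negative. The summand 12 per round consists
  of 6 for the guard and 6 for the increment; the final 6 is the guard that fails.\<close>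

lemma runs_forloop:
  assumes body: "\<And>s. agree X Y s0 s \<Longrightarrow> runs c s (f s) T"
    and agr: "\<And>s s'. s' \<in> set_pmf (f s) \<Longrightarrow> agree (X - {x}) Y s s'"
    and "x \<in> X" "y \<notin> X" "iv s0 y \<le> int (i + m)" "int (i + m) \<le> max (int i) (iv s0 y)"
    and "agree X Y s0 s" "iv s x = int i"
  shows "runs (While (ILess (IV x) (IV y)) (Seq c (ISet x (IConst 0) (IAdd (IV x) (IConst 1)))))
           s (forloop f x i m s) (m * (T + 12) + 6)"
  using assms(5-8)
proof (induction m arbitrary: i s)
  case 0
  then have "\<not> bval (ILess (IV x) (IV y)) s"
    using agree_fst[OF 0(3) assms(4)] by simp
  from terminates.WhileFalse[OF this] show ?case
    by (rule runsI) auto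
next
  case (Suc m)
  let ?w = "While (ILess (IV x) (IV y)) (Seq c (ISet x (IConst 0) (IAdd (IV x) (IConst 1))))"
  have b: "bval (ILess (IV x) (IV y)) s"
    using agree_fst[OF Suc(4) assms(4)] Suc.prems by simp
  have inc: "runs (ISet x (IConst 0) (IAdd (IV x) (IConst 1))) s'
      (return_pmf (iupdate x 0 (int (Suc i)) s')) 6"
    if "s' \<in> set_pmf (f s)" for s'
  proof -
    have "iv s' x = int i" using agree_fst[OF agr[OF that], of x] Suc.prems(4) by simp
    then have "terminates (ISet x (IConst 0) (IAdd (IV x) (IConst 1))) s'
      (return_pmf (iupdate x 0 (int (Suc i)) s', 6))"
      using terminates.ISet[of x "IConst 0" "IAdd (IV x) (IConst 1)" s']
      by (simp add: ac_simps eval_nat_numeral)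
    then show ?thesis by (rule runsI) auto
  qed
  have 1: "runs (Seq c (ISet x (IConst 0) (IAdd (IV x) (IConst 1)))) s
      (bind_pmf (f s) (\<lambda>s'. return_pmf (iupdate x 0 (int (Suc i)) s'))) (T + 6)"
    by (rule runs_Seq[OF body]) (use Suc.prems inc in auto)
  have rest: "runs ?w s' (forloop f x (Suc i) m s') (m * (T + 12) + 6)"
    if "s' \<in> set_pmf (bind_pmf (f s) (\<lambda>s'. return_pmf (iupdate x 0 (int (Suc i)) s')))" for s'
  proof -
    from that obtain s1 where s1: "s1 \<in> set_pmf (f s)" "s' = iupdate x 0 (int (Suc i)) s1" by auto
    have "agree X Y s s1" by (rule agree_mono[OF agr[OF s1(1)]]) auto
    then have "agree X Y s0 s'"
      using Suc.prems(3) assms(3) s1(2) by (metis agree_trans agree_iupdate)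
    then show ?thesis using Suc.IH[of "Suc i" s'] Suc.prems s1(2) by auto
  qed
  have "runs ?w s (bind_pmf (bind_pmf (f s) (\<lambda>s'. return_pmf (iupdate x 0 (int (Suc i)) s')))
      (\<lambda>s'. forloop f x (Suc i) m s'))
      (1 + bcost (ILess (IV x) (IV y)) s + (T + 6 + (m * (T + 12) + 6)))"
    by (rule runs_While[OF b 1]) (use rest in blast)
  then show ?case by (simp add: bind_assoc_pmf bind_return_pmf ac_simps)
qed

theorem runs_compile:
  assumes "psimple p" "bvars p \<inter> iw p = {}" "\<And>y. y \<in> bvars p \<Longrightarrow> \<bar>iv s y\<bar> \<le> int M"
  shows "runs (compile p) s (den p s) (ptime p M)"
  using assms
proof (induction p arbitrary: s)
  case PSkip
  show ?case
    unfolding compile.simps by (rule runsI, rule terminates.Skip) (auto simp: ptime_def)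
next
  case (PI x e e')
  show ?case
    unfolding compile.simps
    by (rule runsI, rule terminates.ISet) (use PI in \<open>auto simp: ptime_def icost_simple\<close>)
next
  case (PR x e e')
  show ?case
    unfolding compile.simps
    by (rule runsI, rule terminates.RSet)
      (use PR in \<open>auto simp: ptime_def icost_simple rcost_simple\<close>)
next
  case (PRand x y)
  have "int_length (iv s y) \<le> M"
    using int_length_le[of "iv s y" M] PRand by simp
  then show ?case
    unfolding compile.simps
    by (intro runsI[OF terminates.Rand]) (auto simp: ptime_def map_pmf_comp)
next
  case (PSeq p1 p2)
  show ?case
    unfolding compile.simps den.simps
  proof (rule runs_mono[OF runs_Seq])
    show "runs (compile p1) s (den p1 s) (ptime p1 M)"
      by (rule PSeq.IH) (use PSeq.prems in auto)
    show "\<forall>s'\<in>set_pmf (den p1 s). runs (compile p2) s' (den p2 s') (ptime p2 M)"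
    proof
      fix s' assume "s' \<in> set_pmf (den p1 s)"
      then have "fst s' y = fst s y" if "y \<in> bvars p2" for y
        using agree_fst[OF den_agree, of s' p1 s y] that PSeq.prems(2) by auto
      then show "runs (compile p2) s' (den p2 s') (ptime p2 M)"
        by (intro PSeq.IH) (use PSeq.prems in auto)
    qed
  qed (use ptime_Seq[of p1 M p2] in \<open>simp add: ptime_def\<close>)
next
  case (PIf b p1 p2)
  have "runs (if bval b s then compile p1 else compile p2) s (den (PIf b p1 p2) s)
      (ptime p1 M + ptime p2 M)"
  proof (cases "bval b s")
    case True
    have "runs (compile p1) s (den p1 s) (ptime p1 M)"
      by (rule PIf.IH) (use PIf.prems in auto)
    then show ?thesis using True by (auto elim: runs_mono)
  next
    case False
    have "runs (compile p2) s (den p2 s) (ptime p2 M)"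
      by (rule PIf.IH) (use PIf.prems in auto)
    then show ?thesis using False by (auto elim: runs_mono)
  qed
  then have "runs (compile (PIf b p1 p2)) s (den (PIf b p1 p2) s)
      (1 + bcost b s + (ptime p1 M + ptime p2 M))"
    unfolding compile.simps by (intro runs_If) auto
  moreover have "1 + bcost b s + (ptime p1 M + ptime p2 M) \<le> ptime (PIf b p1 p2) M"
  proof -
    have "(1 + bsize b) * 1 \<le> (1 + bsize b) * (M + 1) ^ max (depth p1) (depth p2)"
      by (intro mult_left_mono) auto
    then have "1 + bcost b s \<le> (1 + bsize b) * (M + 1) ^ max (depth p1) (depth p2)"
      using PIf.prems(1) by (simp add: bcost_simple)
    then show ?thesis using ptime_Seq[of p1 M p2]
      by (simp add: ptime_def add_mult_distrib)
  qed
  ultimately show ?case by (rule runs_mono)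
next
  case (PFor x y p)
  let ?w = "While (ILess (IV x) (IV y)) (Seq (compile p) (ISet x (IConst 0) (IAdd (IV x) (IConst 1))))"
  let ?m = "nat (iv s y)"
  have xy: "x \<noteq> y" "y \<notin> iw p" "x \<notin> iw p" using PFor.prems by auto
  have 1: "runs ?w (iupdate x 0 0 s) (forloop (den p) x 0 ?m (iupdate x 0 0 s)) (?m * (ptime p M + 12) + 6)"
  proof (rule runs_forloop[where X = "insert x (iw p)" and Y = "rw p" and ?s0.0 = s and f = "den p"])
    fix s' assume "agree (insert x (iw p)) (rw p) s s'"
    then have eq: "fst s' v = fst s v" if "v \<in> bvars p" for v
      by (rule agree_fst) (use that PFor.prems(2) in auto)
    show "runs (compile p) s' (den p s') (ptime p M)"
    proof (rule PFor.IH)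
      show "\<bar>iv s' v\<bar> \<le> int M" if "v \<in> bvars p" for v
        using PFor.prems(3)[of v] that by (simp add: eq[OF that])
    qed (use PFor.prems in auto)
  next
    fix s s' assume "s' \<in> set_pmf (den p s)"
    from den_agree[OF this] show "agree (insert x (iw p) - {x}) (rw p) s s'"
      by (simp add: xy)
  qed (use xy in \<open>simp_all add: agree_iupdate\<close>)
  have "terminates (ISet x (IConst 0) (IConst 0)) s (return_pmf (iupdate x 0 0 s, 3))"
    using terminates.ISet[of x "IConst 0" "IConst 0" s] by (simp add: eval_nat_numeral)
  then have "runs (ISet x (IConst 0) (IConst 0)) s (return_pmf (iupdate x 0 0 s)) 3"
    by (rule runsI) auto
  from runs_Seq[OF this, of ?w "\<lambda>s'. forloop (den p) x 0 ?m s'" "?m * (ptime p M + 12) + 6"] 1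
  have "runs (compile (PFor x y p)) s (den (PFor x y p) s) (3 + (?m * (ptime p M + 12) + 6))"
    by (simp add: bind_return_pmf)
  moreover have "3 + (?m * (ptime p M + 12) + 6) \<le> ptime (PFor x y p) M"
  proof -
    have "?m \<le> M" using PFor.prems(3)[of y] by simp
    then have "3 + (?m * (ptime p M + 12) + 6) \<le> 9 + M * (ptime p M + 12)" by simp
    also have "\<dots> \<le> (M + 1) * (ptime p M + 21)" by (simp add: algebra_simps)
    also have "\<dots> \<le> (M + 1) * (ptime p M + 21 * (M + 1) ^ depth p)"
      by (intro mult_left_mono add_left_mono) auto
    also have "\<dots> = ptime (PFor x y p) M" by (simp add: ptime_def algebra_simps)
    finally show ?thesis .
  qed
  ultimately show ?case by (rule runs_mono)
qed

subsection \<open>Properties of all outcomes\<close>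

definition ensures :: "prog \<Rightarrow> state \<Rightarrow> (state \<Rightarrow> bool) \<Rightarrow> bool" where
  "ensures p s Q \<longleftrightarrow> (\<forall>s'\<in>set_pmf (den p s). Q s')"

lemma ensures_simps [simp]:
  "ensures PSkip s Q = Q s"
  "ensures (PI x e e') s Q = Q (iupdate x (ival e s) (ival e' s) s)"
  "ensures (PR x e r) s Q = Q (rupdate x (ival e s) (rval r s) s)"
  "ensures (PSeq p p') s Q = ensures p s (\<lambda>s'. ensures p' s' Q)"
  "ensures (PIf b p p') s Q = (if bval b s then ensures p s Q else ensures p' s Q)"
  by (auto simp: ensures_def)

lemma ensures_conseq:
  assumes "ensures p s R" "\<And>s'. R s' \<Longrightarrow> agree (iw p) (rw p) s s' \<Longrightarrow> Q s'"
  shows "ensures p s Q"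
  using assms den_agree unfolding ensures_def by blast

lemma ensures_agree: "ensures p s (agree (iw p) (rw p) s)"
  using den_agree unfolding ensures_def by blast

lemma ensuresD: "ensures p s Q \<Longrightarrow> s' \<in> set_pmf (den p s) \<Longrightarrow> Q s'"
  by (simp add: ensures_def)

lemma forloop_invariant:
  assumes "\<And>j s s'. i \<le> j \<Longrightarrow> j < i + m \<Longrightarrow> I j s \<Longrightarrow> iv s x = int j \<Longrightarrow> s' \<in> set_pmf (f s) \<Longrightarrow>
      I (Suc j) (iupdate x 0 (int (Suc j)) s')"
    and "I i s" "iv s x = int i"
  shows "s' \<in> set_pmf (forloop f x i m s) \<Longrightarrow> I (i + m) s'"
  using assms
proof (induction m arbitrary: i s)
  case (Suc m)
  from Suc.prems(1) obtain s1 where s1: "s1 \<in> set_pmf (f s)"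
      "s' \<in> set_pmf (forloop f x (Suc i) m (iupdate x 0 (int (Suc i)) s1))" by auto
  have "I (Suc i + m) s'"
  proof (rule Suc.IH[OF s1(2)])
    fix j t t'
    assume "Suc i \<le> j" "j < Suc i + m" "I j t" "iv t x = int j" "t' \<in> set_pmf (f t)"
    then show "I (Suc j) (iupdate x 0 (int (Suc j)) t')"
      using Suc.prems(2)[of j t t'] by simp
  next
    show "I (Suc i) (iupdate x 0 (int (Suc i)) s1)"
      using Suc.prems(2)[of i s s1] Suc.prems(3,4) s1(1) by simp
  qed simp
  then show ?case by simp
qed simp

text \<open>The frame is supplied by the rule, so an invariant has to mention only arrays that the
  body writes; everything else is recovered from \<open>agree\<close>.\<close>

lemma ensures_PFor:
  assumes "m = nat (iv s y)"
    and "I 0 (iupdate x 0 0 s)"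
    and "\<And>i s'. i < m \<Longrightarrow> I i s' \<Longrightarrow> iv s' x = int i \<Longrightarrow> agree (insert x (iw p)) (rw p) s s' \<Longrightarrow>
        ensures p s' (\<lambda>s''. I (Suc i) (iupdate x 0 (int (Suc i)) s''))"
    and "\<And>s'. I m s' \<Longrightarrow> agree (insert x (iw p)) (rw p) s s' \<Longrightarrow> Q s'"
  shows "ensures (PFor x y p) s Q"
  unfolding ensures_def
proof
  fix s' assume s': "s' \<in> set_pmf (den (PFor x y p) s)"
  define J where "J i t \<longleftrightarrow> I i t \<and> agree (insert x (iw p)) (rw p) s t" for i t
  have "J (0 + m) s'"
  proof (rule forloop_invariant)
    show "s' \<in> set_pmf (forloop (den p) x 0 m (iupdate x 0 0 s))"
      using s' assms(1) by simp
    show "J 0 (iupdate x 0 0 s)" using assms(2) by (simp add: J_def agree_iupdate)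
    fix j t t' assume j: "j < 0 + m" "J j t" "iv t x = int j" "t' \<in> set_pmf (den p t)"
    have "agree (insert x (iw p)) (rw p) t t'"
      by (rule agree_mono[OF den_agree[OF j(4)]]) auto
    then have "agree (insert x (iw p)) (rw p) s (iupdate x 0 (int (Suc j)) t')"
      using j(2) unfolding J_def by (metis agree_trans agree_iupdate insertI1)
    then show "J (Suc j) (iupdate x 0 (int (Suc j)) t')"
      using assms(3)[of j t] j by (auto simp: J_def ensures_def)
  qed simp
  then show "Q s'" using assms(4) by (simp add: J_def)
qed

subsection \<open>Lower bounds on probabilities\<close>

definition likely :: "real \<Rightarrow> prog \<Rightarrow> state \<Rightarrow> (state \<Rightarrow> bool) \<Rightarrow> bool" where
  "likely \<pi> p s Q \<longleftrightarrow> \<pi> \<le> measure_pmf.prob (den p s) {s'. Q s'}"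

lemma likely_ensures: "ensures p s Q \<Longrightarrow> likely 1 p s Q"
  unfolding likely_def ensures_def
  by (subst measure_pmf.prob_eq_1[THEN iffD2]) (auto intro: AE_pmfI)

lemma likely_mono:
  assumes "likely \<pi> p s R" "\<And>s'. s' \<in> set_pmf (den p s) \<Longrightarrow> R s' \<Longrightarrow> Q s'" "\<pi>' \<le> \<pi>"
  shows "likely \<pi>' p s Q"
proof -
  have "measure_pmf.prob (den p s) {s'. R s'} \<le> measure_pmf.prob (den p s) {s'. Q s'}"
    by (rule measure_pmf.finite_measure_mono_AE) (use assms(2) in \<open>auto intro: AE_pmfI\<close>)
  then show ?thesis using assms(1,3) by (simp add: likely_def)
qed

lemma prob_bind_pmf:
  "measure_pmf.prob (bind_pmf p f) A = measure_pmf.expectation p (\<lambda>x. measure_pmf.prob (f x) A)"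
proof -
  have "emeasure (measure_pmf (bind_pmf p f)) A = \<integral>\<^sup>+x. emeasure (measure_pmf (f x)) A \<partial>measure_pmf p"
    by (rule emeasure_bind_pmf)
  also have "\<dots> = \<integral>\<^sup>+x. ennreal (measure_pmf.prob (f x) A) \<partial>measure_pmf p"
    by (simp add: measure_pmf.emeasure_eq_measure)
  also have "\<dots> = ennreal (measure_pmf.expectation p (\<lambda>x. measure_pmf.prob (f x) A))"
    by (intro nn_integral_eq_integral measure_pmf.integrable_const_bound[where B = 1]) auto
  finally show ?thesis by (simp add: measure_pmf.emeasure_eq_measure)
qed

text \<open>Outcomes outside the good event contribute at least 0 to the expectation. Hence bounds
  on success probabilities multiply along a program, although later choices depend on earlier
  ones.\<close>

lemma prob_bind_pmf_ge:
  assumes "\<pi> \<le> measure_pmf.prob p {x. R x}" "0 \<le> \<pi>'"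
    and "\<And>x. x \<in> set_pmf p \<Longrightarrow> R x \<Longrightarrow> \<pi>' \<le> measure_pmf.prob (f x) A"
  shows "\<pi> * \<pi>' \<le> measure_pmf.prob (bind_pmf p f) A"
proof -
  have "\<pi> * \<pi>' \<le> measure_pmf.prob p {x. R x} * \<pi>'"
    using assms(1,2) by (rule mult_right_mono)
  also have "\<dots> = measure_pmf.expectation p (\<lambda>x. \<pi>' * indicator {x. R x} x)"
    by simp
  also have "\<dots> \<le> measure_pmf.expectation p (\<lambda>x. measure_pmf.prob (f x) A)"
  proof (rule integral_mono_AE)
    show "integrable (measure_pmf p) (\<lambda>x. measure_pmf.prob (f x) A)"
      by (rule measure_pmf.integrable_const_bound[where B = 1]) auto
    show "AE x in measure_pmf p. \<pi>' * indicator {x. R x} x \<le> measure_pmf.prob (f x) A"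
      using assms(3) by (auto intro!: AE_pmfI simp: indicator_def)
    show "integrable (measure_pmf p) (\<lambda>x. \<pi>' * indicator {x. R x} x :: real)"
      by (rule measure_pmf.integrable_const_bound[where B = \<pi>']) (use assms(2) in \<open>auto simp: indicator_def\<close>)
  qed
  also have "\<dots> = measure_pmf.prob (bind_pmf p f) A"
    by (simp add: prob_bind_pmf)
  finally show ?thesis .
qed

lemma likely_PSeq:
  assumes "likely \<pi> p s R" "0 \<le> \<pi>'"
    and "\<And>s'. R s' \<Longrightarrow> agree (iw p) (rw p) s s' \<Longrightarrow> likely \<pi>' p' s' Q"
  shows "likely (\<pi> * \<pi>') (PSeq p p') s Q"
  unfolding likely_def den.simps
  by (rule prob_bind_pmf_ge[where R = R])
    (use assms den_agree in \<open>auto simp: likely_def\<close>)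

lemma likely_PSeq_ensures:
  assumes "likely \<pi> p s R" "0 \<le> \<pi>"
    and "\<And>s'. R s' \<Longrightarrow> agree (iw p) (rw p) s s' \<Longrightarrow> ensures p' s' Q"
  shows "likely \<pi> (PSeq p p') s Q"
proof -
  have "likely (\<pi> * 1) (PSeq p p') s Q"
    by (rule likely_PSeq[OF assms(1)]) (simp, rule likely_ensures, rule assms(3))
  then show ?thesis by simp
qed

lemma likely_ensures_PSeq:
  assumes "ensures p s R" "0 \<le> \<pi>"
    and "\<And>s'. R s' \<Longrightarrow> agree (iw p) (rw p) s s' \<Longrightarrow> likely \<pi> p' s' Q"
  shows "likely \<pi> (PSeq p p') s Q"
proof -
  have "likely (1 * \<pi>) (PSeq p p') s Q"
    by (rule likely_PSeq[OF likely_ensures[OF assms(1)] assms(2) assms(3)])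
  then show ?thesis by simp
qed

lemma likely_PRand_set:
  assumes "0 < iv s y" "finite V" "V \<subseteq> {0..<iv s y}" "\<And>v. v \<in> V \<Longrightarrow> Q (iupdate x 0 v s)"
  shows "likely (real (card V) / iv s y) (PRand x y) s Q"
proof -
  have "real (card V) / iv s y = measure_pmf.prob (pmf_of_set {0..<iv s y}) V"
    using assms(1-3) by (subst measure_pmf_of_set) (auto simp: Int_absorb1)
  also have "\<dots> \<le> measure_pmf.prob (pmf_of_set {0..<iv s y}) {v. Q (iupdate x 0 v s)}"
    by (rule measure_pmf.finite_measure_mono) (use assms(4) in auto)
  also have "\<dots> = measure_pmf.prob (den (PRand x y) s) {s'. Q s'}"
    using assms(1) by (simp add: rand_below_def vimage_def)
  finally show ?thesis by (simp add: likely_def)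
qed

lemma likely_PRand:
  assumes "0 \<le> v" "v < iv s y" "Q (iupdate x 0 v s)"
  shows "likely (1 / iv s y) (PRand x y) s Q"
  using likely_PRand_set[of s y "{v}" Q x] assms by simp

lemma likely_forloop:
  assumes "0 \<le> \<pi>"
    and "\<And>j s. i \<le> j \<Longrightarrow> j < i + m \<Longrightarrow> I j s \<Longrightarrow> iv s x = int j \<Longrightarrow>
      \<pi> \<le> measure_pmf.prob (f s) {s'. I (Suc j) (iupdate x 0 (int (Suc j)) s')}"
    and "I i s" "iv s x = int i"
  shows "\<pi> ^ m \<le> measure_pmf.prob (forloop f x i m s) {s'. I (i + m) s'}"
  using assms(2-)
proof (induction m arbitrary: i s)
  case 0
  then show ?case by simp
next
  case (Suc m)
  show ?case
    unfolding forloop.simps power_Suc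
  proof (rule prob_bind_pmf_ge)
    show "\<pi> \<le> measure_pmf.prob (f s) {s'. I (Suc i) (iupdate x 0 (int (Suc i)) s')}"
      by (rule Suc.prems(1)) (use Suc.prems in auto)
    show "0 \<le> \<pi> ^ m" using assms(1) by simp
    fix s' assume *: "I (Suc i) (iupdate x 0 (int (Suc i)) s')"
    have "\<pi> ^ m \<le> measure_pmf.prob (forloop f x (Suc i) m (iupdate x 0 (int (Suc i)) s'))
        {s'. I (Suc i + m) s'}"
      by (rule Suc.IH) (use Suc.prems(1) * in auto)
    then show "\<pi> ^ m \<le> measure_pmf.prob (forloop f x (Suc i) m (iupdate x 0 (int (Suc i)) s'))
        {s'. I (i + Suc m) s'}" by simp
  qed
qed

lemma likely_PFor:
  assumes "m = nat (iv s y)" "0 \<le> \<pi>"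
    and "I 0 (iupdate x 0 0 s)"
    and "\<And>i s'. i < m \<Longrightarrow> I i s' \<Longrightarrow> iv s' x = int i \<Longrightarrow> agree (insert x (iw p)) (rw p) s s' \<Longrightarrow>
        likely \<pi> p s' (\<lambda>s''. I (Suc i) (iupdate x 0 (int (Suc i)) s''))"
  shows "likely (\<pi> ^ m) (PFor x y p) s (I m)"
proof -
  define J where "J i t \<longleftrightarrow> I i t \<and> agree (insert x (iw p)) (rw p) s t" for i t
  have "\<pi> ^ m \<le> measure_pmf.prob (forloop (den p) x 0 m (iupdate x 0 0 s)) {s'. J (0 + m) s'}"
  proof (rule likely_forloop[OF assms(2)])
    show "J 0 (iupdate x 0 0 s)" using assms(3) by (simp add: J_def agree_iupdate)
    fix j t assume j: "j < 0 + m" "J j t" "iv t x = int j"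
    have "likely \<pi> p t (\<lambda>t'. I (Suc j) (iupdate x 0 (int (Suc j)) t'))"
      using assms(4)[of j t] j by (auto simp: J_def)
    then have "likely \<pi> p t (\<lambda>t'. J (Suc j) (iupdate x 0 (int (Suc j)) t'))"
    proof (rule likely_mono)
      fix t' assume t': "t' \<in> set_pmf (den p t)" "I (Suc j) (iupdate x 0 (int (Suc j)) t')"
      have "agree (insert x (iw p)) (rw p) t t'"
        by (rule agree_mono[OF den_agree[OF t'(1)]]) auto
      then have "agree (insert x (iw p)) (rw p) s (iupdate x 0 (int (Suc j)) t')"
        using j(2) unfolding J_def by (metis agree_trans agree_iupdate insertI1)
      then show "J (Suc j) (iupdate x 0 (int (Suc j)) t')" using t'(2) by (simp add: J_def)
    qed simp
    then show "\<pi> \<le> measure_pmf.prob (den p t) {t'. J (Suc j) (iupdate x 0 (int (Suc j)) t')}"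
      by (simp add: likely_def)
  qed simp
  then have "likely (\<pi> ^ m) (PFor x y p) s (J m)"
    using assms(1) by (simp add: likely_def)
  then show ?thesis by (rule likely_mono) (auto simp: J_def)
qed

text \<open>\<open>K\<close> is an invariant and \<open>G\<close> is never lost once reached. The
  remaining rounds succeed with probability at least \<open>1 - (1 - \<pi>) ^ m\<close> in any case
  and surely after a successful first round; so the first round gains \<open>(1 - \<pi>) ^ m\<close>
  with probability at least \<pi>.\<close>

lemma forloop_repeat:
  assumes "0 \<le> \<pi>" "\<pi> \<le> 1"
    and inv: "\<And>s s' j. K s \<Longrightarrow> s' \<in> set_pmf (f s) \<Longrightarrow> K (iupdate x 0 j s')"
    and good: "\<And>s s' j. K s \<Longrightarrow> G s \<Longrightarrow> s' \<in> set_pmf (f s) \<Longrightarrow> G (iupdate x 0 j s')"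
    and "\<And>s j. K s \<Longrightarrow> \<pi> \<le> measure_pmf.prob (f s) {s'. G (iupdate x 0 j s')}"
    and "K s"
  shows "1 - (1 - \<pi>) ^ m \<le> measure_pmf.prob (forloop f x i m s) {s'. G s'}"
  using assms(6)
proof (induction m arbitrary: i s)
  case 0
  then show ?case by simp
next
  case (Suc m)
  have stay: "measure_pmf.prob (forloop f x i m s) {s'. G s'} = 1" if "K s" "G s" for i m s
  proof -
    have "s' \<in> set_pmf (forloop f x i m s) \<Longrightarrow> K s' \<and> G s'" for s'
      using that
    proof (induction m arbitrary: i s)
      case (Suc m)
      then obtain s1 where s1: "s1 \<in> set_pmf (f s)"
        "s' \<in> set_pmf (forloop f x (Suc i) m (iupdate x 0 (int (Suc i)) s1))" by auto
      show ?case
        by (rule Suc.IH[OF s1(2)]) (use inv good s1(1) Suc.prems in blast)+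
    qed simp
    then show ?thesis by (subst measure_pmf.prob_eq_1) (auto intro: AE_pmfI)
  qed
  let ?g = "\<lambda>s'. iupdate x 0 (int (Suc i)) s'"
  let ?A = "{s'. G (?g s')}"
  let ?P = "measure_pmf.prob (f s) ?A"
  have le1: "(1 - \<pi>) ^ m \<le> 1" using assms(1,2) by (intro power_le_one) auto
  have le0: "0 \<le> (1 - \<pi>) ^ m" using assms(2) by simp
  have "1 - (1 - \<pi>) ^ Suc m = \<pi> + (1 - \<pi>) * (1 - (1 - \<pi>) ^ m)"
    by (simp add: algebra_simps)
  also have "\<dots> = 1 - (1 - \<pi>) ^ m + \<pi> * (1 - \<pi>) ^ m" by (simp add: algebra_simps)
  also have "\<dots> \<le> 1 - (1 - \<pi>) ^ m + ?P * (1 - \<pi>) ^ m"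
    using assms(5)[OF Suc.prems, of "int (Suc i)"] assms(2) by (intro add_left_mono mult_right_mono) auto
  also have "\<dots> = measure_pmf.expectation (f s)
      (\<lambda>s'. (1 - (1 - \<pi>) ^ m) + (1 - \<pi>) ^ m * indicator ?A s')"
  proof -
    have "integrable (measure_pmf (f s)) (\<lambda>s'. (1 - \<pi>) ^ m * indicator ?A s' :: real)"
      by (rule measure_pmf.integrable_const_bound[where B = 1])
        (use le1 le0 in \<open>auto simp: indicator_def\<close>)
    then show ?thesis by (subst Bochner_Integration.integral_add) auto
  qed
  also have "\<dots> \<le> measure_pmf.expectation (f s)
      (\<lambda>s'. measure_pmf.prob (forloop f x (Suc i) m (?g s')) {s'. G s'})"
  proof (rule integral_mono_AE)
    show "integrable (measure_pmf (f s)) (\<lambda>s'. measure_pmf.prob (forloop f x (Suc i) m (?g s')) {s'. G s'})"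
      by (rule measure_pmf.integrable_const_bound[where B = 1]) auto
    show "AE s' in measure_pmf (f s). (1 - (1 - \<pi>) ^ m) + (1 - \<pi>) ^ m * indicator ?A s'
        \<le> measure_pmf.prob (forloop f x (Suc i) m (?g s')) {s'. G s'}"
    proof (rule AE_pmfI)
      fix s' assume "s' \<in> set_pmf (f s)"
      then have K: "K (?g s')" using inv Suc.prems by blast
      show "(1 - (1 - \<pi>) ^ m) + (1 - \<pi>) ^ m * indicator ?A s'
          \<le> measure_pmf.prob (forloop f x (Suc i) m (?g s')) {s'. G s'}"
        using Suc.IH[OF K, of "Suc i"] stay[OF K] by (auto simp: indicator_def)
    qed
    show "integrable (measure_pmf (f s)) (\<lambda>s'. (1 - (1 - \<pi>) ^ m) + (1 - \<pi>) ^ m * indicator ?A s')"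
      by (rule measure_pmf.integrable_const_bound[where B = 1])
        (use le1 le0 in \<open>auto simp: indicator_def\<close>)
  qed
  also have "\<dots> = measure_pmf.prob (forloop f x i (Suc m) s) {s'. G s'}"
    by (simp add: prob_bind_pmf)
  finally show ?case .
qed

lemma likely_PFor_repeat:
  assumes "m = nat (iv s y)" "0 \<le> \<pi>" "\<pi> \<le> 1"
    and upd: "\<And>s j. K s \<Longrightarrow> K (iupdate x 0 j s)" "\<And>s j. G s \<Longrightarrow> G (iupdate x 0 j s)"
    and "K s"
    and "\<And>s. K s \<Longrightarrow> ensures p s K"
    and "\<And>s. K s \<Longrightarrow> G s \<Longrightarrow> ensures p s G"
    and "\<And>s. K s \<Longrightarrow> likely \<pi> p s G"
  shows "likely (1 - (1 - \<pi>) ^ m) (PFor x y p) s G"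
  unfolding likely_def den.simps assms(1)[symmetric]
proof (rule forloop_repeat[where K = K])
  fix s j assume "K s"
  from assms(9)[OF this] have "likely \<pi> p s (\<lambda>s'. G (iupdate x 0 j s'))"
    by (rule likely_mono) (use upd in auto)
  then show "\<pi> \<le> measure_pmf.prob (den p s) {s'. G (iupdate x 0 j s')}"
    by (simp add: likely_def)
next
  fix s s' j assume "K s" "s' \<in> set_pmf (den p s)"
  then show "K (iupdate x 0 j s')" using assms(7) upd(1) by (meson ensuresD)
next
  fix s s' j assume "K s" "G s" "s' \<in> set_pmf (den p s)"
  then show "G (iupdate x 0 j s')" using assms(8) upd(2) by (meson ensuresD)
qed (use assms(2,3) upd(1)[OF \<open>K s\<close>] in simp_all)

section \<open>Optimal capacitated assignments\<close>

definition load :: "'a set \<Rightarrow> ('a \<Rightarrow> 'b) \<Rightarrow> 'b \<Rightarrow> nat" where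
  "load A \<rho> f = card {a \<in> A. \<rho> a = f}"

definition obeys :: "'a set \<Rightarrow> 'b set \<Rightarrow> ('b \<Rightarrow> nat) \<Rightarrow> ('a \<Rightarrow> 'b) \<Rightarrow> bool" where
  "obeys A S u \<rho> \<longleftrightarrow> \<rho> ` A \<subseteq> S \<and> (\<forall>f\<in>S. load A \<rho> f \<le> u f)"

definition assign_cost :: "('a \<Rightarrow> 'b \<Rightarrow> real) \<Rightarrow> 'a set \<Rightarrow> ('a \<Rightarrow> 'b) \<Rightarrow> real" where
  "assign_cost w A \<rho> = (\<Sum>a\<in>A. w a (\<rho> a))"

text \<open>By injectivity at most one client of \<open>D\<close> leaves a center and at most one
  enters it. The equation is additive because subtraction of natural numbers truncates.\<close>

lemma load_override:
  assumes "finite A" "D \<subseteq> A" "inj_on \<rho> D" "inj_on \<sigma> D"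
  shows "load A (\<lambda>a. if a \<in> D then \<sigma> a else \<rho> a) f + of_bool (f \<in> \<rho> ` D)
    = load A \<rho> f + of_bool (f \<in> \<sigma> ` D)"
proof -
  have *: "card {a \<in> D. \<rho> a = f} = of_bool (f \<in> \<rho> ` D)" if "inj_on \<rho> D" for \<rho> :: "'a \<Rightarrow> 'b"
  proof (cases "f \<in> \<rho> ` D")
    case True
    then obtain a where "a \<in> D" "f = \<rho> a" by auto
    then have "{a \<in> D. \<rho> a = f} = {a}" using that by (auto dest: inj_onD)
    then show ?thesis using True by simp
  next
    case False
    then have "{a \<in> D. \<rho> a = f} = {}" by auto
    then have "card {a \<in> D. \<rho> a = f} = 0" by (simp only: card.empty)
    then show ?thesis using False by simp
  qed
  have split: "load A \<tau> f = card {a \<in> A - D. \<tau> a = f} + card {a \<in> D. \<tau> a = f}" for \<tau>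
  proof -
    have "{a \<in> A. \<tau> a = f} = {a \<in> A - D. \<tau> a = f} \<union> {a \<in> D. \<tau> a = f}" using assms(2) by auto
    then show ?thesis unfolding load_def
      using assms(1,2) by (subst card_Un_disjoint[symmetric]) (auto intro: finite_subset)
  qed
  let ?\<tau> = "\<lambda>a. if a \<in> D then \<sigma> a else \<rho> a"
  have "{a \<in> A - D. ?\<tau> a = f} = {a \<in> A - D. \<rho> a = f}" "{a \<in> D. ?\<tau> a = f} = {a \<in> D. \<sigma> a = f}" by auto
  then show ?thesis
    unfolding split[of ?\<tau>] split[of \<rho>] by (simp add: *[OF assms(3)] *[OF assms(4)])
qed

lemma assign_cost_override:
  assumes "finite A" "D \<subseteq> A"
  shows "assign_cost w A (\<lambda>a. if a \<in> D then \<sigma> a else \<rho> a)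
    = assign_cost w A \<rho> + (\<Sum>a\<in>D. w a (\<sigma> a) - w a (\<rho> a))"
proof -
  have "assign_cost w A (\<lambda>a. if a \<in> D then \<sigma> a else \<rho> a) - assign_cost w A \<rho>
      = (\<Sum>a\<in>A. if a \<in> D then w a (\<sigma> a) - w a (\<rho> a) else 0)"
    unfolding assign_cost_def sum_subtractf[symmetric] by (rule sum.cong) auto
  also have "\<dots> = (\<Sum>a\<in>D. w a (\<sigma> a) - w a (\<rho> a))"
    using assms by (simp add: sum.If_cases Int_absorb1)
  finally show ?thesis by simp
qed

lemma load_insert:
  assumes "finite A" "c \<notin> A"
  shows "load (insert c A) \<rho> f = load A \<rho> f + of_bool (\<rho> c = f)"
proof -
  have "{a \<in> insert c A. \<rho> a = f} = (if \<rho> c = f then insert c {a \<in> A. \<rho> a = f} else {a \<in> A. \<rho> a = f})"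
    by auto
  then show ?thesis using assms by (simp add: load_def)
qed

lemma load_cong: "(\<And>a. a \<in> A \<Longrightarrow> \<rho> a = \<rho>' a) \<Longrightarrow> load A \<rho> f = load A \<rho>' f"
  unfolding load_def by (rule arg_cong[where f = card]) auto

lemma assign_cost_cong: "(\<And>a. a \<in> A \<Longrightarrow> \<rho> a = \<rho>' a) \<Longrightarrow> assign_cost w A \<rho> = assign_cost w A \<rho>'"
  unfolding assign_cost_def by (rule sum.cong) auto

lemma obeys_cong: "(\<And>a. a \<in> A \<Longrightarrow> \<rho> a = \<rho>' a) \<Longrightarrow> obeys A S u \<rho> = obeys A S u \<rho>'"
  unfolding obeys_def using load_cong[of A \<rho> \<rho>'] by (simp cong: image_cong)

lemma obeys_subset:
  assumes "obeys A S u \<rho>" "B \<subseteq> A" "finite A"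
  shows "obeys B S u \<rho>"
proof -
  have "load B \<rho> f \<le> load A \<rho> f" for f
    unfolding load_def using assms(2,3) by (intro card_mono) auto
  then show ?thesis using assms(1,2) unfolding obeys_def by (meson image_mono order_trans)
qed

text \<open>
  An optimal assignment of \<open>A\<close> becomes an optimal assignment of \<open>insert c A\<close> by giving \<open>c\<close> to some
  center \<open>g\<close> and moving one client from each center \<open>h\<close> to \<open>mov h\<close>, and the client to be moved
  is the one for which this is cheapest. Indeed, let \<open>\<sigma>\<close> be an optimal assignment of \<open>insert c A\<close>
  that is as close as possible to \<open>\<rho>\<close>. In the multigraph with an edge from \<open>\<rho> a\<close> to \<open>\<sigma> a\<close> for
  every \<open>a\<close>, the closest choice of \<open>\<sigma>\<close> precludes cycles, so there is a path from \<open>\<sigma> c\<close> to a sink,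
  where capacity must be available.
\<close>

definition reroute :: "('b \<Rightarrow> 'a) \<Rightarrow> ('b \<Rightarrow> 'b) \<Rightarrow> 'a \<Rightarrow> 'b \<Rightarrow> ('a \<Rightarrow> 'b) \<Rightarrow> 'a \<Rightarrow> 'b" where
  "reroute \<beta> mov c g \<rho> a = (if a = c then g else if \<beta> (\<rho> a) = a then mov (\<rho> a) else \<rho> a)"

definition cheapest :: "('a \<Rightarrow> 'b \<Rightarrow> real) \<Rightarrow> 'a set \<Rightarrow> ('a \<Rightarrow> 'b) \<Rightarrow> ('b \<Rightarrow> 'b) \<Rightarrow> 'b \<Rightarrow> 'a \<Rightarrow> bool" where
  "cheapest w A \<rho> mov h b \<longleftrightarrow> b \<in> A \<and> \<rho> b = h \<and>
     (\<forall>a\<in>A. \<rho> a = h \<longrightarrow> w b (mov h) - w b h \<le> w a (mov h) - w a h)"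

lemma insertion_step:
  fixes w :: "'a \<Rightarrow> 'b \<Rightarrow> real"
  assumes fin: "finite A" and c: "c \<notin> A"
    and \<rho>: "obeys A S u \<rho>"
    and opt: "\<And>\<rho>'. obeys A S u \<rho>' \<Longrightarrow> assign_cost w A \<rho> \<le> assign_cost w A \<rho>'"
    and \<rho>0: "obeys (insert c A) S u \<rho>0"
  obtains g mov where "g \<in> S" "mov ` S \<subseteq> S"
    "\<And>\<beta>. (\<And>h. h \<in> S \<Longrightarrow> h \<in> \<rho> ` A \<Longrightarrow> cheapest w A \<rho> mov h (\<beta> h)) \<Longrightarrow>
       obeys (insert c A) S u (reroute \<beta> mov c g \<rho>) \<and>
       assign_cost w (insert c A) (reroute \<beta> mov c g \<rho>) \<le> assign_cost w (insert c A) \<rho>0"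
proof -
  \<comment> \<open>Among all assignments that are as good as \<open>\<rho>0\<close>, one is taken
    that differs from \<rho> in as few clients as possible.\<close>
  define diff where "diff \<sigma> = card {a \<in> A. \<rho> a \<noteq> \<sigma> a}" for \<sigma>
  define P where "P \<sigma> \<longleftrightarrow> obeys (insert c A) S u \<sigma> \<and>
      assign_cost w (insert c A) \<sigma> \<le> assign_cost w (insert c A) \<rho>0" for \<sigma>
  have "P \<rho>0" using \<rho>0 by (simp add: P_def)
  from ex_has_least_nat[of P, OF this, of diff]
  obtain \<sigma> where \<sigma>: "P \<sigma>" and least: "\<And>\<sigma>'. P \<sigma>' \<Longrightarrow> diff \<sigma> \<le> diff \<sigma>'" by blast
  have \<sigma>S: "\<sigma> a \<in> S" if "a \<in> insert c A" for a
    using \<sigma> that by (auto simp: P_def obeys_def)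
  have \<rho>S: "\<rho> a \<in> S" if "a \<in> A" for a using \<rho> that by (auto simp: obeys_def)
  \<comment> \<open>The multigraph is thinned out to a function: \<open>al h\<close> is one client
    that has to leave \<open>h\<close>, and \<open>nx h\<close> is the center to which it goes.
    Centers that no client leaves are fixed points, the sinks.\<close>
  define act where "act h \<longleftrightarrow> (\<exists>a\<in>A. \<rho> a = h \<and> \<sigma> a \<noteq> h)" for h
  define al where "al h = (SOME a. a \<in> A \<and> \<rho> a = h \<and> \<sigma> a \<noteq> h)" for h
  have al: "al h \<in> A" "\<rho> (al h) = h" "\<sigma> (al h) \<noteq> h" if "act h" for h
    using someI_ex[of "\<lambda>a. a \<in> A \<and> \<rho> a = h \<and> \<sigma> a \<noteq> h"] that unfolding act_def al_def by blast+
  define nx where "nx h = (if act h then \<sigma> (al h) else h)" for h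
  have acyclic: False if Z0: "Z0 \<noteq> {}" "Z0 \<subseteq> {h. act h}" "nx ` Z0 \<subseteq> Z0" for Z0
  proof -
    define C where "C Z \<longleftrightarrow> Z \<noteq> {} \<and> Z \<subseteq> {h. act h} \<and> nx ` Z \<subseteq> Z" for Z
    have "C Z0" using Z0 by (simp add: C_def)
    \<comment> \<open>On a closed set of least cardinality \<open>nx\<close> is a permutation, that
      is, a union of cycles. The clients \<open>al h\<close> of this set can then be exchanged
      without changing any load.\<close>
    from ex_has_least_nat[of C, OF this, of card]
    obtain Z where Z: "C Z" and minZ: "\<And>Z'. C Z' \<Longrightarrow> card Z \<le> card Z'" by blast
    have Zact: "act h" if "h \<in> Z" for h using Z that by (auto simp: C_def)
    have finZ: "finite Z"
      by (rule finite_subset[of _ "\<rho> ` A"]) (use Zact fin in \<open>auto simp: act_def\<close>)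
    have "C (nx ` Z)" using Z by (auto simp: C_def)
    with minZ have "card Z \<le> card (nx ` Z)" by blast
    then have eq: "nx ` Z = Z" using Z finZ by (intro card_seteq) (auto simp: C_def)
    then have injn: "inj_on nx Z" using finZ by (simp add: eq_card_imp_inj_on)
    define D where "D = al ` Z"
    have D: "D \<subseteq> A" using al Zact by (auto simp: D_def)
    have \<rho>D: "\<rho> ` D = Z" unfolding D_def image_image using al(2) Zact by auto
    have "\<sigma> ` D = nx ` Z" unfolding D_def image_image using Zact by (auto simp: nx_def)
    then have \<sigma>D: "\<sigma> ` D = Z" by (simp add: eq)
    have inj\<rho>: "inj_on \<rho> D" unfolding D_def using al(2) Zact by (auto intro!: inj_onI)
    have inj\<sigma>: "inj_on \<sigma> D"
      unfolding D_def by (rule inj_on_imageI) (use injn Zact in \<open>simp add: inj_on_def nx_def\<close>)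
    let ?\<sigma> = "\<lambda>a. if a \<in> D then \<rho> a else \<sigma> a" and ?\<rho> = "\<lambda>a. if a \<in> D then \<sigma> a else \<rho> a"
    have "load (insert c A) ?\<sigma> f = load (insert c A) \<sigma> f" for f
      using load_override[of "insert c A" D \<sigma> \<rho> f] fin D inj\<rho> inj\<sigma> by (auto simp: \<rho>D \<sigma>D)
    then have r1: "obeys (insert c A) S u ?\<sigma>"
      using \<sigma> \<rho>S D \<sigma>S by (auto simp: P_def obeys_def)
    have "load A ?\<rho> f = load A \<rho> f" for f
      using load_override[of A D \<rho> \<sigma> f] fin D inj\<rho> inj\<sigma> by (auto simp: \<rho>D \<sigma>D)
    then have "obeys A S u ?\<rho>" using \<rho> \<rho>S D \<sigma>S by (auto simp: obeys_def)
    \<comment> \<open>Rotating \<rho> forward along the cycles cannot gain, as \<rho> is optimal; so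
      rotating \<sigma> back cannot lose. But this brings \<sigma> closer to \<rho>, against its
      choice.\<close>
    from opt[OF this] have "0 \<le> (\<Sum>a\<in>D. w a (\<sigma> a) - w a (\<rho> a))"
      using assign_cost_override[OF fin D, of w \<sigma> \<rho>] by simp
    then have "(\<Sum>a\<in>D. w a (\<rho> a) - w a (\<sigma> a)) \<le> 0" by (simp add: sum_subtractf)
    then have "P ?\<sigma>"
      using r1 \<sigma> assign_cost_override[OF _ subset_insertI2[OF D], of c w \<rho> \<sigma>] fin by (auto simp: P_def)
    from least[OF this] have 1: "diff \<sigma> \<le> diff ?\<sigma>" .
    obtain h where h: "h \<in> Z" using Z by (auto simp: C_def)
    have "{a \<in> A. \<rho> a \<noteq> ?\<sigma> a} \<subset> {a \<in> A. \<rho> a \<noteq> \<sigma> a}"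
      using al[OF Zact[OF h]] h by (auto simp: D_def split: if_splits)
    then have "diff ?\<sigma> < diff \<sigma>" unfolding diff_def using fin by (intro psubset_card_mono) auto
    with 1 show False by simp
  qed
  \<comment> \<open>The walk that starts where \<sigma> puts the new client. As no set of active
    centers is closed under \<open>nx\<close>, it reaches a sink, and up to the first sink it is a
    simple path.\<close>
  define v where "v i = (nx ^^ i) (\<sigma> c)" for i :: nat
  have vSuc: "v (Suc i) = nx (v i)" for i by (simp add: v_def)
  have "\<exists>m. \<not> act (v m)"
  proof (rule ccontr)
    assume "\<nexists>m. \<not> act (v m)"
    then show False by (intro acyclic[of "range v"]) (auto simp: vSuc[symmetric])
  qed
  define m where "m = (LEAST m. \<not> act (v m))"
  have m: "\<not> act (v m)" unfolding m_def by (rule LeastI_ex) fact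
  have lt: "act (v i)" if "i < m" for i using not_less_Least that unfolding m_def by blast
  have inj: "inj_on v {..m}"
  proof (rule linorder_inj_onI')
    fix i j assume ij: "i \<in> {..m}" "j \<in> {..m}" "i < j"
    show "v i \<noteq> v j"
    proof
      assume eq: "v i = v j"
      have "nx (v l) \<in> v ` {i..<j}" if "l \<in> {i..<j}" for l
      proof (cases "Suc l = j")
        case True
        then have "nx (v l) = v i" using eq vSuc[of l] by simp
        then show ?thesis using ij by auto
      next
        case False
        then show ?thesis using that vSuc[of l] by (metis Suc_le_eq atLeastLessThan_iff imageI le_SucI le_neq_implies_less)
      qed
      then show False
        using ij lt by (intro acyclic[of "v ` {i..<j}"]) auto
    qed
  qed
  define Q where "Q = v ` {..<m}"
  have Qact: "act h" if "h \<in> Q" for h using that lt by (auto simp: Q_def)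
  have finQ: "finite Q" by (simp add: Q_def)
  define mov where "mov h = (if h \<in> Q then nx h else h)" for h
  have vm: "v m \<notin> Q" using inj by (auto simp: Q_def dest!: inj_onD)
  have nQ: "nx ` Q = v ` {1..m}"
    unfolding Q_def image_image vSuc[symmetric] by (force simp: image_iff gr0_conv_Suc Suc_le_eq)
  have v0: "v 0 = \<sigma> c" by (simp add: v_def)
  \<comment> \<open>Balance along the path: the inner centers gain and lose one client, so that in
    the end only the sink has one client more.\<close>
  have vsplit: "of_bool (f \<in> v ` {1..m}) + of_bool (f = \<sigma> c) = (of_bool (f \<in> Q) + of_bool (f = v m) :: nat)" for f
  proof -
    have "v 0 \<notin> v ` {1..m}" using inj by (auto dest!: inj_onD)
    moreover have "insert (v 0) (v ` {1..m}) = insert (v m) Q"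
    proof -
      have "insert 0 {1..m} = insert m {..<m}" by auto
      then show ?thesis unfolding Q_def by (metis image_insert)
    qed
    ultimately show ?thesis using vm v0 by (auto simp: of_bool_def)
  qed
  have injnx: "inj_on nx Q"
  proof (rule inj_onI)
    fix g h assume "g \<in> Q" "h \<in> Q" and eq: "nx g = nx h"
    then obtain i j where ij: "i < m" "j < m" "g = v i" "h = v j" by (auto simp: Q_def)
    then have "v (Suc i) = v (Suc j)" using eq by (simp add: vSuc)
    then have "Suc i = Suc j" using inj_onD[OF inj, of "Suc i" "Suc j"] ij by simp
    then show "g = h" using ij by simp
  qed
  have nxS: "nx h \<in> S" if "h \<in> S" for h using that al(1) \<sigma>S by (auto simp: nx_def)
  show thesis
  proof (rule that[of "\<sigma> c" mov])
    show "\<sigma> c \<in> S" using \<sigma>S by simp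
    show "mov ` S \<subseteq> S" using nxS by (auto simp: mov_def)
    \<comment> \<open>The claim is made for every choice of cheapest clients, so the program may
      break ties in any way.\<close>
    fix \<beta> assume \<beta>: "\<And>h. h \<in> S \<Longrightarrow> h \<in> \<rho> ` A \<Longrightarrow> cheapest w A \<rho> mov h (\<beta> h)"
    have \<beta>Q: "cheapest w A \<rho> mov h (\<beta> h)" if "h \<in> Q" for h
      using \<beta>[of h] al(1,2)[OF Qact[OF that]] \<rho>S by force
    let ?\<tau> = "reroute \<beta> mov c (\<sigma> c) \<rho>"
    define E where "E = \<beta> ` Q"
    have E: "E \<subseteq> A" using \<beta>Q by (auto simp: E_def cheapest_def)
    have \<rho>\<beta>: "\<rho> (\<beta> h) = h" if "h \<in> Q" for h using \<beta>Q[OF that] by (simp add: cheapest_def)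
    have \<rho>E: "\<rho> ` E = Q" unfolding E_def image_image using \<rho>\<beta> by auto
    have inj\<rho>: "inj_on \<rho> E" unfolding E_def using \<rho>\<beta> by (auto intro!: inj_onI)
    have movE: "(\<lambda>a. mov (\<rho> a)) ` E = v ` {1..m}"
      unfolding image_image[of mov \<rho>, symmetric] \<rho>E nQ[symmetric] by (auto simp: mov_def)
    have injE: "inj_on (\<lambda>a. mov (\<rho> a)) E"
    proof (rule inj_onI)
      fix a b assume ab: "a \<in> E" "b \<in> E" "mov (\<rho> a) = mov (\<rho> b)"
      then have "\<rho> a \<in> Q" "\<rho> b \<in> Q" using \<rho>E by auto
      then have "\<rho> a = \<rho> b" using ab(3) inj_onD[OF injnx] by (simp add: mov_def)
      then show "a = b" using inj_onD[OF inj\<rho>] ab by blast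
    qed
    have \<tau>A: "?\<tau> a = (if a \<in> E then mov (\<rho> a) else \<rho> a)" if "a \<in> A" for a
    proof -
      have "a \<noteq> c" using that c by auto
      moreover have "\<beta> (\<rho> a) = a" if "a \<in> E" using that \<rho>\<beta> by (auto simp: E_def)
      moreover have "a \<in> E" if "\<beta> (\<rho> a) = a" "\<rho> a \<in> Q" using that by (metis E_def imageI)
      ultimately show ?thesis by (auto simp: reroute_def mov_def)
    qed
    have load\<tau>: "load (insert c A) ?\<tau> f = load A \<rho> f + of_bool (f = v m)" for f
    proof -
      have "load A ?\<tau> f + of_bool (f \<in> Q) = load A \<rho> f + of_bool (f \<in> v ` {1..m})"
        using load_override[OF fin E inj\<rho> injE, of f]
        by (simp add: \<rho>E movE load_cong[of A ?\<tau> "\<lambda>a. if a \<in> E then mov (\<rho> a) else \<rho> a"] \<tau>A)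
      moreover have "?\<tau> c = \<sigma> c" by (simp add: reroute_def)
      ultimately show ?thesis using load_insert[OF fin c, of ?\<tau> f] vsplit[of f] by auto
    qed
    \<comment> \<open>No client of the sink leaves it under \<sigma>, but some client arrives there
      that \<rho> does not put there: the last one on the path, or \<open>c\<close> itself if the
      path has length 0. As \<sigma> respects the capacity, \<rho> leaves room for one more.\<close>
    have spare: "load A \<rho> (v m) + 1 \<le> u (v m)"
    proof -
      obtain x where x: "x \<in> insert c A" "\<sigma> x = v m" "x = c \<or> \<rho> x \<noteq> v m"
      proof (cases m)
        case 0
        then show ?thesis using that[of c] v0 by simp
      next
        case (Suc i)
        then have "act (v i)" using lt by simp
        moreover from this have "\<sigma> (al (v i)) = v m" using Suc vSuc[of i] by (simp add: nx_def)
        ultimately show ?thesis using that[of "al (v i)"] al[of "v i"] by auto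
      qed
      have sub: "insert x {a \<in> A. \<rho> a = v m} \<subseteq> {a \<in> insert c A. \<sigma> a = v m}"
        using x m by (auto simp: act_def)
      have "x \<notin> {a \<in> A. \<rho> a = v m}" using x c by auto
      then have "load A \<rho> (v m) + 1 = card (insert x {a \<in> A. \<rho> a = v m})"
        using fin by (simp add: load_def)
      also have "\<dots> \<le> load (insert c A) \<sigma> (v m)"
        unfolding load_def using sub fin by (intro card_mono) auto
      also have "\<dots> \<le> u (v m)"
        using \<sigma> \<sigma>S[OF x(1)] x(2) by (auto simp: P_def obeys_def)
      finally show ?thesis .
    qed
    have \<tau>S: "?\<tau> a \<in> S" if "a \<in> insert c A" for a
    proof (cases "a = c")
      case False
      then have "a \<in> A" using that by simp
      then show ?thesis using \<tau>A \<rho>S nxS by (auto simp: mov_def)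
    qed (simp add: reroute_def \<sigma>S)
    have "load A \<rho> f \<le> u f" if "f \<in> S" for f using \<rho> that by (simp add: obeys_def)
    then have r\<tau>: "obeys (insert c A) S u ?\<tau>"
      unfolding obeys_def using \<tau>S spare by (auto simp: load\<tau>)
    \<comment> \<open>Undoing the path in \<sigma> and dropping \<open>c\<close> gives an admissible
      assignment of \<open>A\<close>, with which \<rho> can be compared. This bounds the cost of the
      moves along the path by clients \<open>al h\<close>, and the cheapest clients are at least as
      good.\<close>
    define D where "D = al ` Q"
    have D: "D \<subseteq> A" using al Qact by (auto simp: D_def)
    have \<rho>D: "\<rho> ` D = Q" unfolding D_def image_image using al(2) Qact by auto
    have \<sigma>D: "\<sigma> ` D = v ` {1..m}"
      unfolding nQ[symmetric] D_def image_image using Qact by (auto simp: nx_def)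
    have inj\<rho>D: "inj_on \<rho> D" unfolding D_def using al(2) Qact by (auto intro!: inj_onI)
    have inj\<sigma>D: "inj_on \<sigma> D"
      unfolding D_def by (rule inj_on_imageI) (use injnx Qact in \<open>simp add: inj_on_def nx_def\<close>)
    let ?\<sigma> = "\<lambda>a. if a \<in> D then \<rho> a else \<sigma> a"
    have "load A ?\<sigma> f \<le> load (insert c A) \<sigma> f" for f
      using load_override[OF fin D inj\<sigma>D inj\<rho>D, of f] load_insert[OF fin c, of \<sigma> f] vsplit[of f]
      by (simp add: \<rho>D \<sigma>D eq_commute[of "\<sigma> c"])
    then have "obeys A S u ?\<sigma>"
      using \<sigma> \<sigma>S \<rho>S D unfolding P_def obeys_def by (fastforce intro: order_trans)
    from opt[OF this] have opt': "assign_cost w A \<rho> \<le> assign_cost w A \<sigma> + (\<Sum>a\<in>D. w a (\<rho> a) - w a (\<sigma> a))"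
      using assign_cost_override[OF fin D, of w \<rho> \<sigma>] by simp
    have "inj_on al Q" "inj_on \<beta> Q"
      using al(2) Qact \<rho>\<beta> by (metis inj_onI)+
    have "assign_cost w (insert c A) ?\<tau> = w c (?\<tau> c) + assign_cost w A ?\<tau>"
      using fin c by (simp add: assign_cost_def)
    also have "?\<tau> c = \<sigma> c" by (simp add: reroute_def)
    also have "assign_cost w A ?\<tau> = assign_cost w A \<rho> + (\<Sum>a\<in>E. w a (mov (\<rho> a)) - w a (\<rho> a))"
      using assign_cost_override[OF fin E, of w "\<lambda>a. mov (\<rho> a)" \<rho>]
      by (simp add: assign_cost_cong[of A ?\<tau> "\<lambda>a. if a \<in> E then mov (\<rho> a) else \<rho> a"] \<tau>A)
    also have "(\<Sum>a\<in>E. w a (mov (\<rho> a)) - w a (\<rho> a)) = (\<Sum>h\<in>Q. w (\<beta> h) (mov h) - w (\<beta> h) h)"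
      unfolding E_def using \<open>inj_on \<beta> Q\<close> \<rho>\<beta> by (simp add: sum.reindex)
    also have "\<dots> \<le> (\<Sum>h\<in>Q. w (al h) (mov h) - w (al h) h)"
      using \<beta>Q al Qact by (intro sum_mono) (auto simp: cheapest_def)
    also have "\<dots> = (\<Sum>a\<in>D. w a (\<sigma> a) - w a (\<rho> a))"
      unfolding D_def using \<open>inj_on al Q\<close> al Qact by (simp add: sum.reindex mov_def nx_def)
    also have "w c (\<sigma> c) + (assign_cost w A \<rho> + \<dots>) \<le> w c (\<sigma> c) + assign_cost w A \<sigma>"
      using opt' by (simp add: sum_subtractf)
    also have "\<dots> = assign_cost w (insert c A) \<sigma>" using fin c by (simp add: assign_cost_def)
    also have "\<dots> \<le> assign_cost w (insert c A) \<rho>0" using \<sigma> by (simp add: P_def)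
    finally show "obeys (insert c A) S u ?\<tau> \<and>
        assign_cost w (insert c A) ?\<tau> \<le> assign_cost w (insert c A) \<rho>0"
      using r\<tau> by simp
  qed
qed

section \<open>Leaders by adaptive sampling\<close>

text \<open>Jensen's inequality for the weights 1 and \<beta>. For \<open>z = 2\<close> the
  difference of the two sides is \<open>\<beta> * (x - y)\<^sup>2\<close>.\<close>

lemma power12_add_le:
  fixes x y \<beta> :: real
  assumes "z = 1 \<or> z = (2::nat)" "0 \<le> x" "0 \<le> y" "0 \<le> \<beta>"
  shows "(x + \<beta> * y) ^ z \<le> (1 + \<beta>) ^ (z - 1) * (x ^ z + \<beta> * y ^ z)"
  using assms(1)
proof
  assume "z = 2"
  have "0 \<le> \<beta> * (x - y)\<^sup>2" using assms by simp
  then show ?thesis using \<open>z = 2\<close> by (simp add: power2_eq_square algebra_simps)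
qed simp

locale clustering = Metric_space V d for V :: "'a set" and d +
  fixes C S :: "'a set" and cen :: "'a \<Rightarrow> 'a" and z :: nat and e :: real
  assumes finC: "finite C" and C: "C \<subseteq> V" and finS: "finite S" and S: "S \<subseteq> V"
    and cen: "cen ` C \<subseteq> S" and z: "z = 1 \<or> z = 2" and e: "0 < e" "e \<le> 1"
begin

definition near :: "'a set \<Rightarrow> 'a \<Rightarrow> real" where
  "near L v = Min ((\<lambda>l. d v l) ` L)"

definition rad :: "'a \<Rightarrow> real" where
  "rad c = d c (cen c)"

definition total :: real where
  "total = (\<Sum>c\<in>C. rad c ^ z)"

text \<open>The cost of moving every center to its nearest leader, paid once per client. The factor
  \<open>3 ^ z\<close> results if this is at most slightly more than \<open>total\<close>.\<close>

definition excess :: "'a set \<Rightarrow> real" where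
  "excess L = (\<Sum>c\<in>C. near L (cen c) ^ z)"

definition cluster :: "'a \<Rightarrow> 'a set" where
  "cluster s = {c \<in> C. cen c = s}"

text \<open>The leaders are too far from \<open>s\<close> in comparison with the average cost of its
  cluster. Both sides are multiplied by the size of the cluster, so centers of empty clusters are
  never bad.\<close>

definition bad :: "'a set \<Rightarrow> 'a set" where
  "bad L = {s \<in> S. (1 + e) * (\<Sum>c\<in>cluster s. rad c ^ z) < card (cluster s) * near L s ^ z}"

text \<open>The gap between \<open>1 + e / 2\<close> here and \<open>1 + e\<close> in
  \<open>bad\<close> is used in two ways: a hit chosen as leader makes its center good, and a hit is
  closer to its own center than this center is to the leaders, so that it has a substantial sampling
  weight.\<close>

definition hits :: "'a set \<Rightarrow> 'a set" where
  "hits L = {c \<in> C. cen c \<in> bad L \<and>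
     card (cluster (cen c)) * rad c ^ z \<le> (1 + e / 2) * (\<Sum>c\<in>cluster (cen c). rad c ^ z)}"

definition leaders :: "'a set \<Rightarrow> bool" where
  "leaders L \<longleftrightarrow> finite L \<and> L \<noteq> {} \<and> L \<subseteq> V"

lemma near_le: "leaders L \<Longrightarrow> l \<in> L \<Longrightarrow> near L v \<le> d v l"
  by (simp add: near_def leaders_def)

lemma near_attained:
  assumes "leaders L" obtains l where "l \<in> L" "near L v = d v l"
proof -
  have "near L v \<in> (\<lambda>l. d v l) ` L"
    unfolding near_def using assms by (intro Min_in) (auto simp: leaders_def)
  then show thesis using that by blast
qed

lemma near_nonneg: "leaders L \<Longrightarrow> 0 \<le> near L v"
  by (rule near_attained[of L v]) simp_all

lemma near_triangle:
  assumes "leaders L" "u \<in> V" "v \<in> V"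
  shows "near L u \<le> d u v + near L v"
proof -
  obtain l where l: "l \<in> L" "near L v = d v l" using near_attained[OF assms(1)] .
  have "near L u \<le> d u l" by (rule near_le) fact+
  also have "\<dots> \<le> d u v + d v l" by (rule triangle) (use assms l in \<open>auto simp: leaders_def\<close>)
  finally show ?thesis by (simp add: l)
qed

lemma near_anti: "leaders L \<Longrightarrow> leaders L' \<Longrightarrow> L \<subseteq> L' \<Longrightarrow> near L' v \<le> near L v"
  by (rule near_attained[of L v]) (auto simp: near_le)

lemma cenS: "c \<in> C \<Longrightarrow> cen c \<in> S"
  using cen by auto

lemma cluster_sum: "(\<Sum>s\<in>S. \<Sum>c\<in>cluster s. f c) = (\<Sum>c\<in>C. f c)" for f :: "'a \<Rightarrow> real"
  unfolding cluster_def using sum.group[OF finC finS cen, of f] by simp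

lemma finite_cluster: "finite (cluster s)"
  using finC by (simp add: cluster_def)

lemma rad_nonneg: "0 \<le> rad c"
  by (simp add: rad_def)

lemma excess_cluster: "excess L = (\<Sum>s\<in>S. card (cluster s) * near L s ^ z)"
  unfolding excess_def cluster_sum[symmetric] by (rule sum.cong) (auto simp: cluster_def)

lemma total_nonneg: "0 \<le> total"
  by (simp add: total_def sum_nonneg rad_nonneg)

lemma bad_anti:
  assumes "leaders L" "leaders L'" "L \<subseteq> L'"
  shows "bad L' \<subseteq> bad L"
proof -
  have "near L' s ^ z \<le> near L s ^ z" for s
    using near_anti[OF assms] near_nonneg[OF assms(2)] by (intro power_mono)
  then have "card (cluster s) * near L' s ^ z \<le> card (cluster s) * near L s ^ z" for s
    by (intro mult_left_mono) auto
  then show ?thesis unfolding bad_def by (auto intro: less_le_trans)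
qed

lemma excess_anti: "leaders L \<Longrightarrow> leaders L' \<Longrightarrow> L \<subseteq> L' \<Longrightarrow> excess L' \<le> excess L"
  unfolding excess_def by (intro sum_mono power_mono near_anti near_nonneg)

lemma excess_no_bad:
  assumes "bad L = {}"
  shows "excess L \<le> (1 + e) * total"
proof -
  have "excess L \<le> (\<Sum>s\<in>S. (1 + e) * (\<Sum>c\<in>cluster s. rad c ^ z))"
    unfolding excess_cluster using assms by (intro sum_mono) (auto simp: bad_def not_less)
  also have "\<dots> = (1 + e) * total"
    by (simp add: total_def sum_distrib_left[symmetric] cluster_sum)
  finally show ?thesis .
qed

lemma hits_not_bad:
  assumes "leaders L" "c \<in> hits L"
  shows "cen c \<in> bad L - bad (insert c L)"
proof -
  let ?s = "cen c"
  have c: "c \<in> C" "?s \<in> bad L" using assms(2) by (auto simp: hits_def)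
  have L: "leaders (insert c L)" using assms(1) c C by (auto simp: leaders_def)
  have "near (insert c L) ?s \<le> rad c"
    using near_le[OF L, of c ?s] by (simp add: rad_def commute)
  then have "card (cluster ?s) * near (insert c L) ?s ^ z \<le> card (cluster ?s) * rad c ^ z"
    using near_nonneg[OF L] by (intro mult_left_mono power_mono) auto
  also have "\<dots> \<le> (1 + e / 2) * (\<Sum>c\<in>cluster ?s. rad c ^ z)" using assms(2) by (simp add: hits_def)
  also have "\<dots> \<le> (1 + e) * (\<Sum>c\<in>cluster ?s. rad c ^ z)"
    using e by (intro mult_right_mono sum_nonneg) (auto simp: rad_nonneg)
  finally show ?thesis using c by (simp add: bad_def)
qed

text \<open>The progress measure of the sampling: every hit removes a bad center and no center
  becomes bad again, so as many hits as there are centers suffice.\<close>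

lemma card_bad_hit:
  assumes "leaders L" "c \<in> hits L"
  shows "card (bad (insert c L)) < card (bad L)"
proof -
  have "c \<in> V" using assms(2) C by (auto simp: hits_def)
  then have "bad (insert c L) \<subseteq> bad L"
    using assms(1) by (intro bad_anti) (auto simp: leaders_def)
  moreover have "finite (bad L)" using finS by (simp add: bad_def)
  ultimately show ?thesis
    using hits_not_bad[OF assms] by (intro psubset_card_mono) auto
qed

text \<open>At least a fraction \<open>e / 3\<close> of the cluster are hits, and each of them has
  distance at least \<open>e / 8\<close> times \<open>near L s\<close> to the leaders. The constant
  is the product of \<open>e / 3\<close> and \<open>e ^ 2 / 64\<close>.\<close>

lemma hits_in_cluster:
  assumes L: "leaders L" and s: "s \<in> bad L"
  shows "e ^ 3 / 192 * (card (cluster s) * near L s ^ z)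
    \<le> (\<Sum>c\<in>hits L \<inter> cluster s. near L c ^ z)"
proof -
  let ?n = "real (card (cluster s))" and ?y = "near L s"
  define A where "A = (\<Sum>c\<in>cluster s. rad c ^ z)"
  define H where "H = hits L \<inter> cluster s"
  have H: "H = {c \<in> cluster s. ?n * rad c ^ z \<le> (1 + e / 2) * A}"
    using s by (auto simp: H_def hits_def cluster_def A_def)
  have finH: "finite H" by (simp add: H finite_cluster)
  have A0: "0 \<le> A" by (simp add: A_def sum_nonneg rad_nonneg)
  have sb: "(1 + e) * A < ?n * ?y ^ z" using s by (simp add: bad_def A_def)
  have y0: "0 \<le> ?y" by (rule near_nonneg) fact
  have n0: "0 < ?n"
  proof (rule ccontr)
    assume "\<not> 0 < ?n"
    then have "?n = 0" by simp
    then have "(1 + e) * A < 0" using sb by simp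
    then show False using A0 e by (simp add: mult_less_0_iff)
  qed
  \<comment> \<open>Markov's inequality: the clients that cost more than \<open>1 + e / 2\<close>
    times the average are at most a fraction \<open>1 / (1 + e / 2)\<close> of the cluster. If the
    cluster costs nothing, all of its clients are hits, and \<open>A\<close> cannot be
    cancelled.\<close>
  have cardH: "?n * (e / 3) \<le> real (card H)"
  proof (cases "A = 0")
    case True
    then have "\<forall>c\<in>cluster s. rad c ^ z = 0"
      unfolding A_def
      by (subst (asm) sum_nonneg_eq_0_iff) (auto intro: finite_cluster zero_le_power rad_nonneg)
    then have "H = cluster s" using True z by (auto simp: H)
    then show ?thesis using e mult_left_mono[of "e / 3" 1 ?n] by simp
  next
    case False
    then have A: "0 < A" using A0 by simp
    have "card (cluster s - H) * ((1 + e / 2) * A) \<le> (\<Sum>c\<in>cluster s - H. ?n * rad c ^ z)"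
      by (rule sum_bounded_below) (auto simp: H)
    also have "\<dots> \<le> (\<Sum>c\<in>cluster s. ?n * rad c ^ z)"
      by (intro sum_mono2) (auto simp: finite_cluster rad_nonneg)
    also have "\<dots> = ?n * A" by (simp add: A_def sum_distrib_left)
    finally have "card (cluster s - H) * (1 + e / 2) \<le> ?n"
      using A by (simp add: mult.assoc[symmetric])
    moreover have "H \<subseteq> cluster s" by (auto simp: H)
    then have "real (card (cluster s - H)) = ?n - card H"
      using finH finite_cluster by (simp add: card_Diff_subset of_nat_diff card_mono)
    ultimately have "?n * (e / 2) \<le> card H * (1 + e / 2)" by (simp add: algebra_simps)
    also have "\<dots> \<le> card H * (3 / 2)" using e by (intro mult_left_mono) auto
    finally show ?thesis by simp
  qed
  have each: "e ^ 2 / 64 * ?y ^ z \<le> near L c ^ z" if c: "c \<in> H" for c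
  proof -
    have cC: "c \<in> C" "cen c = s" using c by (auto simp: H cluster_def)
    have "(1 - e / 4) * (1 + e) * A \<ge> (1 + e / 2) * A"
    proof (rule mult_right_mono)
      have "e * e \<le> e * 1" using e by (intro mult_left_mono) auto
      moreover have "(1 - e / 4) * (1 + e) = 1 + 3 / 4 * e - e * e / 4" by (simp add: field_simps)
      ultimately show "1 + e / 2 \<le> (1 - e / 4) * (1 + e)" by linarith
    qed (rule A0)
    moreover have "(1 - e / 4) * ((1 + e) * A) \<le> (1 - e / 4) * (?n * ?y ^ z)"
      using sb e by (intro mult_left_mono) auto
    ultimately have "?n * rad c ^ z \<le> ?n * ((1 - e / 4) * ?y ^ z)"
      using c by (simp add: H mult.assoc mult.left_commute)
    then have "rad c ^ z \<le> (1 - e / 4) * ?y ^ z" using n0 by simp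
    \<comment> \<open>A \<open>z\<close>-th root without roots: \<open>1 - e / 4\<close> is at most
      \<open>(1 - e / 8) ^ z\<close> for both values of \<open>z\<close>.\<close>
    also have "\<dots> \<le> (1 - e / 8) ^ z * ?y ^ z"
      using z e y0 by (intro mult_right_mono) (auto simp: power2_eq_square algebra_simps)
    also have "\<dots> = ((1 - e / 8) * ?y) ^ z" by (simp add: power_mult_distrib)
    finally have "rad c \<le> (1 - e / 8) * ?y"
      using power_mono_iff[of "rad c" "(1 - e / 8) * ?y" z] z e y0 rad_nonneg by auto
    moreover have "?y \<le> d s c + near L c"
      by (rule near_triangle) (use L cC C S cenS in auto)
    moreover have "d s c = rad c" using cC by (simp add: rad_def commute)
    ultimately have "e / 8 * ?y \<le> near L c" by (simp add: algebra_simps)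
    then have "(e / 8 * ?y) ^ z \<le> near L c ^ z" using e y0 by (intro power_mono) auto
    \<comment> \<open>For \<open>z = 1\<close> the factor \<open>e / 8\<close> is weakened to
      \<open>e ^ 2 / 64\<close>, so that both objectives share one constant.\<close>
    moreover have "e ^ 2 / 64 * ?y ^ z \<le> (e / 8) ^ z * ?y ^ z"
      using z
    proof
      assume "z = 1"
      have "e * e \<le> 8 * e" using e by (intro mult_right_mono) auto
      then have "e ^ 2 / 64 \<le> e / 8" by (simp add: power2_eq_square)
      then show ?thesis using \<open>z = 1\<close> y0 by (simp add: mult_right_mono del: times_divide_eq_left)
    qed (simp add: power2_eq_square)
    ultimately show ?thesis by (simp only: power_mult_distrib)
  qed
  have "e ^ 3 / 192 * (?n * ?y ^ z) = (?n * (e / 3)) * (e ^ 2 / 64 * ?y ^ z)"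
    by (simp add: power3_eq_cube power2_eq_square)
  also have "\<dots> \<le> card H * (e ^ 2 / 64 * ?y ^ z)"
    using cardH y0 by (intro mult_right_mono) auto
  also have "\<dots> \<le> (\<Sum>c\<in>H. near L c ^ z)"
    by (rule sum_bounded_below) (rule each)
  finally show ?thesis by (simp add: H_def)
qed

text \<open>Centers that are not bad account for at most \<open>(1 + e) * total\<close> of the
  excess. If the excess is larger than \<open>(1 + 2 * e) * total\<close>, the bad ones must carry a
  fraction \<open>e / 3\<close> of it. All clients together weigh at most four times the excess, and
  2304 is 192 * 3 * 4.\<close>

theorem hits_heavy:
  assumes L: "leaders L" and X: "(1 + 2 * e) * total < excess L"
  shows "e ^ 4 / 2304 * (\<Sum>c\<in>C. near L c ^ z) \<le> (\<Sum>c\<in>hits L. near L c ^ z)"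
    "0 < (\<Sum>c\<in>C. near L c ^ z)"
proof -
  let ?X = "excess L"
  have "0 \<le> (1 + 2 * e) * total" using total_nonneg e by simp
  then have X0: "0 < ?X" using X by linarith
  define B where "B = (\<Sum>s\<in>bad L. card (cluster s) * near L s ^ z)"
  have badS: "bad L \<subseteq> S" by (auto simp: bad_def)
  have "?X = B + (\<Sum>s\<in>S - bad L. card (cluster s) * near L s ^ z)"
    unfolding excess_cluster B_def by (subst sum.subset_diff[OF badS finS]) (rule add.commute)
  also have "\<dots> \<le> B + (\<Sum>s\<in>S - bad L. (1 + e) * (\<Sum>c\<in>cluster s. rad c ^ z))"
    by (intro add_left_mono sum_mono) (simp add: bad_def not_less)
  also have "\<dots> \<le> B + (\<Sum>s\<in>S. (1 + e) * (\<Sum>c\<in>cluster s. rad c ^ z))"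
    using finS e by (intro add_left_mono sum_mono2) (auto simp: sum_nonneg rad_nonneg)
  also have "\<dots> = B + (1 + e) * total"
    by (simp add: total_def sum_distrib_left[symmetric] cluster_sum)
  finally have XB: "?X \<le> B + (1 + e) * total" .
  have "(1 + 2 * e) * ?X \<le> (1 + 2 * e) * B + (1 + e) * ((1 + 2 * e) * total)"
    using mult_left_mono[OF XB, of "1 + 2 * e"] e by (simp add: algebra_simps)
  also have "\<dots> \<le> (1 + 2 * e) * B + (1 + e) * ?X"
    using X e by (intro add_left_mono mult_left_mono) auto
  finally have "e * ?X \<le> (1 + 2 * e) * B" by (simp add: algebra_simps)
  also have "\<dots> \<le> 3 * B"
    using e L by (intro mult_right_mono) (auto simp: B_def near_nonneg intro!: sum_nonneg)
  finally have B: "e * ?X \<le> 3 * B" .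
  have "hits L = (\<Union>s\<in>bad L. hits L \<inter> cluster s)" by (auto simp: hits_def cluster_def)
  moreover have "(\<Sum>c\<in>(\<Union>s\<in>bad L. hits L \<inter> cluster s). near L c ^ z)
      = (\<Sum>s\<in>bad L. \<Sum>c\<in>hits L \<inter> cluster s. near L c ^ z)"
    by (rule sum.UNION_disjoint)
      (use finS badS finite_subset in \<open>auto simp: finite_cluster, auto simp: cluster_def\<close>)
  ultimately have "(\<Sum>c\<in>hits L. near L c ^ z) = (\<Sum>s\<in>bad L. \<Sum>c\<in>hits L \<inter> cluster s. near L c ^ z)"
    by metis
  also have "\<dots> \<ge> (\<Sum>s\<in>bad L. e ^ 3 / 192 * (card (cluster s) * near L s ^ z))"
    by (intro sum_mono hits_in_cluster L)
  finally have H: "e ^ 3 / 192 * B \<le> (\<Sum>c\<in>hits L. near L c ^ z)"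
    by (simp add: B_def sum_distrib_left)
  have "e ^ 3 / 192 * (e * ?X) \<le> e ^ 3 / 192 * (3 * B)"
    using B e by (intro mult_left_mono) auto
  moreover have "e ^ 4 / 576 * ?X = e ^ 3 / 192 * (e * ?X) / 3"
    by (simp add: power4_eq_xxxx power3_eq_cube)
  moreover have "e ^ 3 / 192 * (3 * B) / 3 = e ^ 3 / 192 * B" by simp
  ultimately have HX: "e ^ 4 / 576 * ?X \<le> (\<Sum>c\<in>hits L. near L c ^ z)"
    using H by linarith
  have "(\<Sum>c\<in>C. near L c ^ z) \<le> (\<Sum>c\<in>C. 2 * rad c ^ z + 2 * near L (cen c) ^ z)"
  proof (rule sum_mono)
    fix c assume c: "c \<in> C"
    have "near L c \<le> rad c + 1 * near L (cen c)"
      using near_triangle[OF L, of c "cen c"] c C S cenS by (auto simp: rad_def)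
    then have "near L c ^ z \<le> (rad c + 1 * near L (cen c)) ^ z"
      using near_nonneg[OF L] by (intro power_mono)
    also have "\<dots> \<le> (1 + 1) ^ (z - 1) * (rad c ^ z + 1 * near L (cen c) ^ z)"
      by (rule power12_add_le) (use z near_nonneg[OF L] rad_nonneg in auto)
    also have "\<dots> \<le> 2 * (rad c ^ z + 1 * near L (cen c) ^ z)"
      using z near_nonneg[OF L] rad_nonneg by (intro mult_right_mono) auto
    finally show "near L c ^ z \<le> 2 * rad c ^ z + 2 * near L (cen c) ^ z" by simp
  qed
  also have "\<dots> = 2 * total + 2 * ?X"
    by (simp add: total_def excess_def sum.distrib sum_distrib_left)
  also have "\<dots> \<le> 4 * ?X"
  proof -
    have "1 * total \<le> (1 + 2 * e) * total" using e total_nonneg by (intro mult_right_mono) auto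
    then show ?thesis using X by simp
  qed
  finally have W: "(\<Sum>c\<in>C. near L c ^ z) \<le> 4 * ?X" .
  have "e ^ 4 / 2304 * (\<Sum>c\<in>C. near L c ^ z) \<le> e ^ 4 / 2304 * (4 * ?X)"
    using W e by (intro mult_left_mono) auto
  then show "e ^ 4 / 2304 * (\<Sum>c\<in>C. near L c ^ z) \<le> (\<Sum>c\<in>hits L. near L c ^ z)"
    using HX by (simp add: mult.commute[of "e ^ 4"])
  have "0 < e ^ 4 / 576 * ?X" using X0 e by simp
  also note HX
  also have "(\<Sum>c\<in>hits L. near L c ^ z) \<le> (\<Sum>c\<in>C. near L c ^ z)"
    by (rule sum_mono2) (use finC near_nonneg[OF L] in \<open>auto simp: hits_def\<close>)
  finally show "0 < (\<Sum>c\<in>C. near L c ^ z)" .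
qed

text \<open>Jensen's inequality with weight \<open>2 + e\<close>, where 2 stands for going from the
  center to the leader and on to the replacement. For \<open>z = 2\<close> the constant 31 is 24 + 7
  in \<open>(3 + e) * (3 + 7 * e) = 9 + 24 * e + 7 * e ^ 2\<close>; for \<open>z = 1\<close> it is
  generous.\<close>

lemma moved_cost:
  assumes L: "leaders L" and X: "excess L \<le> (1 + 2 * e) * total"
    and g: "\<And>s. s \<in> S \<Longrightarrow> g s \<in> V" "\<And>s. s \<in> cen ` C \<Longrightarrow> d s (g s) \<le> (2 + e) * near L s"
  shows "(\<Sum>c\<in>C. d c (g (cen c)) ^ z) \<le> (3 ^ z + 31 * e) * total"
proof -
  have "(\<Sum>c\<in>C. d c (g (cen c)) ^ z)
      \<le> (\<Sum>c\<in>C. (1 + (2 + e)) ^ (z - 1) * (rad c ^ z + (2 + e) * near L (cen c) ^ z))"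
  proof (rule sum_mono)
    fix c assume c: "c \<in> C"
    have "d c (g (cen c)) \<le> d c (cen c) + d (cen c) (g (cen c))"
      using c C S cenS g(1) by (intro triangle) auto
    also have "\<dots> \<le> rad c + (2 + e) * near L (cen c)" using g(2) c by (simp add: rad_def)
    finally have "d c (g (cen c)) ^ z \<le> (rad c + (2 + e) * near L (cen c)) ^ z"
      by (intro power_mono) auto
    also have "\<dots> \<le> (1 + (2 + e)) ^ (z - 1) * (rad c ^ z + (2 + e) * near L (cen c) ^ z)"
      by (rule power12_add_le) (use z near_nonneg[OF L] rad_nonneg e in auto)
    finally show "d c (g (cen c)) ^ z \<le> (1 + (2 + e)) ^ (z - 1) * (rad c ^ z + (2 + e) * near L (cen c) ^ z)" .
  qed
  also have "\<dots> = (3 + e) ^ (z - 1) * (total + (2 + e) * excess L)"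
    by (simp add: total_def excess_def sum.distrib sum_distrib_left[symmetric])
  also have "\<dots> \<le> (3 + e) ^ (z - 1) * (total + (2 + e) * ((1 + 2 * e) * total))"
    using X e by (intro mult_left_mono add_left_mono) auto
  also have "\<dots> = ((3 + e) ^ (z - 1) * (3 + 5 * e + 2 * e\<^sup>2)) * total"
    by (simp add: algebra_simps power2_eq_square)
  also have "\<dots> \<le> (3 ^ z + 31 * e) * total"
  proof (rule mult_right_mono)
    have e2: "e\<^sup>2 \<le> e" using e by (simp add: power2_eq_square mult_le_cancel_left1)
    then have "3 + 5 * e + 2 * e\<^sup>2 \<le> 3 + 7 * e" by simp
    then have "(3 + e) ^ (z - 1) * (3 + 5 * e + 2 * e\<^sup>2) \<le> (3 + e) ^ (z - 1) * (3 + 7 * e)"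
      using e by (intro mult_left_mono) auto
    also have "\<dots> \<le> 3 ^ z + 31 * e"
      using z e e2 by (auto simp: power2_eq_square algebra_simps)
    finally show "(3 + e) ^ (z - 1) * (3 + 5 * e + 2 * e\<^sup>2) \<le> 3 ^ z + 31 * e" .
  qed (rule total_nonneg)
  finally show ?thesis .
qed

end

section \<open>Replacement centers of large capacity\<close>

text \<open>Equal capacities are separated by the index. So ranks are injective, and a guessed rank
  determines a single facility.\<close>

definition better :: "('a::linorder \<Rightarrow> nat) \<Rightarrow> 'a \<Rightarrow> 'a \<Rightarrow> bool" where
  "better u v w \<longleftrightarrow> u w < u v \<or> u v = u w \<and> v < w"

definition rank_in :: "('a::linorder \<Rightarrow> nat) \<Rightarrow> 'a set \<Rightarrow> 'a \<Rightarrow> nat" where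
  "rank_in u B v = card {w \<in> B. better u w v}"

lemma rank_in_less:
  assumes "finite B" "v \<in> B" "better u v w"
  shows "rank_in u B v < rank_in u B w"
  unfolding rank_in_def
  by (rule psubset_card_mono) (use assms in \<open>auto simp: better_def\<close>)

lemma rank_in_inj:
  assumes "finite B" "v \<in> B" "w \<in> B" "rank_in u B v = rank_in u B w"
  shows "v = w"
proof (rule ccontr)
  assume "v \<noteq> w"
  then have "better u v w \<or> better u w v" by (auto simp: better_def)
  then show False using rank_in_less[OF assms(1,2), of u w] rank_in_less[OF assms(1,3), of u v] assms(4)
    by auto
qed

text \<open>
  A center is replaced by the facility with the largest capacity in a ball that is not taken
  already and is not reserved for a later center. As fewer than \<open>k\<close> facilities are excluded, its
  position in the list of all facilities of the ball, ordered by capacity, can be guessed.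
\<close>

lemma ex_replacement:
  assumes "finite B" "s \<in> B" "finite X" "s \<notin> X" "card X < k"
  obtains f where "f \<in> B" "f \<notin> X" "u s \<le> u f" "rank_in u B f < k"
proof -
  have "s \<in> B \<and> s \<notin> X" using assms by simp
  from ex_has_least_nat[of "\<lambda>v. v \<in> B \<and> v \<notin> X", OF this, of "rank_in u B"]
  obtain f where f: "f \<in> B" "f \<notin> X" and least: "\<And>v. v \<in> B \<Longrightarrow> v \<notin> X \<Longrightarrow> rank_in u B f \<le> rank_in u B v"
    by blast
  \<comment> \<open>Everything better than \<open>f\<close> is excluded. This bounds the rank of
    \<open>f\<close> by \<open>card X\<close>; and as \<open>s\<close> is not excluded, it is not
    better than \<open>f\<close>, which compares the capacities.\<close>
  have sub: "v \<in> X" if "v \<in> B" "better u v f" for v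
    using rank_in_less[OF assms(1) that] least[OF that(1)] by fastforce
  have "rank_in u B f \<le> card X"
    unfolding rank_in_def using sub assms(3) by (intro card_mono) auto
  moreover have "u s \<le> u f" using sub[OF assms(2)] assms(4) by (force simp: better_def)
  ultimately show ?thesis using that f assms(5) by simp
qed

section \<open>The program\<close>

subsection \<open>Simple loops\<close>

lemma card_less_Suc_Collect: "card {i. i < Suc m \<and> Q i} = card {i. i < m \<and> Q i} + of_bool (Q m)"
proof -
  have "{i. i < Suc m \<and> Q i} = (if Q m then insert m {i. i < m \<and> Q i} else {i. i < m \<and> Q i})"
    by (auto simp: less_Suc_eq)
  then show ?thesis by simp
qed

lemma sum_less_Suc_Collect:
  "(\<Sum>i | i < Suc m \<and> Q i. g i) = (\<Sum>i | i < m \<and> Q i. g i) + (if Q m then g m else (0::real))"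
proof -
  have "{i. i < Suc m \<and> Q i} = (if Q m then insert m {i. i < m \<and> Q i} else {i. i < m \<and> Q i})"
    by (auto simp: less_Suc_eq)
  then show ?thesis by simp
qed

text \<open>The expression is evaluated in any state that differs from the initial one only in the
  counter and the target array. If its value is determined there, no invariant has to be invented;
  likewise for the next three loop shapes.\<close>

lemma ensures_map_loop:
  assumes "x \<noteq> arr" "nat (iv s y) = m"
    and "\<And>i s'. i < m \<Longrightarrow> agree {x, arr} {} s s' \<Longrightarrow> iv s' x = int i \<Longrightarrow> ival e s' = g i"
  shows "ensures (PFor x y (PI arr (IV x) e)) s
    (\<lambda>s'. fst s' arr = (\<lambda>j. if 0 \<le> j \<and> j < int m then g (nat j) else fst s arr j))"
  by (rule ensures_PFor[where m = m and
        I = "\<lambda>i s'. fst s' arr = (\<lambda>j. if 0 \<le> j \<and> j < int i then g (nat j) else fst s arr j)"])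
    (use assms in \<open>auto simp: fun_eq_iff\<close>)

lemma ensures_rmap_loop:
  assumes "nat (iv s y) = m"
    and "\<And>i s'. i < m \<Longrightarrow> agree {x} {arr} s s' \<Longrightarrow> iv s' x = int i \<Longrightarrow> rval e s' = g i"
  shows "ensures (PFor x y (PR arr (IV x) e)) s
    (\<lambda>s'. snd s' arr = (\<lambda>j. if 0 \<le> j \<and> j < int m then g (nat j) else snd s arr j))"
  by (rule ensures_PFor[where m = m and
        I = "\<lambda>i s'. snd s' arr = (\<lambda>j. if 0 \<le> j \<and> j < int i then g (nat j) else snd s arr j)"])
    (use assms in \<open>auto simp: fun_eq_iff\<close>)

lemma ensures_count_loop:
  assumes "x \<noteq> c" "nat (iv s y) = m"
    and "\<And>i s'. i < m \<Longrightarrow> agree {x, c} {} s s' \<Longrightarrow> iv s' x = int i \<Longrightarrow> bval b s' = Q i"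
  shows "ensures (PFor x y (PIf b (PIV c (IAdd (IV c) (IConst 1))) PSkip)) s
    (\<lambda>s'. iv s' c = iv s c + int (card {i. i < m \<and> Q i}))"
  by (rule ensures_PFor[where m = m and
        I = "\<lambda>i s'. iv s' c = iv s c + int (card {j. j < i \<and> Q j})"])
    (use assms in \<open>auto simp: card_less_Suc_Collect\<close>)

lemma ensures_sum_loop:
  assumes "nat (iv s y) = m"
    and "\<And>i s'. i < m \<Longrightarrow> agree {x} {r} s s' \<Longrightarrow> iv s' x = int i \<Longrightarrow> bval b s' = Q i \<and> rval e s' = g i"
  shows "ensures (PFor x y (PIf b (PRV r (RAdd (RV r) e)) PSkip)) s
    (\<lambda>s'. rv s' r = rv s r + (\<Sum>i | i < m \<and> Q i. g i))"
  by (rule ensures_PFor[where m = m and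
        I = "\<lambda>i s'. rv s' r = rv s r + (\<Sum>j | j < i \<and> Q j. g j)"])
    (use assms in \<open>auto simp: sum_less_Suc_Collect\<close>)

subsection \<open>Abbreviations\<close>

text \<open>
  Arrays 10 to 22 hold parameters that are computed once; the bounds of all loops are among them.
  In this list, and for the scratch arrays from 30 on, \<open>v\<close> marks scalars, that is, arrays of which
  only cell \<open>0\<close> is used.
\<close>

abbreviation "CL \<equiv> 1 :: nat"
abbreviation "FA \<equiv> 2 :: nat"
abbreviation "CAP \<equiv> 3 :: nat"
abbreviation "GR \<equiv> 4 :: nat"
abbreviation "LO \<equiv> 5 :: nat"
abbreviation "UP \<equiv> 6 :: nat"
abbreviation "OUTS \<equiv> 7 :: nat"
abbreviation "OUTR \<equiv> 8 :: nat"

abbreviation "vN \<equiv> 10 :: nat"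
abbreviation "vK \<equiv> 11 :: nat"
abbreviation "vT \<equiv> 12 :: nat"
abbreviation "vK1 \<equiv> 13 :: nat"
abbreviation "vP2 \<equiv> 14 :: nat"
abbreviation "vRR \<equiv> 15 :: nat"
abbreviation "vNN \<equiv> 16 :: nat"
abbreviation "vCODES \<equiv> 17 :: nat"
abbreviation "vTRIALS \<equiv> 18 :: nat"
abbreviation "vB \<equiv> 19 :: nat"
abbreviation "aROW \<equiv> 20 :: nat"
abbreviation "aGROW \<equiv> 21 :: nat"
abbreviation "aMASK \<equiv> 22 :: nat"

abbreviation "aLD \<equiv> 30 :: nat"
abbreviation "vU \<equiv> 31 :: nat"
abbreviation "vV \<equiv> 32 :: nat"
abbreviation "vR \<equiv> 33 :: nat"
abbreviation "vSEL \<equiv> 34 :: nat"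
abbreviation "aF \<equiv> 35 :: nat"
abbreviation "vLI \<equiv> 36 :: nat"
abbreviation "vTY \<equiv> 37 :: nat"
abbreviation "vRK \<equiv> 38 :: nat"
abbreviation "vEX \<equiv> 39 :: nat"
abbreviation "aSV \<equiv> 40 :: nat"
abbreviation "vOK \<equiv> 41 :: nat"
abbreviation "vCNT \<equiv> 42 :: nat"
abbreviation "aRHO \<equiv> 43 :: nat"
abbreviation "aRHO2 \<equiv> 44 :: nat"
abbreviation "aRHOB \<equiv> 45 :: nat"
abbreviation "aNX \<equiv> 46 :: nat"
abbreviation "vHAVE \<equiv> 47 :: nat"
abbreviation "vBI \<equiv> 48 :: nat"
abbreviation "vCARRY \<equiv> 49 :: nat"
abbreviation "vHB \<equiv> 50 :: nat"
abbreviation "vCC \<equiv> 51 :: nat"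
abbreviation "vVAL \<equiv> 52 :: nat"

abbreviation "iI \<equiv> 60 :: nat"
abbreviation "iJ \<equiv> 61 :: nat"
abbreviation "iV \<equiv> 62 :: nat"
abbreviation "iU \<equiv> 63 :: nat"
abbreviation "iC \<equiv> 64 :: nat"
abbreviation "iCODE \<equiv> 65 :: nat"
abbreviation "iTRIAL \<equiv> 66 :: nat"
abbreviation "vTMP \<equiv> 70 :: nat"
abbreviation "vPP \<equiv> 71 :: nat"

abbreviation "rMINW \<equiv> 10 :: nat"
abbreviation "rTOT \<equiv> 2 :: nat"
abbreviation "rACC \<equiv> 3 :: nat"
abbreviation "rRAD \<equiv> 4 :: nat"
abbreviation "rBW \<equiv> 5 :: nat"
abbreviation "rCOST \<equiv> 6 :: nat"
abbreviation "rBEST \<equiv> 7 :: nat"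
abbreviation "rGB \<equiv> 8 :: nat"
abbreviation "rR0 \<equiv> 9 :: nat"

definition BEq :: "iexp \<Rightarrow> iexp \<Rightarrow> bexp" where
  "BEq e e' = BAnd (BNot (ILess e e')) (BNot (ILess e' e))"

definition BOr :: "bexp \<Rightarrow> bexp \<Rightarrow> bexp" where
  "BOr b b' = BNot (BAnd (BNot b) (BNot b'))"

abbreviation BPos :: "iexp \<Rightarrow> bexp" where "BPos e \<equiv> ILess (IConst 0) e"

definition Dx :: "iexp \<Rightarrow> iexp \<Rightarrow> rexp" where
  "Dx u v = RGet 0 (IAdd (IGet aROW u) v)"

definition Wx :: "nat \<Rightarrow> iexp \<Rightarrow> iexp \<Rightarrow> rexp" where
  "Wx z u v = (if z = 1 then Dx u v else RMul (Dx u v) (Dx u v))"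

fun block :: "prog list \<Rightarrow> prog" where
  "block [] = PSkip"
| "block [p] = p"
| "block (p # ps) = PSeq p (block ps)"

lemma bval_BEq [simp]: "bval (BEq e e') s \<longleftrightarrow> ival e s = ival e' s"
  by (auto simp: BEq_def)

lemma bval_BOr [simp]: "bval (BOr b b') s \<longleftrightarrow> bval b s \<or> bval b' s"
  by (auto simp: BOr_def)

definition dval :: "state \<Rightarrow> int \<Rightarrow> int \<Rightarrow> real" where
  "dval s u v = snd s 0 (fst s aROW u + v)"

lemma rval_Dx [simp]: "rval (Dx u v) s = dval s (ival u s) (ival v s)"
  by (simp add: Dx_def dval_def)

lemma rval_Wx [simp]: "z = 1 \<or> z = 2 \<Longrightarrow> rval (Wx z u v) s = dval s (ival u s) (ival v s) ^ z"
  by (auto simp: Wx_def power2_eq_square)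

lemma dval_cong: "fst s' aROW = fst s aROW \<Longrightarrow> snd s' 0 = snd s 0 \<Longrightarrow> dval s' = dval s"
  by (simp add: dval_def fun_eq_iff)

lemma dval_iupdate [simp]: "x \<noteq> aROW \<Longrightarrow> dval (iupdate x j v s) = dval s"
  and dval_rupdate [simp]: "y \<noteq> 0 \<Longrightarrow> dval (rupdate y j r s) = dval s"
  by (rule dval_cong; simp)+

subsection \<open>Program text\<close>

text \<open>Iterated addition is affordable since each multiplier is itself counted among the loop
  bounds.\<close>

definition MUL :: "nat \<Rightarrow> nat \<Rightarrow> prog" where
  "MUL x y = block [PIV vTMP (IConst 0), PFor iI y (PIV vTMP (IAdd (IV vTMP) (IV x))), PIV x (IV vTMP)]"

definition SETUP0 :: prog where
  "SETUP0 = block [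
     PIV vN (IGet 0 (IConst 0)), PIV vK (IGet 0 (IConst 1)), PIV vT (IGet 0 (IConst 2)),
     PIV vK1 (IAdd (IV vK) (IConst 1))]"

definition SETUP1 :: "int \<Rightarrow> int \<Rightarrow> prog" where
  "SETUP1 a q = block [
     PFor iI vN (PI aROW (IAdd (IV iI) (IConst 1)) (IAdd (IGet aROW (IV iI)) (IV vN))),
     PFor iI vT (PI aGROW (IAdd (IV iI) (IConst 1)) (IAdd (IGet aGROW (IV iI)) (IV vN))),
     PFor iV vN (PFor iJ vT (PI aMASK (IV iV)
       (IAdd (IAdd (IGet aMASK (IV iV)) (IGet aMASK (IV iV))) (IGet GR (IAdd (IGet aGROW (IV iJ)) (IV iV)))))),
     PIV vP2 (IConst 1),
     PFor iI vT (PIV vP2 (IAdd (IV vP2) (IV vP2))),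
     PIV vP2 (IAdd (IV vP2) (IConst 1)),
     PIV vRR (IConst 2),
     PIV vPP (IConst 1),
     PFor iI vN (PIf (ILess (IV vPP) (IV vN))
       (PSeq (PIV vPP (IAdd (IV vPP) (IV vPP))) (PIV vRR (IAdd (IV vRR) (IConst (q * a))))) PSkip),
     PIV vNN (IConst 0),
     PFor iI vN (PIV vNN (IAdd (IV vNN) (IConst (4608 * q ^ 4))))]"

definition SETUP2 :: "int \<Rightarrow> prog" where
  "SETUP2 q = block [PIV vB (IConst (4608 * q ^ 4)), MUL vB vK1, MUL vB vP2, MUL vB vK, MUL vB vRR]"

definition SETUP3 :: prog where
  "SETUP3 = block [
     PIV vCODES (IConst 1), PFor iJ vK1 (MUL vCODES vK),
     PIV vTRIALS (IConst 2), MUL vTRIALS vN, MUL vTRIALS vN, MUL vTRIALS vN, PFor iJ vK (MUL vTRIALS vB)]"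

text \<open>The smallest distance is guessed as that of a random pair and serves as unit of length.
  If the pair has distance 0, the unit is 1, which is adequate if there is only one point.\<close>

definition GUESS :: "nat \<Rightarrow> prog" where
  "GUESS z = block [
     PRand aLD vN, PRand vU vN, PRand vV vN,
     PRV rR0 (Dx (IV vU) (IV vV)),
     PIf (RLess (ROfInt (IConst 0)) (RV rR0)) PSkip (PRV rR0 (ROfInt (IConst 1))),
     PFor iV vN (PR rMINW (IV iV) (Wx z (IV iV) (IV aLD)))]"

text \<open>Sampling by inversion of the cumulative weights, with \<open>vR\<close> divided by
  \<open>vNN\<close> in place of a uniform real and cross-multiplied comparisons. The initial
  selection is the first leader, which is at hand even if there are no clients.\<close>

definition SCAN :: prog where
  "SCAN = block [
     PRV rACC (ROfInt (IConst 0)), PIV vSEL (IV aLD),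
     PFor iV vN (PIf (BPos (IGet CL (IV iV)))
       (PSeq (PIf (RLess (RMul (ROfInt (IV vR)) (RV rTOT)) (RMul (RV rACC) (ROfInt (IV vNN))))
               PSkip (PIV vSEL (IV iV)))
             (PRV rACC (RAdd (RV rACC) (RGet rMINW (IV iV))))) PSkip)]"

definition SAMPLE :: "nat \<Rightarrow> prog" where
  "SAMPLE z = block [
     PRV rTOT (ROfInt (IConst 0)),
     PFor iV vN (PIf (BPos (IGet CL (IV iV))) (PRV rTOT (RAdd (RV rTOT) (RGet rMINW (IV iV)))) PSkip),
     PRand vR vNN,
     SCAN,
     PI aLD (IAdd (IV iJ) (IConst 1)) (IV vSEL),
     PFor iV vN (PIf (RLess (Wx z (IV iV) (IV vSEL)) (RGet rMINW (IV iV)))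
       (PR rMINW (IV iV) (Wx z (IV iV) (IV vSEL))) PSkip)]"

definition CANDB :: "nat \<Rightarrow> bexp" where
  "CANDB x = BAnd (BPos (IGet FA (IV x)))
     (BAnd (BEq (IGet aMASK (IV x)) (IV vTY)) (RLess (Dx (IGet aLD (IV vLI)) (IV x)) (RV rRAD)))"

definition BETTERB :: bexp where
  "BETTERB = BOr (ILess (IGet CAP (IV iV)) (IGet CAP (IV iU)))
     (BAnd (BEq (IGet CAP (IV iU)) (IGet CAP (IV iV))) (ILess (IV iU) (IV iV)))"

text \<open>The random exponent \<open>vEX\<close> must not bound a loop; so the radius is computed
  in a loop over all exponents that stops multiplying in time. An empty slot is marked by
  -1.\<close>

definition PICK :: "int \<Rightarrow> prog" where
  "PICK q = block [
     PRV rRAD (RV rR0),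
     PFor iV vRR (PIf (ILess (IV iV) (IV vEX))
       (PRV rRAD (RMul (RV rRAD) (RDiv (ROfInt (IConst (q + 1))) (ROfInt (IConst q))))) PSkip),
     PI aF (IV iJ) (IConst (-1)),
     PFor iV vN (PIf (CANDB iV)
       (block [PIV vCNT (IConst 0),
          PFor iU vN (PIf (BAnd (CANDB iU) BETTERB) (PIV vCNT (IAdd (IV vCNT) (IConst 1))) PSkip),
          PIf (BEq (IV vCNT) (IV vRK)) (PI aF (IV iJ) (IV iV)) PSkip]) PSkip)]"

definition SELECT :: "int \<Rightarrow> prog" where
  "SELECT q = block [PRand vLI vK1, PRand vTY vP2, PRand vRK vK, PRand vEX vRR, PICK q]"

definition CENTERS :: prog where
  "CENTERS = block [
     PFor iV vN (PI aSV (IV iV) (IConst 0)),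
     PFor iJ vK (PIf (ILess (IGet aF (IV iJ)) (IConst 0)) PSkip (PI aSV (IGet aF (IV iJ)) (IConst 1)))]"

definition GROUPS :: prog where
  "GROUPS = block [
     PIV vOK (IConst 1),
     PFor iJ vT (block [
       PIV vCNT (IConst 0),
       PFor iV vN (PIf (BAnd (BPos (IGet aSV (IV iV))) (BPos (IGet GR (IAdd (IGet aGROW (IV iJ)) (IV iV)))))
         (PIV vCNT (IAdd (IV vCNT) (IConst 1))) PSkip),
       PIf (BOr (ILess (IV vCNT) (IGet LO (IV iJ))) (ILess (IGet UP (IV iJ)) (IV vCNT)))
         (PIV vOK (IConst 0)) PSkip])]"

definition INB :: "nat \<Rightarrow> bexp" where
  "INB x = BAnd (BPos (IGet CL (IV x))) (ILess (IV x) (IV vCC))"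

definition CHECK :: "nat \<Rightarrow> prog" where
  "CHECK z = block [
     PIV vVAL (IConst 1),
     PRV rCOST (ROfInt (IConst 0)),
     PFor iV vN (PIf (INB iV) (block [
       PRV rCOST (RAdd (RV rCOST) (Wx z (IV iV) (IGet aRHO2 (IV iV)))),
       PIV vCNT (IConst 0),
       PFor iU vN (PIf (BAnd (INB iU) (BEq (IGet aRHO2 (IV iU)) (IGet aRHO2 (IV iV))))
         (PIV vCNT (IAdd (IV vCNT) (IConst 1))) PSkip),
       PIf (BAnd (BPos (IGet aSV (IGet aRHO2 (IV iV)))) (BNot (ILess (IGet CAP (IGet aRHO2 (IV iV))) (IV vCNT))))
         PSkip (PIV vVAL (IConst 0))]) PSkip)]"

definition DELTA :: "nat \<Rightarrow> rexp" where
  "DELTA z = RSub (Wx z (IV iV) (IGet aF (IGet aNX (IV iJ)))) (Wx z (IV iV) (IGet aF (IV iJ)))"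

definition CHEAPEST :: "nat \<Rightarrow> prog" where
  "CHEAPEST z = block [
     PIV vBI (IConst (-1)),
     PFor iV vN (PIf (BEq (IGet aRHO (IV iV)) (IGet aF (IV iJ)))
       (PIf (BAnd (BNot (ILess (IV vBI) (IConst 0))) (BNot (RLess (DELTA z) (RV rBW)))) PSkip
         (PSeq (PIV vBI (IV iV)) (PRV rBW (DELTA z)))) PSkip)]"

text \<open>Cell \<open>j < k\<close> of \<open>aNX\<close> is the slot to which slot
  \<open>j\<close> passes its cheapest client, cell \<open>k\<close> the slot of the new client.
  Passing a client to its own slot amounts to no move. The moves are read off \<open>aRHO\<close>
  and written to \<open>aRHO2\<close>, hence are simultaneous.\<close>

definition REROUTE :: "nat \<Rightarrow> prog" where
  "REROUTE z = block [
     PFor iV vN (PI aRHO2 (IV iV) (IGet aRHO (IV iV))),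
     PI aRHO2 (IV iC) (IGet aF (IGet aNX (IV vK))),
     PFor iJ vK (PSeq (CHEAPEST z)
       (PIf (ILess (IV vBI) (IConst 0)) PSkip (PI aRHO2 (IV vBI) (IGet aF (IGet aNX (IV iJ))))))]"

definition KEEP :: "nat \<Rightarrow> prog" where
  "KEEP z = block [
     PIV vCC (IAdd (IV iC) (IConst 1)),
     CHECK z,
     PIf (BAnd (BPos (IV vVAL)) (BOr (BEq (IV vHAVE) (IConst 0)) (RLess (RV rCOST) (RV rBEST))))
       (block [PIV vHAVE (IConst 1), PRV rBEST (RV rCOST), PFor iV vN (PI aRHOB (IV iV) (IGet aRHO2 (IV iV)))])
       PSkip]"

text \<open>Increment of a number with \<open>k + 1\<close> digits in base \<open>k\<close>, so that
  \<open>aNX\<close> runs through all \<open>k ^ (k + 1)\<close> reroutings.\<close>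

definition ODOMETER :: prog where
  "ODOMETER = block [
     PIV vCARRY (IConst 1),
     PFor iJ vK1 (PIf (BPos (IV vCARRY))
       (PIf (ILess (IAdd (IGet aNX (IV iJ)) (IConst 1)) (IV vK))
         (PSeq (PI aNX (IV iJ) (IAdd (IGet aNX (IV iJ)) (IConst 1))) (PIV vCARRY (IConst 0)))
         (PI aNX (IV iJ) (IConst 0))) PSkip)]"

definition INSERT :: "nat \<Rightarrow> prog" where
  "INSERT z = block [
     PIV vHAVE (IConst 0),
     PFor iJ vK1 (PI aNX (IV iJ) (IConst 0)),
     PFor iCODE vCODES (block [REROUTE z, KEEP z, ODOMETER]),
     PIf (BPos (IV vHAVE)) (PFor iV vN (PI aRHO (IV iV) (IGet aRHOB (IV iV)))) PSkip]"

text \<open>Vertices without assignment hold -2, in contrast to the -1 of empty slots; otherwise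
  they would be taken for clients of an empty slot.\<close>

definition ASSIGN :: "nat \<Rightarrow> prog" where
  "ASSIGN z = block [
     PFor iV vN (PI aRHO (IV iV) (IConst (-2))),
     PFor iC vN (PIf (BPos (IGet CL (IV iC))) (INSERT z) PSkip)]"

text \<open>Loads and cost are computed afresh and nothing is taken for granted about the
  assignment. A recorded solution is therefore feasible even if the guesses were
  inconsistent.\<close>

definition RECORD :: "nat \<Rightarrow> prog" where
  "RECORD z = block [
     PFor iV vN (PI aRHO2 (IV iV) (IGet aRHO (IV iV))),
     PIV vCC (IV vN),
     CHECK z,
     PIf (BAnd (BAnd (BPos (IV vOK)) (BPos (IV vVAL))) (BOr (BEq (IV vHB) (IConst 0)) (RLess (RV rCOST) (RV rGB))))
       (block [PIV vHB (IConst 1), PRV rGB (RV rCOST),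
          PFor iV vN (PI OUTS (IV iV) (IGet aSV (IV iV))),
          PFor iV vN (PI OUTR (IV iV) (IGet aRHO2 (IV iV)))]) PSkip]"

definition EVAL :: "nat \<Rightarrow> prog" where
  "EVAL z = block [CENTERS, GROUPS, ASSIGN z, RECORD z]"

definition TRIAL :: "nat \<Rightarrow> int \<Rightarrow> prog" where
  "TRIAL z q = block [GUESS z, PFor iJ vK (SAMPLE z), PFor iJ vK (SELECT q), EVAL z]"

definition MAIN :: "nat \<Rightarrow> int \<Rightarrow> prog" where
  "MAIN z q = PFor iTRIAL vTRIALS (TRIAL z q)"

lemmas setup_defs = SETUP0_def SETUP1_def SETUP2_def SETUP3_def MUL_def
lemmas main_defs = MAIN_def TRIAL_def GUESS_def SAMPLE_def SCAN_def SELECT_def PICK_def CANDB_def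
  BETTERB_def EVAL_def CENTERS_def GROUPS_def ASSIGN_def INSERT_def REROUTE_def CHEAPEST_def
  DELTA_def KEEP_def CHECK_def INB_def ODOMETER_def RECORD_def Dx_def BEq_def BOr_def

lemma psimple_programs:
  "psimple SETUP0" "psimple (SETUP1 a q)" "psimple (SETUP2 q)" "psimple SETUP3"
  "z = 1 \<or> z = 2 \<Longrightarrow> psimple (MAIN z q)"
  by (auto simp: setup_defs main_defs Wx_def)

lemma bvars_programs:
  "bvars SETUP0 = {}" "bvars (SETUP1 a q) = {vN, vT}" "bvars (SETUP2 q) = {vK1, vP2, vK, vRR}"
  "bvars SETUP3 = {vK1, vK, vN, vB}"
  "bvars (MAIN z q) = {vTRIALS, vN, vK, vNN, vK1, vP2, vRR, vT, vCODES}"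
  by (auto simp: setup_defs main_defs)

lemma iw_setup [simp]:
  "iw SETUP0 = {vN, vK, vT, vK1}" "rw SETUP0 = {}"
  "iw (SETUP1 a q) = {iI, iV, iJ, aROW, aGROW, aMASK, vP2, vRR, vPP, vNN}" "rw (SETUP1 a q) = {}"
  "iw (SETUP2 q) = {vTMP, iI, vB}" "rw (SETUP2 q) = {}"
  "iw SETUP3 = {vTMP, iI, iJ, vCODES, vTRIALS}" "rw SETUP3 = {}"
  by (auto simp: setup_defs)

lemma iw_MUL [simp]: "iw (MUL x y) = {vTMP, iI, x}" "rw (MUL x y) = {}"
  by (auto simp: MUL_def)

lemma iw_main [simp]:
  "iw (GUESS z) = {aLD, vU, vV, iV}" "rw (GUESS z) = {rR0, rMINW}"
  "iw SCAN = {vSEL, iV}" "rw SCAN = {rACC}"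
  "iw (SAMPLE z) = {iV, vR, vSEL, aLD}" "rw (SAMPLE z) = {rTOT, rACC, rMINW}"
  "iw (PICK q) = {iV, aF, vCNT, iU}" "rw (PICK q) = {rRAD}"
  "iw (SELECT q) = {vLI, vTY, vRK, vEX, iV, aF, vCNT, iU}" "rw (SELECT q) = {rRAD}"
  "iw CENTERS = {iV, aSV, iJ}" "rw CENTERS = {}"
  "iw GROUPS = {vOK, iJ, vCNT, iV}" "rw GROUPS = {}"
  "iw (CHECK z) = {vVAL, iV, vCNT, iU}" "rw (CHECK z) = {rCOST}"
  "iw (CHEAPEST z) = {vBI, iV}" "rw (CHEAPEST z) = {rBW}"
  "iw (REROUTE z) = {iV, aRHO2, iJ, vBI}" "rw (REROUTE z) = {rBW}"
  "iw (KEEP z) = {vCC, vVAL, iV, vCNT, iU, vHAVE, aRHOB}" "rw (KEEP z) = {rCOST, rBEST}"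
  "iw ODOMETER = {vCARRY, iJ, aNX}" "rw ODOMETER = {}"
  "iw (INSERT z) = {vHAVE, iJ, aNX, iCODE, iV, aRHO2, vBI, vCC, vVAL, vCNT, iU, aRHOB, vCARRY, aRHO}"
  "rw (INSERT z) = {rBW, rCOST, rBEST}"
  "iw (ASSIGN z) = {iC, vHAVE, iJ, aNX, iCODE, iV, aRHO2, vBI, vCC, vVAL, vCNT, iU, aRHOB, vCARRY, aRHO}"
  "rw (ASSIGN z) = {rBW, rCOST, rBEST}"
  "iw (RECORD z) = {iV, aRHO2, vCC, vVAL, vCNT, iU, vHB, OUTS, OUTR}" "rw (RECORD z) = {rCOST, rGB}"
  by (auto simp: main_defs)

lemma iw_TRIAL [simp]:
  "iw (TRIAL z q) = {aLD, vU, vV, iV, iJ, vR, vSEL, vLI, vTY, vRK, vEX, aF, vCNT, iU, aSV, vOK, iC, vHAVE,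
     aNX, iCODE, aRHO2, vBI, vCC, vVAL, aRHOB, vCARRY, aRHO, vHB, OUTS, OUTR}"
  "rw (TRIAL z q) = {rR0, rMINW, rTOT, rACC, rRAD, rBW, rCOST, rBEST, rGB}"
  by (auto simp: TRIAL_def EVAL_def)

lemma iw_EVAL [simp]:
  "iw (EVAL z) = {iV, iJ, vCNT, iU, aSV, vOK, iC, vHAVE,
     aNX, iCODE, aRHO2, vBI, vCC, vVAL, aRHOB, vCARRY, aRHO, vHB, OUTS, OUTR}"
  "rw (EVAL z) = {rBW, rCOST, rBEST, rGB}"
  by (auto simp: EVAL_def)

lemma iw_MAIN: "iw (MAIN z q) = insert iTRIAL (iw (TRIAL z q))"
  by (simp add: MAIN_def)

text \<open>The five nested loops of \<open>MAIN\<close> are those over trials, clients to be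
  inserted, reroutings, and two inner ones in \<open>REROUTE\<close> or \<open>CHECK\<close>. They
  cause the fifth power in the running time.\<close>

lemma depth_programs:
  "depth SETUP0 = 0" "depth (SETUP1 a q) = 2" "depth (SETUP2 q) = 1" "depth SETUP3 = 2"
  "depth (MAIN z q) = 5"
  by (simp_all add: setup_defs main_defs)

text \<open>A constant costs 1 whatever its value. So \<open>a\<close> and \<open>q\<close> affect
  the running time only through the loop bounds, and the coefficient does not depend on the
  accuracy.\<close>

lemma tcoeff_programs:
  "tcoeff (SETUP1 a q) = tcoeff (SETUP1 0 0)" "tcoeff (SETUP2 q) = tcoeff (SETUP2 0)"
  "tcoeff (MAIN z q) = tcoeff (MAIN z 0)"
  by (simp_all add: setup_defs main_defs Wx_def)

section \<open>Parameters\<close>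

text \<open>Horner's scheme, as the program computes it by doubling; the first group becomes the
  most significant bit.\<close>

fun bitmask :: "(nat \<Rightarrow> bool) \<Rightarrow> nat \<Rightarrow> nat" where
  "bitmask g 0 = 0"
| "bitmask g (Suc i) = 2 * bitmask g i + of_bool (g i)"

lemma bitmask_less: "bitmask g i < 2 ^ i"
  by (induction i) auto

lemma bitmask_inj: "bitmask g i = bitmask h i \<Longrightarrow> j < i \<Longrightarrow> g j = h j"
proof (induction i)
  case (Suc i)
  have "g i = h i"
    using arg_cong[OF Suc.prems(1), of "\<lambda>m. m mod 2"] by (cases "g i"; cases "h i") simp_all
  with Suc show ?case by (auto simp: less_Suc_eq)
qed simp

lemma vector_array_int [simp]: "v < m \<Longrightarrow> vector_array m f (int v) = f v"
  by (simp add: vector_array_def)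

lemma matrix_array_int:
  assumes "i < l" "j < m"
  shows "matrix_array l m f (int (i * m) + int j) = f i j"
proof -
  have "i * m + j < l * m"
    using assms mult_le_mono1[of "Suc i" l m] by simp
  then have "matrix_array l m f (int (i * m + j)) = f i j"
    unfolding matrix_array_def by (subst vector_array_int) (use assms in simp_all)
  then show ?thesis by simp
qed

locale cfr =
  fixes I :: cfr_instance and a z q :: nat
  assumes wf: "wf_instance I" and aspect: "aspect_ratio_bounded a I"
    and z: "z = 1 \<or> z = 2" and q: "0 < q"
begin

abbreviation n :: nat where "n \<equiv> nverts I"
abbreviation k :: nat where "k \<equiv> ncenters I"
abbreviation t :: nat where "t \<equiv> ngroups I"
abbreviation pts :: "nat set" where "pts \<equiv> points I"
abbreviation dis :: "nat \<Rightarrow> nat \<Rightarrow> real" where "dis \<equiv> distance I"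
abbreviation cls :: "nat set" where "cls \<equiv> clients I"
abbreviation facs :: "nat set" where "facs \<equiv> facilities I"

definition lg :: nat where "lg = (LEAST l. n \<le> 2 ^ l)"
text \<open>Since \<open>(1 + 1 / q) ^ q\<close> is at least 2, \<open>q * a * lg\<close> factors
  reach the aspect ratio \<open>n ^ a\<close>. One more makes the ball contain its boundary point,
  and one more counts the exponent 0.\<close>

definition nrad :: nat where "nrad = 2 + q * a * lg"
text \<open>The inverse probability that one sampling step and one selection succeed: the factors
  stand for a hit, the index of the leader, the group type, the rank and the radius.\<close>

definition base :: nat where
  "base = 4608 * q ^ 4 * (k + 1) * (2 ^ t + 1) * k * nrad"
text \<open>Twice the inverse success probability of a trial; \<open>n ^ 3\<close> stands for the
  first leader and the pair that gives the unit of length.\<close>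

definition trials :: nat where "trials = 2 * n ^ 3 * base ^ k"

definition gmask :: "nat \<Rightarrow> nat" where
  "gmask v = bitmask (\<lambda>i. v \<in> group_set I i) t"

definition params :: "state \<Rightarrow> bool" where
  "params s \<longleftrightarrow> (\<forall>x\<le>6. fst s x = encode_ints I x) \<and> snd s 0 = encode_reals I 0 \<and>
     iv s vN = int n \<and> iv s vK = int k \<and> iv s vT = int t \<and> iv s vK1 = int (k + 1) \<and>
     iv s vP2 = int (2 ^ t + 1) \<and> iv s vRR = int nrad \<and> iv s vNN = int (4608 * q ^ 4 * n) \<and>
     iv s vCODES = int (k ^ (k + 1)) \<and> iv s vTRIALS = int trials \<and>
     (\<forall>u<n. fst s aROW (int u) = int (u * n)) \<and> (\<forall>i<t. fst s aGROW (int i) = int (i * n)) \<and>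
     (\<forall>v<n. fst s aMASK (int v) = int (gmask v))"

lemma params_agree:
  assumes "agree X Y s s'" "X \<inter> ({..6} \<union> {10..22}) = {}" "0 \<notin> Y"
  shows "params s' = params s"
proof -
  have "fst s' x = fst s x" if "x \<le> 6 \<or> 10 \<le> x \<and> x \<le> 22" for x
    by (rule agree_fst[OF assms(1)]) (use assms(2) that in auto)
  moreover have "snd s' 0 = snd s 0" by (rule agree_snd[OF assms(1,3)])
  ultimately show ?thesis unfolding params_def by simp
qed

lemma params_iupdate [simp]: "22 < x \<Longrightarrow> params (iupdate x j v s) = params s"
  by (rule params_agree[of "{x}" "{}", OF agree_iupdate]) auto

lemma params_rupdate [simp]: "0 < x \<Longrightarrow> params (rupdate x j r s) = params s"
  by (rule params_agree[of "{}" "{x}"]) (auto simp: agree_def)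

lemma pos: "0 < n" "0 < k" "0 < t"
  and pts_n: "v \<in> pts \<Longrightarrow> v < n"
  and metric: "Metric_space pts dis"
  and cls_pts: "cls \<subseteq> pts" and facs_pts: "facs \<subseteq> pts"
  and groups: "i < t \<Longrightarrow> group_set I i \<subseteq> facs"
  using wf by (auto simp: wf_instance_def points_def)

lemma finite_pts: "finite pts" "finite cls" "finite facs"
proof -
  show "finite pts" using pts_n by (intro finite_subset[of pts "{..<n}"]) auto
  then show "finite cls" "finite facs" using cls_pts facs_pts finite_subset by blast+
qed

context
  fixes s assumes s: "params s"
begin

lemma scalars:
  "iv s vN = int n" "iv s vK = int k" "iv s vT = int t" "iv s vK1 = 1 + int k"
  "iv s vP2 = 2 ^ t + 1" "iv s vRR = int nrad" "iv s vNN = 4608 * int q ^ 4 * int n"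
  "iv s vCODES = int (k ^ (k + 1))" "iv s vTRIALS = int trials"
  using s by (auto simp: params_def)

lemma CL_val: "v < n \<Longrightarrow> fst s CL (int v) = of_bool (v \<in> cls)"
  using s by (simp add: params_def encode_ints_def)

lemma FA_val: "v < n \<Longrightarrow> fst s FA (int v) = of_bool (v \<in> facs)"
  using s by (simp add: params_def encode_ints_def)

text \<open>All integers are covered, since an assignment under examination may contain the negative
  markers; these have capacity 0.\<close>

lemma CAP_val: "fst s CAP g = (if 0 \<le> g \<and> nat g \<in> facs then int (capacity I (nat g)) else 0)"
proof -
  have "fst s CAP = vector_array n (\<lambda>v. if v \<in> facs then int (capacity I v) else 0)"
    using s by (simp add: params_def encode_ints_def)
  moreover have "g < int n" if "0 \<le> g" "nat g \<in> facs"
    using that facs_pts pts_n[of "nat g"] by auto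
  ultimately show ?thesis by (auto simp: vector_array_def)
qed

lemma GR_val: "i < t \<Longrightarrow> v < n \<Longrightarrow>
    fst s GR (fst s aGROW (int i) + int v) = of_bool (v \<in> group_set I i)"
  using s matrix_array_int[of i t v n "\<lambda>i v. of_bool (v \<in> group_set I i) :: int"]
  by (simp add: params_def encode_ints_def)

lemma LO_val: "i < t \<Longrightarrow> fst s LO (int i) = lower_bound I i"
  and UP_val: "i < t \<Longrightarrow> fst s UP (int i) = upper_bound I i"
  using s by (simp_all add: params_def encode_ints_def)

lemma MASK_val: "v < n \<Longrightarrow> fst s aMASK (int v) = int (gmask v)"
  using s by (simp add: params_def)

lemma dval_val:
  assumes "u \<in> pts" "v \<in> pts"
  shows "dval s (int u) (int v) = dis u v"
  using s assms pts_n[of u] pts_n[of v]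
    matrix_array_int[of u n v n "\<lambda>u v. if u \<in> pts \<and> v \<in> pts then dis u v else 0"]
  by (simp add: dval_def params_def encode_reals_def)

end

section \<open>Evaluation of a set of centers\<close>

lemma CENTERS:
  assumes s: "params s" and F: "\<And>j. j < k \<Longrightarrow> fst s aF (int j) < int n"
  shows "ensures CENTERS s (\<lambda>s'. \<forall>i. fst s' aSV i =
    (if 0 \<le> i \<and> i < int n then of_bool (\<exists>j<k. fst s aF (int j) = i) else fst s aSV i))"
  unfolding CENTERS_def block.simps ensures_simps
proof (rule ensures_conseq[OF ensures_map_loop[where m = n and g = "\<lambda>_. 0"]])
  fix s1 assume s1: "fst s1 aSV = (\<lambda>j. if 0 \<le> j \<and> j < int n then 0 else fst s aSV j)"
    and a1: "agree (iw (PFor iV vN (PI aSV (IV iV) (IConst 0)))) (rw (PFor iV vN (PI aSV (IV iV) (IConst 0)))) s s1"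
  have F1: "fst s1 aF = fst s aF" "iv s1 vK = int k"
    using a1 s by (simp_all add: agree_def scalars)
  show "ensures (PFor iJ vK (PIf (ILess (IGet aF (IV iJ)) (IConst 0)) PSkip (PI aSV (IGet aF (IV iJ)) (IConst 1)))) s1
    (\<lambda>s'. \<forall>i. fst s' aSV i =
      (if 0 \<le> i \<and> i < int n then of_bool (\<exists>j<k. fst s aF (int j) = i) else fst s aSV i))"
  proof (rule ensures_PFor[where m = k and I = "\<lambda>m s'. \<forall>i. fst s' aSV i =
      (if 0 \<le> i \<and> i < int n then of_bool (\<exists>j<m. fst s aF (int j) = i) else fst s aSV i)"], goal_cases)
    case (3 m s2)
    have "fst s2 aF = fst s aF" using 3(4) F1 by (simp add: agree_def)
    then show ?case
      using 3(1-3) F[of m] by (auto simp: less_Suc_eq)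
  qed (use F1 in \<open>simp_all add: s1\<close>)
qed (use s in \<open>auto simp: scalars\<close>)

lemma GROUPS:
  assumes s: "params s"
  shows "ensures GROUPS s (\<lambda>s'. iv s' vOK = of_bool (\<forall>i<t.
    lower_bound I i \<le> int (card {v. v < n \<and> 0 < fst s aSV (int v) \<and> v \<in> group_set I i}) \<and>
    int (card {v. v < n \<and> 0 < fst s aSV (int v) \<and> v \<in> group_set I i}) \<le> upper_bound I i))"
proof -
  define cnt where "cnt i = int (card {v. v < n \<and> 0 < fst s aSV (int v) \<and> v \<in> group_set I i})" for i
  have "ensures GROUPS s (\<lambda>s'. iv s' vOK = of_bool (\<forall>i<t. lower_bound I i \<le> cnt i \<and> cnt i \<le> upper_bound I i))"
    unfolding GROUPS_def block.simps ensures_simps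
  proof (rule ensures_PFor[where m = t and I = "\<lambda>m s'. iv s' vOK =
      of_bool (\<forall>i<m. lower_bound I i \<le> cnt i \<and> cnt i \<le> upper_bound I i)"], goal_cases)
    case (3 i s1)
    have p1: "params s1" by (subst params_agree[OF 3(4)]) (use s in auto)
    have SV: "fst s1 aSV = fst s aSV" using 3(4) by (simp add: agree_def)
    show ?case
      unfolding ensures_simps
    proof (rule ensures_conseq[OF ensures_count_loop[where m = n and
          Q = "\<lambda>v. 0 < fst s aSV (int v) \<and> v \<in> group_set I i"]], goal_cases)
      case (3 v s2)
      then show ?case
        using GR_val[OF p1 \<open>i < t\<close>, of v] \<open>iv s1 iJ = int i\<close> by (simp add: agree_def SV)
    next
      case (4 s2)
      have [simp]: "iv s2 vCNT = cnt i" using 4(1) by (simp add: cnt_def)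
      have "fst s2 LO = fst s1 LO" "fst s2 UP = fst s1 UP" "iv s2 iJ = int i" "iv s2 vOK = iv s1 vOK"
        using 4(2) \<open>iv s1 iJ = int i\<close> by (auto simp: agree_def)
      then show ?case
        using \<open>iv s1 vOK = _\<close> LO_val[OF p1 \<open>i < t\<close>] UP_val[OF p1 \<open>i < t\<close>]
        by (auto simp: less_Suc_eq)
    qed (use scalars(1)[OF p1] in auto)
  qed (use scalars(3)[OF s] in auto)
  then show ?thesis by (simp add: cnt_def)
qed

section \<open>Checking loads and computing the cost of an assignment\<close>

definition wcost :: "state \<Rightarrow> nat \<Rightarrow> int \<Rightarrow> real" where
  "wcost s v g = dval s (int v) g ^ z"

definition open_cells :: "state \<Rightarrow> int set" where
  "open_cells s = {g. 0 < fst s aSV g}"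

definition caps :: "int \<Rightarrow> nat" where
  "caps g = (if 0 \<le> g \<and> nat g \<in> facs then capacity I (nat g) else 0)"

lemma CHECK:
  fixes s defines "A \<equiv> {v \<in> cls. int v < iv s vCC}" and "\<rho> \<equiv> \<lambda>v. fst s aRHO2 (int v)"
  assumes s: "params s"
  shows "ensures (CHECK z) s (\<lambda>s'. iv s' vVAL = of_bool (obeys A (open_cells s) caps \<rho>) \<and>
    rv s' rCOST = assign_cost (wcost s) A \<rho>)"
proof -
  define ok where "ok v \<longleftrightarrow> 0 < fst s aSV (\<rho> v) \<and> load A \<rho> (\<rho> v) \<le> caps (\<rho> v)" for v
  have A: "v \<in> A \<longleftrightarrow> v < n \<and> v \<in> cls \<and> int v < iv s vCC" for v
    using cls_pts pts_n by (auto simp: A_def)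
  have finA: "finite A" using finite_pts by (simp add: A_def)
  have "ensures (CHECK z) s (\<lambda>s'. iv s' vVAL = of_bool (\<forall>v. v < n \<and> v \<in> A \<longrightarrow> ok v) \<and>
      rv s' rCOST = (\<Sum>v | v < n \<and> v \<in> A. wcost s v (\<rho> v)))"
    unfolding CHECK_def block.simps ensures_simps
  proof (rule ensures_PFor[where m = n and I = "\<lambda>m s'. iv s' vVAL = of_bool (\<forall>v. v < m \<and> v \<in> A \<longrightarrow> ok v) \<and>
      rv s' rCOST = (\<Sum>v | v < m \<and> v \<in> A. wcost s v (\<rho> v))"], goal_cases)
    case (3 i s1)
    note i = \<open>i < n\<close> \<open>iv s1 iV = int i\<close>
    have p1: "params s1" by (subst params_agree[OF 3(4)]) (use s in auto)
    have eqs: "fst s1 aSV = fst s aSV" "fst s1 aRHO2 = fst s aRHO2" "fst s1 vCC = fst s vCC"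
        "dval s1 = dval s"
      using 3(4) by (simp_all add: agree_def dval_def fun_eq_iff)
    have inA: "bval (INB iV) s1 \<longleftrightarrow> i \<in> A"
      using i CL_val[OF p1, of i] by (simp add: INB_def A eqs)
    show ?case
    proof (cases "i \<in> A")
      case False
      then have "(\<forall>v. v < Suc i \<and> v \<in> A \<longrightarrow> ok v) = (\<forall>v. v < i \<and> v \<in> A \<longrightarrow> ok v)"
        by (auto simp: less_Suc_eq)
      then show ?thesis using 3(2) False inA by (simp add: sum_less_Suc_Collect)
    next
      case True
      have "{u. u < n \<and> u \<in> A \<and> \<rho> u = \<rho> i} = {u \<in> A. \<rho> u = \<rho> i}" using A by auto
      then have cnt: "card {u. u < n \<and> u \<in> A \<and> \<rho> u = \<rho> i} = load A \<rho> (\<rho> i)" by (simp add: load_def)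
      have b: "bval (INB iV) s1" using inA True by simp
      show ?thesis
        unfolding ensures_simps if_P[OF b]
      proof (intro ensures_conseq[OF ensures_count_loop[where m = n and
            Q = "\<lambda>u. u \<in> A \<and> \<rho> u = \<rho> i"]], goal_cases)
        case (3 u s2)
        then show ?case
          using CL_val[OF p1, of u] i by (simp add: INB_def agree_def eqs A \<rho>_def conj_ac)
      next
        case (4 s2)
        have e2: "iv s2 vCNT = int (load A \<rho> (\<rho> i))" using 4(1) by (simp add: cnt)
        have e3: "fst s2 aSV = fst s aSV" "fst s2 aRHO2 = fst s aRHO2" "fst s2 CAP = fst s1 CAP"
          "iv s2 iV = int i" "iv s2 vVAL = iv s1 vVAL"
          "rv s2 rCOST = rv s1 rCOST + wcost s i (\<rho> i)"
          using 4(2) i z by (auto simp: agree_def eqs wcost_def \<rho>_def)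
        have ok: "0 < fst s2 aSV (fst s2 aRHO2 (iv s2 iV)) \<and> \<not> fst s2 CAP (fst s2 aRHO2 (iv s2 iV)) < iv s2 vCNT \<longleftrightarrow> ok i"
          by (auto simp: e2 e3 ok_def \<rho>_def CAP_val[OF p1] caps_def)
        have split: "(\<forall>v. v < Suc i \<and> v \<in> A \<longrightarrow> ok v) = ((\<forall>v. v < i \<and> v \<in> A \<longrightarrow> ok v) \<and> ok i)"
          using True by (auto simp: less_Suc_eq)
        show ?case
          using \<open>iv s1 vVAL = _ \<and> _\<close> True ok e3(5,6)
          by (simp add: split sum_less_Suc_Collect)
      qed (use scalars(1)[OF p1] in auto)
    qed
  qed (use scalars(1)[OF s] in auto)
  moreover have "(\<forall>v. v < n \<and> v \<in> A \<longrightarrow> ok v) \<longleftrightarrow> obeys A (open_cells s) caps \<rho>"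
  proof
    assume all: "\<forall>v. v < n \<and> v \<in> A \<longrightarrow> ok v"
    then have okA: "ok v" if "v \<in> A" for v using that A by auto
    have "load A \<rho> f \<le> caps f" for f
    proof (cases "f \<in> \<rho> ` A")
      case True
      then show ?thesis using okA by (auto simp: ok_def)
    next
      case False
      then have "{v \<in> A. \<rho> v = f} = {}" by auto
      then show ?thesis unfolding load_def by (metis card.empty le0)
    qed
    then show "obeys A (open_cells s) caps \<rho>"
      using okA by (auto simp: obeys_def open_cells_def ok_def)
  qed (auto simp: obeys_def open_cells_def ok_def)
  moreover have "{v. v < n \<and> v \<in> A} = A" using A by auto
  ultimately show ?thesis by (simp add: assign_cost_def)
qed

section \<open>Enumeration of the reroutings by digits in base \<open>k\<close>\<close>

definition digit :: "nat \<Rightarrow> nat \<Rightarrow> nat" where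
  "digit c j = (c div k ^ j) mod k"

lemma digit_less: "digit c j < k"
  using pos by (simp add: digit_def)

text \<open>The carry reaches position \<open>i\<close> exactly if \<open>k ^ i\<close> divides the
  new number. Expressing the carry flag in this way makes it a closed formula for the loop invariant
  of \<open>ODOMETER\<close>.\<close>

lemma digit_Suc:
  "digit (Suc c) i = (if k ^ i dvd Suc c then (if digit c i + 1 < k then digit c i + 1 else 0) else digit c i)"
proof (cases "k ^ i dvd Suc c")
  case True
  then have "Suc c div k ^ i = Suc (c div k ^ i)" by (simp add: div_Suc dvd_eq_mod_eq_0)
  moreover have "digit c i + 1 \<le> k" using digit_less[of c i] by simp
  ultimately show ?thesis using True by (auto simp: digit_def mod_Suc)
next
  case False
  then have "Suc c div k ^ i = c div k ^ i" by (simp add: div_Suc dvd_eq_mod_eq_0)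
  then show ?thesis using False by (simp add: digit_def)
qed

lemma carry_Suc: "k ^ Suc i dvd Suc c \<longleftrightarrow> k ^ i dvd Suc c \<and> \<not> digit c i + 1 < k"
proof (cases "k ^ i dvd Suc c")
  case True
  then have eq: "Suc c div k ^ i = Suc (c div k ^ i)" by (simp add: div_Suc dvd_eq_mod_eq_0)
  have c: "Suc c = k ^ i * (Suc c div k ^ i)" using True by simp
  have "k ^ Suc i dvd Suc c \<longleftrightarrow> k ^ i * k dvd k ^ i * (Suc c div k ^ i)"
    by (subst c) (simp only: power_Suc2)
  also have "\<dots> \<longleftrightarrow> k dvd Suc (c div k ^ i)" using pos by (simp add: eq del: mult_Suc_right)
  also have "\<dots> \<longleftrightarrow> \<not> digit c i + 1 < k"
    using digit_less[of c i] by (auto simp: dvd_eq_mod_eq_0 mod_Suc digit_def)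
  finally show ?thesis using True by simp
next
  case False
  have "k ^ i dvd k ^ Suc i" by simp
  then show ?thesis using False dvd_trans by blast
qed

lemma ODOMETER:
  assumes s: "params s" and nx: "\<And>j. j \<le> k \<Longrightarrow> fst s aNX (int j) = int (digit c j)"
  shows "ensures ODOMETER s (\<lambda>s'. \<forall>j\<le>k. fst s' aNX (int j) = int (digit (Suc c) j))"
  unfolding ODOMETER_def block.simps ensures_simps
proof (rule ensures_PFor[where m = "k + 1" and I = "\<lambda>i s'. iv s' vCARRY = of_bool (k ^ i dvd Suc c) \<and>
    (\<forall>j\<le>k. fst s' aNX (int j) = int (digit (if j < i then Suc c else c) j))"], goal_cases)
  case (3 i s1)
  then have vK: "iv s1 vK = int k" using s by (simp add: agree_fst scalars)
  have c0: "i \<le> k" "iv s1 iJ = int i"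
      "\<And>j. j \<le> k \<Longrightarrow> fst s1 aNX (int j) = int (digit (if j < i then Suc c else c) j)"
    using 3 by auto
  have b1: "bval (BPos (IV vCARRY)) s1 \<longleftrightarrow> k ^ i dvd Suc c" using 3(2) by simp
  have b2: "bval (ILess (IAdd (IGet aNX (IV iJ)) (IConst 1)) (IV vK)) s1 \<longleftrightarrow> digit c i + 1 < k"
    using c0 vK by auto
  have *: "digit (if j < Suc i then Suc c else c) j
      = (if j = i then digit (Suc c) i else digit (if j < i then Suc c else c) j)" for j
    by (auto simp: less_Suc_eq)
  show ?case
    unfolding ensures_simps b1 b2
    using c0(1,2) c0(3)[of i] 3(2) c0(3)
    by (simp add: carry_Suc digit_Suc[of c i] * del: power_Suc)
next
  case 2
  show ?case using nx pos by simp
qed (use scalars(4)[OF s] in auto)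

subsection \<open>Insertion of a client\<close>

definition shift_gain :: "state \<Rightarrow> nat \<Rightarrow> nat \<Rightarrow> real" where
  "shift_gain s j v = wcost s v (fst s aF (fst s aNX (int j))) - wcost s v (fst s aF (int j))"

definition cheapest_in :: "state \<Rightarrow> nat \<Rightarrow> nat \<Rightarrow> int \<Rightarrow> bool" where
  "cheapest_in s m j b \<longleftrightarrow> b = -1 \<and> (\<forall>v<m. fst s aRHO (int v) \<noteq> fst s aF (int j)) \<or>
     (\<exists>u<m. b = int u \<and> fst s aRHO (int u) = fst s aF (int j) \<and>
       (\<forall>v<m. fst s aRHO (int v) = fst s aF (int j) \<longrightarrow> shift_gain s j u \<le> shift_gain s j v))"

lemma cheapest_in_cong:
  assumes "fst s' aF = fst s aF" "fst s' aNX = fst s aNX" "fst s' aRHO = fst s aRHO" "dval s' = dval s"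
  shows "cheapest_in s' = cheapest_in s"
  using assms by (simp add: cheapest_in_def shift_gain_def wcost_def fun_eq_iff)

lemma CHEAPEST:
  assumes s: "params s" and j: "iv s iJ = int j"
  shows "ensures (CHEAPEST z) s (\<lambda>s'. cheapest_in s n j (iv s' vBI))"
  unfolding CHEAPEST_def block.simps ensures_simps
proof (rule ensures_PFor[where m = n and I = "\<lambda>m s'. cheapest_in s m j (iv s' vBI) \<and>
    (0 \<le> iv s' vBI \<longrightarrow> rv s' rBW = shift_gain s j (nat (iv s' vBI)))"], goal_cases)
  case (3 i s1)
  have eqs: "fst s1 aF = fst s aF" "fst s1 aNX = fst s aNX" "fst s1 aRHO = fst s aRHO"
      "iv s1 iJ = int j" "dval s1 = dval s"
    using 3(4) j by (simp_all add: agree_def dval_def fun_eq_iff)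
  have D: "rval (DELTA z) s1 = shift_gain s j i"
      "rval (DELTA z) (iupdate vBI 0 (int i) s1) = shift_gain s j i"
    using z 3(3) by (simp_all add: DELTA_def shift_gain_def wcost_def eqs)
  have c: "cheapest_in s i j (iv s1 vBI)" "0 \<le> iv s1 vBI \<Longrightarrow> rv s1 rBW = shift_gain s j (nat (iv s1 vBI))"
    using 3(2) by auto
  show ?case
  proof (cases "fst s aRHO (int i) = fst s aF (int j)")
    case False
    then have "cheapest_in s (Suc i) j (iv s1 vBI)"
      using c(1) unfolding cheapest_in_def by (auto simp: less_Suc_eq)
    then show ?thesis using False c(2) by (simp add: eqs 3(3))
  next
    case True
    show ?thesis
    proof (cases "0 \<le> iv s1 vBI \<and> \<not> shift_gain s j i < rv s1 rBW")
      case keep: True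
      then have "cheapest_in s (Suc i) j (iv s1 vBI)"
        using c unfolding cheapest_in_def by (auto simp: less_Suc_eq)
      then show ?thesis using keep c(2) D by (simp add: eqs 3(3))
    next
      case change: False
      have "cheapest_in s (Suc i) j (int i)"
        using c change True unfolding cheapest_in_def
        by (auto simp: less_Suc_eq)
      then show ?thesis using change D by (auto simp: eqs 3(3) True)
    qed
  qed
qed (use scalars(1)[OF s] in \<open>auto simp: cheapest_in_def\<close>)

definition rerouted :: "state \<Rightarrow> nat \<Rightarrow> nat \<Rightarrow> (nat \<Rightarrow> int) \<Rightarrow> (int \<Rightarrow> int) \<Rightarrow> bool" where
  "rerouted s m c b \<rho> \<longleftrightarrow> \<rho> (int c) = fst s aF (fst s aNX (int k)) \<and>
     (\<forall>v<n. v \<noteq> c \<longrightarrow>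
       (\<forall>j<m. fst s aRHO (int v) = fst s aF (int j) \<longrightarrow> b j = int v \<longrightarrow>
          \<rho> (int v) = fst s aF (fst s aNX (int j))) \<and>
       ((\<forall>j<m. fst s aRHO (int v) = fst s aF (int j) \<longrightarrow> b j \<noteq> int v) \<longrightarrow>
          \<rho> (int v) = fst s aRHO (int v)))"

text \<open>The slots are processed one after the other although the moves are meant to be
  simultaneous. This is harmless since by \<open>uniq\<close> a vertex belongs to one slot at most
  and is written at most once, and by \<open>cF\<close> the entry of the new client is not
  overwritten.\<close>

lemma REROUTE:
  assumes s: "params s" and c: "iv s iC = int c" "c < n"
    and uniq: "\<And>v j j'. v < n \<Longrightarrow> j < k \<Longrightarrow> j' < k \<Longrightarrow> fst s aRHO (int v) = fst s aF (int j) \<Longrightarrow>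
      fst s aRHO (int v) = fst s aF (int j') \<Longrightarrow> j = j'"
    and cF: "\<And>j. j < k \<Longrightarrow> fst s aRHO (int c) \<noteq> fst s aF (int j)"
  shows "ensures (REROUTE z) s (\<lambda>s'. \<exists>b. (\<forall>j<k. cheapest_in s n j (b j)) \<and> rerouted s k c b (fst s' aRHO2))"
  unfolding REROUTE_def block.simps ensures_simps
proof (rule ensures_conseq[OF ensures_map_loop[where m = n and g = "\<lambda>v. fst s aRHO (int v)"]], goal_cases)
  case (4 s1)
  have eqs: "fst s1 aF = fst s aF" "fst s1 aNX = fst s aNX" "fst s1 aRHO = fst s aRHO"
      "iv s1 iC = int c" "iv s1 vK = int k"
    using 4(2) c s by (simp_all add: agree_def scalars)
  show ?case
  proof (rule ensures_PFor[where m = k and I = "\<lambda>m s'. \<exists>b. (\<forall>j<m. cheapest_in s n j (b j)) \<and>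
      rerouted s m c b (fst s' aRHO2)"], goal_cases)
    case 1
    then show ?case by (simp add: eqs)
  next
    case 2
    then show ?case using 4(1) c(2) by (auto simp: rerouted_def eqs)
  next
    case (3 i s2)
    have e2: "fst s2 aF = fst s aF" "fst s2 aNX = fst s aNX" "fst s2 aRHO = fst s aRHO"
        "dval s2 = dval s"
      using 3(4) 4(2) by (simp_all add: agree_def dval_def fun_eq_iff)
    have p2: "params s2"
      using 3(4) 4(2) s by (simp add: params_agree[OF 3(4)] params_agree[OF 4(2)])
    from 3(2) obtain b where b: "\<forall>j<i. cheapest_in s n j (b j)" "rerouted s i c b (fst s2 aRHO2)"
      by blast
    show ?case
      unfolding ensures_simps
    proof (rule ensures_conseq[OF CHEAPEST[OF p2 3(3)]], goal_cases)
      case 5: (1 s3)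
      have e3: "fst s3 aF = fst s aF" "fst s3 aNX = fst s aNX" "fst s3 aRHO2 = fst s2 aRHO2" "iv s3 iJ = int i"
        using 5(2) 3(3) e2 by (simp_all add: agree_def)
      have ch: "cheapest_in s n i (iv s3 vBI)" using 5(1) by (simp add: cheapest_in_cong[OF e2])
      define b' where "b' = b(i := iv s3 vBI)"
      have all: "\<forall>j<Suc i. cheapest_in s n j (b' j)"
        using b(1) ch by (auto simp: b'_def less_Suc_eq)
      have "rerouted s (Suc i) c b' (if iv s3 vBI < 0 then fst s3 aRHO2
          else (fst s3 aRHO2)(iv s3 vBI := fst s aF (fst s aNX (int i))))"
      proof (cases "iv s3 vBI < 0")
        case True
        then show ?thesis
          using b(2) by (auto simp: rerouted_def b'_def e3 less_Suc_eq)
      next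
        case False
        then obtain u where u: "u < n" "iv s3 vBI = int u" "fst s aRHO (int u) = fst s aF (int i)"
          using ch by (auto simp: cheapest_in_def)
        have "u \<noteq> c" using u(3) cF[OF 3(1)] by auto
        moreover have "j = i" if "fst s aRHO (int u) = fst s aF (int j)" "j < Suc i" for j
          using uniq[OF u(1) _ 3(1) that(1) u(3)] that(2) 3(1) by simp
        ultimately show ?thesis
          using b(2) u False by (auto simp: rerouted_def b'_def e3 less_Suc_eq)
      qed
      with all show ?case
        by (cases "iv s3 vBI < 0") (auto simp: e3)
    qed
  qed auto
qed (use scalars(1)[OF s] in \<open>simp_all add: agree_def\<close>)

lemma KEEP:
  fixes s defines "A \<equiv> {v \<in> cls. int v < iv s iC + 1}" and "\<rho> \<equiv> \<lambda>v. fst s aRHO2 (int v)"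
  defines "improves \<equiv> obeys A (open_cells s) caps \<rho> \<and>
    (iv s vHAVE = 0 \<or> assign_cost (wcost s) A \<rho> < rv s rBEST)"
  assumes s: "params s"
  shows "ensures (KEEP z) s (\<lambda>s'. if improves
    then iv s' vHAVE = 1 \<and> rv s' rBEST = assign_cost (wcost s) A \<rho> \<and>
      (\<forall>v<n. fst s' aRHOB (int v) = \<rho> v)
    else iv s' vHAVE = iv s vHAVE \<and> rv s' rBEST = rv s rBEST \<and> fst s' aRHOB = fst s aRHOB)"
  unfolding KEEP_def block.simps ensures_simps
proof (rule ensures_conseq[OF CHECK], goal_cases)
  case (2 s1)
  let ?s = "iupdate vCC (ival (IConst 0) s) (ival (IAdd (IV iC) (IConst 1)) s) s"
  have *: "wcost ?s = wcost s" "open_cells ?s = open_cells s" by (simp_all add: wcost_def open_cells_def fun_eq_iff)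
  have val: "iv s1 vVAL = of_bool (obeys A (open_cells s) caps \<rho>)" "rv s1 rCOST = assign_cost (wcost s) A \<rho>"
    using 2(1) unfolding * by (simp_all add: A_def \<rho>_def)
  have eqs: "iv s1 vHAVE = iv s vHAVE" "rv s1 rBEST = rv s rBEST" "fst s1 aRHOB = fst s aRHOB"
      "fst s1 aRHO2 = fst s aRHO2" "iv s1 vN = int n"
    using 2(2) scalars(1)[OF s] by (simp_all add: agree_def)
  show ?case
  proof (cases improves)
    case False
    then show ?thesis using val eqs by (auto simp: improves_def)
  next
    case True
    then have b: "bval (BAnd (BPos (IV vVAL)) (BOr (BEq (IV vHAVE) (IConst 0)) (RLess (RV rCOST) (RV rBEST)))) s1"
      using val eqs by (auto simp: improves_def)
    show ?thesis
      unfolding if_P[OF True] if_P[OF b] ensures_simps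
      by (rule ensures_conseq[OF ensures_map_loop[where m = n and g = \<rho>]])
        (use eqs val in \<open>auto simp: agree_def \<rho>_def\<close>)
  qed
qed (use s in simp)

lemma ex_code:
  assumes "\<And>j. j \<le> m \<Longrightarrow> d j < k"
  shows "\<exists>c<k ^ Suc m. \<forall>j\<le>m. digit c j = d j"
  using assms
proof (induction m)
  case 0
  then show ?case by (intro exI[of _ "d 0"]) (simp add: digit_def)
next
  case (Suc m)
  then obtain c where c: "c < k ^ Suc m" "\<forall>j\<le>m. digit c j = d j" by force
  let ?c = "c + d (Suc m) * k ^ Suc m"
  have "?c < (1 + d (Suc m)) * k ^ Suc m" using c(1) by simp
  also have "\<dots> \<le> k * k ^ Suc m" using Suc.prems[of "Suc m"] by (intro mult_right_mono) auto
  finally have lt: "?c < k ^ Suc (Suc m)" by simp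
  have "digit ?c j = d j" if "j \<le> Suc m" for j
  proof (cases "j = Suc m")
    case True
    then show ?thesis using c(1) Suc.prems[of "Suc m"] pos by (simp add: digit_def)
  next
    case False
    then have j: "j \<le> m" using that by simp
    have "k ^ Suc m = k ^ j * (k * k ^ (m - j))"
      using j by (metis Suc_diff_le le_SucI le_add_diff_inverse power_Suc power_add)
    then have eq: "?c = c + k ^ j * (d (Suc m) * k ^ (m - j) * k)" by simp
    have "?c div k ^ j = c div k ^ j + d (Suc m) * k ^ (m - j) * k"
      unfolding eq by (rule trans[OF div_mult_self2]) (use pos in simp_all)
    then show ?thesis using c(2) j by (simp add: digit_def)
  qed
  with lt show ?case by blast
qed

definition sited :: "state \<Rightarrow> bool" where
  "sited s \<longleftrightarrow> (\<forall>j<k. fst s aF (int j) \<in> insert (-1) (open_cells s)) \<and>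
     (\<forall>g\<in>open_cells s. 0 \<le> g \<and> (\<exists>j<k. fst s aF (int j) = g)) \<and>
     (\<forall>j<k. \<forall>j'<k. fst s aF (int j) = fst s aF (int j') \<longrightarrow> 0 \<le> fst s aF (int j) \<longrightarrow> j = j')"

definition assigned :: "nat set \<Rightarrow> state \<Rightarrow> bool" where
  "assigned A s \<longleftrightarrow> (\<forall>v<n. v \<notin> A \<longrightarrow> fst s aRHO (int v) = -2) \<and>
     obeys A (open_cells s) caps (\<lambda>v. fst s aRHO (int v)) \<and>
     (\<forall>\<rho>. obeys A (open_cells s) caps \<rho> \<longrightarrow>
        assign_cost (wcost s) A (\<lambda>v. fst s aRHO (int v)) \<le> assign_cost (wcost s) A \<rho>)"

lemma sited_cong: "fst s' aF = fst s aF \<Longrightarrow> fst s' aSV = fst s aSV \<Longrightarrow> sited s' = sited s"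
  by (simp add: sited_def open_cells_def)

lemma assigned_cong:
  "fst s' aSV = fst s aSV \<Longrightarrow> fst s' aRHO = fst s aRHO \<Longrightarrow> dval s' = dval s \<Longrightarrow> assigned A s' = assigned A s"
proof -
  assume a: "fst s' aSV = fst s aSV" "fst s' aRHO = fst s aRHO" "dval s' = dval s"
  then have "open_cells s' = open_cells s" "wcost s' = wcost s"
    by (simp_all add: open_cells_def wcost_def fun_eq_iff)
  with a show ?thesis by (simp add: assigned_def)
qed

text \<open>The competitor \<open>\<rho>0\<close> is fixed because the rerouting that beats it, and
  thus the decisive round of the loop, depends on it. The program does not depend on it, so that
  \<open>INSERT\<close> can let it range over all assignments afterwards.\<close>

lemma INSERT_le:
  fixes s c defines "A \<equiv> {v \<in> cls. v < c}"
  assumes s: "params s" and c: "iv s iC = int c" "c \<in> cls"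
    and sited: "sited s" and as: "assigned A s"
    and \<rho>0: "obeys (insert c A) (open_cells s) caps \<rho>0"
  shows "ensures (INSERT z) s (\<lambda>s'. (\<forall>v<n. v \<notin> insert c A \<longrightarrow> fst s' aRHO (int v) = -2) \<and>
     obeys (insert c A) (open_cells s) caps (\<lambda>v. fst s' aRHO (int v)) \<and>
     assign_cost (wcost s) (insert c A) (\<lambda>v. fst s' aRHO (int v)) \<le> assign_cost (wcost s) (insert c A) \<rho>0)"
proof -
  let ?F = "\<lambda>j. fst s aF (int j)" and ?S = "open_cells s" and ?w = "wcost s"
  define \<rho> where "\<rho> = (\<lambda>v. fst s aRHO (int v))"
  have cn: "c < n" using c(2) cls_pts pts_n by auto
  have An: "v < n" if "v \<in> A" for v using that cls_pts pts_n by (auto simp: A_def)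
  have finA: "finite A" using finite_pts by (simp add: A_def)
  have cA: "c \<notin> A" by (simp add: A_def)
  have A': "{v \<in> cls. int v < int c + 1} = insert c A" using c(2) by (auto simp: A_def)
  have out: "\<rho> v = -2" if "v < n" "v \<notin> A" for v using as that by (simp add: assigned_def \<rho>_def)
  have obA: "obeys A ?S caps \<rho>" using as by (simp add: assigned_def \<rho>_def)
  have optA: "assign_cost ?w A \<rho> \<le> assign_cost ?w A \<rho>'" if "obeys A ?S caps \<rho>'" for \<rho>'
    using as that by (simp add: assigned_def \<rho>_def)
  have S0: "0 \<le> g" if "g \<in> ?S" for g using sited that by (auto simp: sited_def)
  have slotF: "j = j'" if "j < k" "j' < k" "?F j = ?F j'" "?F j \<in> ?S" for j j'
    using sited that S0 unfolding sited_def by blast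
  define slot where "slot g = (SOME j. j < k \<and> ?F j = g)" for g
  have slot: "slot g < k" "?F (slot g) = g" if "g \<in> ?S" for g
    using someI_ex[of "\<lambda>j. j < k \<and> ?F j = g"] sited that by (auto simp: sited_def slot_def)
  have \<rho>S: "\<rho> v \<in> ?S" if "v \<in> A" for v using obA that by (auto simp: obeys_def)
  have Frange: "?F j \<in> insert (-1) ?S" if "j < k" for j using sited that by (simp add: sited_def)
  \<comment> \<open>A vertex with the same entry as a slot must be assigned already: other vertices
    hold -2, which occurs in no slot, and no open facility is -1.\<close>
  have \<rho>F: "v \<in> A \<and> ?F j \<in> ?S" if "v < n" "\<rho> v = ?F j" "j < k" for v j
    using that out[of v] Frange[of j] \<rho>S[of v] S0[of "-2"] S0[of "-1"] by (cases "v \<in> A") force+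
  obtain g mov where gS: "g \<in> ?S" and movS: "mov ` ?S \<subseteq> ?S" and
    best: "\<And>\<beta>. (\<And>h. h \<in> ?S \<Longrightarrow> h \<in> \<rho> ` A \<Longrightarrow> cheapest ?w A \<rho> mov h (\<beta> h)) \<Longrightarrow>
       obeys (insert c A) ?S caps (reroute \<beta> mov c g \<rho>) \<and>
       assign_cost ?w (insert c A) (reroute \<beta> mov c g \<rho>) \<le> assign_cost ?w (insert c A) \<rho>0"
  proof (rule insertion_step[OF finA cA obA optA \<rho>0], goal_cases)
    case (2 g mov)
    show ?case by (rule 2(1)[OF 2(2,3)], rule 2(4), blast)
  qed
  define d where "d j = (if j = k then slot g else if ?F j \<in> ?S then slot (mov (?F j)) else j)" for j
  have "d j < k" if "j \<le> k" for j
    using that gS movS slot(1) by (auto simp: d_def)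
  then obtain code where code: "code < k ^ Suc k" "\<forall>j\<le>k. digit code j = d j"
    using ex_code[of k d] by blast
  \<comment> \<open>The invariant compares the best cost with the competitor only once the round
    \<open>code\<close> has passed. Until then it just says that what is stored is admissible and
    has the stated cost.\<close>
  define K where "K = assign_cost ?w (insert c A) \<rho>0"
  define J where "J i s' \<longleftrightarrow> (\<forall>j\<le>k. fst s' aNX (int j) = int (digit i j)) \<and>
     (iv s' vHAVE = 0 \<or> iv s' vHAVE = 1 \<and> obeys (insert c A) ?S caps (\<lambda>v. fst s' aRHOB (int v)) \<and>
        (\<forall>v<n. v \<notin> insert c A \<longrightarrow> fst s' aRHOB (int v) = -2) \<and>
        rv s' rBEST = assign_cost ?w (insert c A) (\<lambda>v. fst s' aRHOB (int v))) \<and>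
     (code < i \<longrightarrow> iv s' vHAVE = 1 \<and> rv s' rBEST \<le> K)" for i s'
  have body: "ensures (block [REROUTE z, KEEP z, ODOMETER]) s1 (\<lambda>s'. J (Suc i) (iupdate iCODE 0 (int (Suc i)) s'))"
    if J: "J i s1" and a1: "agree {vHAVE, iJ, aNX, iCODE, iV, aRHO2, vBI, vCC, vVAL, vCNT, iU, aRHOB, vCARRY}
      {rBW, rCOST, rBEST} s s1" for i s1
  proof -
    have p1: "params s1" using s by (simp add: params_agree[OF a1])
    have e1: "fst s1 aF = fst s aF" "fst s1 aRHO = fst s aRHO" "iv s1 iC = int c" "fst s1 aSV = fst s aSV"
        "dval s1 = dval s"
      using a1 c by (simp_all add: agree_def dval_def fun_eq_iff)
    have nx1: "fst s1 aNX (int j) = int (digit i j)" if "j \<le> k" for j using J that by (simp add: J_def)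
    show ?thesis
      unfolding block.simps ensures_simps
    proof (rule ensures_conseq[OF REROUTE[OF p1 e1(3) cn]], goal_cases)
      case (1 v j j')
      then show ?case using slotF[of j j'] \<rho>F[of v j] by (simp add: e1 \<rho>_def)
    next
      case (2 j)
      then show ?case using \<rho>F[of c j] cA cn by (auto simp: e1 \<rho>_def)
    next
      case (3 s2)
      then obtain b where b: "\<forall>j<k. cheapest_in s1 n j (b j)" "rerouted s1 k c b (fst s2 aRHO2)" by blast
      note a2 = 3(2)
      have p2: "params s2" using p1 by (simp add: params_agree[OF a2])
      have e2: "iv s2 iC = int c" "fst s2 aSV = fst s aSV" "dval s2 = dval s" "fst s2 aNX = fst s1 aNX"
          "iv s2 vHAVE = iv s1 vHAVE" "rv s2 rBEST = rv s1 rBEST" "fst s2 aRHOB = fst s1 aRHOB"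
        using a2 e1 by (simp_all add: agree_def dval_def fun_eq_iff)
      have w2: "wcost s2 = ?w" "open_cells s2 = ?S" by (simp_all add: wcost_def open_cells_def e2 fun_eq_iff)
      define \<rho>2 where "\<rho>2 = (\<lambda>v. fst s2 aRHO2 (int v))"
      have kept: "\<rho>2 v = \<rho> v"
        if "v < n" "v \<noteq> c" "\<And>j. j < k \<Longrightarrow> \<rho> v = ?F j \<Longrightarrow> b j \<noteq> int v" for v
        using b(2) that unfolding rerouted_def e1 \<rho>_def \<rho>2_def by blast
      have changed: "\<rho>2 v = fst s aF (fst s1 aNX (int j))"
        if "v < n" "v \<noteq> c" "j < k" "\<rho> v = ?F j" "b j = int v" for v j
        using b(2) that unfolding rerouted_def e1 \<rho>_def \<rho>2_def by blast
      have out2: "\<rho>2 v = -2" if "v < n" "v \<notin> insert c A" for v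
      proof -
        have "b j \<noteq> int v" if "j < k" "\<rho> v = ?F j" for j
          using \<rho>F[OF \<open>v < n\<close> that(2,1)] \<open>v \<notin> insert c A\<close> by simp
        from kept[OF \<open>v < n\<close> _ this] have "\<rho>2 v = \<rho> v" using that by simp
        then show ?thesis using out that by simp
      qed
      \<comment> \<open>In the decisive round the slots pass on clients as \<open>mov\<close>
        prescribes, and the clients found by \<open>CHEAPEST\<close> are a legitimate choice of
        \<beta>, so the new assignment is the one of \<open>insertion_step\<close>.\<close>
      have target: "obeys (insert c A) ?S caps \<rho>2 \<and> assign_cost ?w (insert c A) \<rho>2 \<le> K" if "i = code"
      proof -
        have nx: "fst s1 aNX (int j) = int (d j)" if "j \<le> k" for j
          using nx1[OF that] code(2) that \<open>i = code\<close> by simp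
        define \<beta> where "\<beta> h = nat (b (slot h))" for h
        have F1: "fst s aF (fst s1 aNX (int (slot h))) = mov h" if "h \<in> ?S" for h
          using nx[of "slot h"] slot[OF that] that movS slot(2)[of "mov h"] by (auto simp: d_def e1)
        have b_in: "\<exists>u. u \<in> A \<and> b (slot h) = int u \<and> \<rho> u = h \<and>
            (\<forall>a\<in>A. \<rho> a = h \<longrightarrow> ?w u (mov h) - ?w u h \<le> ?w a (mov h) - ?w a h)"
          if h: "h \<in> ?S" "h \<in> \<rho> ` A" for h
        proof -
          have "cheapest_in s1 n (slot h) (b (slot h))" using b(1) slot(1)[OF h(1)] by blast
          moreover have "\<exists>v<n. \<rho> v = h" using h(2) An by auto
          ultimately obtain u where u: "u < n" "b (slot h) = int u" "\<rho> u = h"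
            "\<And>v. v < n \<Longrightarrow> \<rho> v = h \<Longrightarrow> shift_gain s1 (slot h) u \<le> shift_gain s1 (slot h) v"
            unfolding cheapest_in_def using slot(2)[OF h(1)] by (auto simp: e1 \<rho>_def)
          have "shift_gain s1 (slot h) v = ?w v (mov h) - ?w v h" for v
            by (simp add: shift_gain_def F1[OF h(1)] wcost_def e1 slot(2)[OF h(1)])
          moreover have "u \<in> A" using \<rho>F[OF u(1), of "slot h"] slot[OF h(1)] u(3) by simp
          ultimately show ?thesis using u An by auto
        qed
        have "cheapest ?w A \<rho> mov h (\<beta> h)" if "h \<in> ?S" "h \<in> \<rho> ` A" for h
          using b_in[OF that] by (auto simp: cheapest_def \<beta>_def)
        note best[OF this]
        moreover have "\<rho>2 v = reroute \<beta> mov c g \<rho> v" if v: "v \<in> insert c A" for v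
        proof (cases "v = c")
          case True
          then show ?thesis
            using b(2) nx[of k] slot(2)[OF gS] by (simp add: rerouted_def reroute_def \<rho>2_def d_def e1)
        next
          case False
          then have vA: "v \<in> A" using v by simp
          let ?j = "slot (\<rho> v)"
          note h = \<rho>S[OF vA]
          have bj: "b ?j = int v \<longleftrightarrow> \<beta> (\<rho> v) = v"
            using b_in[OF h] vA by (auto simp: \<beta>_def)
          have only: "j = ?j" if "j < k" "\<rho> v = ?F j" for j
            using slotF[OF that(1) slot(1)[OF h]] slot(2)[OF h] that(2) h by simp
          show ?thesis
          proof (cases "b ?j = int v")
            case True
            then have "\<rho>2 v = fst s aF (fst s1 aNX (int ?j))"
              using changed[OF An[OF vA] False slot(1)[OF h]] slot(2)[OF h] by (simp add: e1)
            then show ?thesis using True bj False F1[OF h] by (simp add: reroute_def)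
          next
            case no: False
            then have "\<rho>2 v = \<rho> v"
              using kept[OF An[OF vA] False] only by blast
            then show ?thesis using no bj False by (simp add: reroute_def)
          qed
        qed
        ultimately show ?thesis
          using obeys_cong[of "insert c A" \<rho>2] assign_cost_cong[of "insert c A" \<rho>2] by (simp add: K_def)
      qed
      show ?case
      proof (rule ensures_conseq[OF KEEP[OF p2]], goal_cases)
        case (1 s3)
        note k3 = 1(1)[unfolded w2 e2(1) A' \<rho>2_def[symmetric] e2(5-7)]
        have p3: "params s3" using p2 by (simp add: params_agree[OF 1(2)])
        have nx3: "fst s3 aNX (int j) = int (digit i j)" if "j \<le> k" for j
          using 1(2) nx1[OF that] by (simp add: agree_def e2)
        have st: "(iv s3 vHAVE = 0 \<or> iv s3 vHAVE = 1 \<and> obeys (insert c A) ?S caps (\<lambda>v. fst s3 aRHOB (int v)) \<and>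
            (\<forall>v<n. v \<notin> insert c A \<longrightarrow> fst s3 aRHOB (int v) = -2) \<and>
            rv s3 rBEST = assign_cost ?w (insert c A) (\<lambda>v. fst s3 aRHOB (int v))) \<and>
            (code < Suc i \<longrightarrow> iv s3 vHAVE = 1 \<and> rv s3 rBEST \<le> K)"
        proof (cases "obeys (insert c A) ?S caps \<rho>2 \<and>
            (iv s1 vHAVE = 0 \<or> assign_cost ?w (insert c A) \<rho>2 < rv s1 rBEST)")
          case True
          have "\<forall>v<n. fst s3 aRHOB (int v) = fst s2 aRHO2 (int v)"
            and have3: "iv s3 vHAVE = 1" "rv s3 rBEST = assign_cost ?w (insert c A) \<rho>2"
            using k3 True by simp_all
          then have eq0: "fst s3 aRHOB (int v) = \<rho>2 v" if "v < n" for v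
            using that by (simp add: \<rho>2_def)
          then have eq: "fst s3 aRHOB (int v) = \<rho>2 v" if "v \<in> insert c A" for v
            using that An cn by blast
          have eqs: "obeys (insert c A) ?S caps (\<lambda>v. fst s3 aRHOB (int v)) = obeys (insert c A) ?S caps \<rho>2"
            "assign_cost ?w (insert c A) (\<lambda>v. fst s3 aRHOB (int v)) = assign_cost ?w (insert c A) \<rho>2"
            by (rule obeys_cong assign_cost_cong; use eq in simp)+
          have "rv s3 rBEST \<le> K" if "code < Suc i"
          proof (cases "i = code")
            case True
            then show ?thesis using target have3 by simp
          next
            case False
            then have "code < i" using that by simp
            then have "iv s1 vHAVE = 1" "rv s1 rBEST \<le> K" using J by (simp_all add: J_def)
            then show ?thesis using True have3 by simp
          qed
          then show ?thesis
            using True have3 eq0 out2 by (simp add: eqs)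
        next
          case False
          then have k3: "iv s3 vHAVE = iv s1 vHAVE" "rv s3 rBEST = rv s1 rBEST" "fst s3 aRHOB = fst s1 aRHOB"
            using k3 by simp_all
          have "iv s1 vHAVE = 1 \<and> rv s1 rBEST \<le> K" if "code < Suc i"
          proof (cases "i = code")
            case True
            then show ?thesis using target False J unfolding J_def by fastforce
          next
            case False
            then show ?thesis using that J by (simp add: J_def)
          qed
          then show ?thesis using J unfolding k3 J_def by blast
        qed
        show ?case
          by (rule ensures_conseq[OF ODOMETER[OF p3 nx3]]) (use st in \<open>auto simp: J_def agree_def\<close>)
      qed
    qed
  qed
  show ?thesis
    unfolding INSERT_def
    unfolding block.simps(2,3) ensures_simps(4)
    unfolding ensures_simps(1-3)
  proof (rule ensures_conseq[OF ensures_map_loop[where m = "k + 1" and g = "\<lambda>_. 0"]], goal_cases)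
    case (4 s1)
    have vC: "iv s1 vCODES = int (k ^ (k + 1))" "iv s1 vN = int n"
      using 4(2) scalars[OF s] by (simp_all add: agree_def)
    show ?case
    proof (rule ensures_PFor[where m = "k ^ (k + 1)" and I = J], goal_cases)
      case 1
      show ?case by (simp only: vC nat_int)
    next
      case 2
      then show ?case using 4 by (simp add: J_def digit_def agree_def)
    next
      case (3 i s2)
      have "agree {vHAVE, iJ, aNX, iCODE, iV, aRHO2, vBI, vCC, vVAL, vCNT, iU, aRHOB, vCARRY}
          {rBW, rCOST, rBEST} s s2"
        using 3(4) 4(2) by (simp add: agree_def)
      from body[OF 3(2) this] show ?case by simp
    next
      case (4 s2)
      have J: "iv s2 vHAVE = 1" "obeys (insert c A) ?S caps (\<lambda>v. fst s2 aRHOB (int v))"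
        "\<forall>v<n. v \<notin> insert c A \<longrightarrow> fst s2 aRHOB (int v) = -2"
        "assign_cost ?w (insert c A) (\<lambda>v. fst s2 aRHOB (int v)) \<le> K"
        using 4(1) code(1) by (auto simp: J_def)
      have vN: "iv s2 vN = int n" using 4(2) vC by (simp add: agree_def)
      have b: "bval (BPos (IV vHAVE)) s2" using J(1) by simp
      show ?case
        unfolding ensures_simps if_P[OF b]
      proof (rule ensures_conseq[OF ensures_map_loop[where m = n and g = "\<lambda>v. fst s2 aRHOB (int v)"]], goal_cases)
        case (4 s3)
        have eq: "fst s3 aRHO (int v) = fst s2 aRHOB (int v)" if "v < n" for v
          using 4(1) that by simp
        have "obeys (insert c A) ?S caps (\<lambda>v. fst s3 aRHO (int v)) = obeys (insert c A) ?S caps (\<lambda>v. fst s2 aRHOB (int v))"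
          "assign_cost ?w (insert c A) (\<lambda>v. fst s3 aRHO (int v)) = assign_cost ?w (insert c A) (\<lambda>v. fst s2 aRHOB (int v))"
          by (rule obeys_cong assign_cost_cong; use eq An cn in auto)+
        then show ?case using J eq by (auto simp: K_def)
      qed (use vN in \<open>auto simp: agree_def\<close>)
    qed
  qed (use scalars(4)[OF s] in auto)
qed

lemma INSERT:
  fixes s c defines "A \<equiv> {v \<in> cls. v < c}"
  assumes s: "params s" and c: "iv s iC = int c" "c \<in> cls"
    and sited: "sited s" and as: "assigned A s"
    and \<rho>0: "obeys (insert c A) (open_cells s) caps \<rho>0"
  shows "ensures (INSERT z) s (assigned (insert c A))"
  unfolding ensures_def
proof
  fix s' assume s': "s' \<in> set_pmf (den (INSERT z) s)"
  have "agree (iw (INSERT z)) (rw (INSERT z)) s s'" by (rule den_agree[OF s'])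
  then have eqs: "open_cells s' = open_cells s" "wcost s' = wcost s"
    by (simp_all add: open_cells_def wcost_def dval_def agree_def fun_eq_iff)
  note * = ensuresD[OF INSERT_le[OF s c sited as[unfolded A_def]] s', folded A_def]
  show "assigned (insert c A) s'"
    unfolding assigned_def eqs using *[OF \<rho>0] * by blast
qed

text \<open>An admissible assignment of all clients restricts to every initial segment of the
  clients; so each insertion has a competitor and succeeds.\<close>

lemma ASSIGN:
  assumes s: "params s" and sited: "sited s" and \<rho>0: "obeys cls (open_cells s) caps \<rho>0"
  shows "ensures (ASSIGN z) s (assigned cls)"
  unfolding ASSIGN_def block.simps ensures_simps
proof (rule ensures_conseq[OF ensures_map_loop[where m = n and g = "\<lambda>_. -2"]], goal_cases)
  case (4 s1)
  have p1: "params s1" using s by (simp add: params_agree[OF 4(2)])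
  have e1: "fst s1 aSV = fst s aSV" "fst s1 aF = fst s aF" using 4(2) by (simp_all add: agree_def)
  show ?case
  proof (rule ensures_PFor[where m = n and I = "\<lambda>m s'. assigned {v \<in> cls. v < m} s'"], goal_cases)
    case 1
    then show ?case by (simp add: scalars(1)[OF p1])
  next
    case 2
    have "fst s1 aRHO (int v) = -2" if "v < n" for v using 4(1) that by simp
    then show ?case by (simp add: assigned_def obeys_def load_def assign_cost_def)
  next
    case (3 c s2)
    have p2: "params s2" using p1 by (simp add: params_agree[OF 3(4)])
    have e2: "fst s2 aSV = fst s aSV" "fst s2 aF = fst s aF" using 3(4) e1 by (simp_all add: agree_def)
    have S: "open_cells s2 = open_cells s" by (simp add: open_cells_def e2)
    have sited2: "sited s2" using sited sited_cong[OF e2(2,1)] by simp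
    have upd: "assigned A (iupdate iC 0 m s') = assigned A s'" for A m s'
      by (rule assigned_cong) simp_all
    have b: "bval (BPos (IGet CL (IV iC))) s2 \<longleftrightarrow> c \<in> cls"
      using CL_val[OF p2 3(1)] 3(3) by simp
    show ?case
    proof (cases "c \<in> cls")
      case True
      then have "{v \<in> cls. v < Suc c} = insert c {v \<in> cls. v < c}" by auto
      moreover from this have "obeys (insert c {v \<in> cls. v < c}) (open_cells s2) caps \<rho>0"
        unfolding S using finite_pts by (intro obeys_subset[OF \<rho>0]) auto
      note INSERT[OF p2 3(3) True sited2 3(2) this]
      ultimately show ?thesis
        unfolding ensures_simps b upd using True by simp
    next
      case False
      then have "{v \<in> cls. v < Suc c} = {v \<in> cls. v < c}" by (auto simp: less_Suc_eq)
      then show ?thesis unfolding ensures_simps b upd using False 3(2) by simp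
    qed
  next
    case (4 s2)
    moreover have "{v \<in> cls. v < n} = cls" using cls_pts pts_n by auto
    ultimately show ?case by simp
  qed
qed (use scalars(1)[OF s] in auto)

lemma RECORD:
  fixes s defines "\<rho> \<equiv> \<lambda>v. fst s aRHO (int v)"
  defines "cost \<equiv> assign_cost (wcost s) cls \<rho>"
  assumes s: "params s"
  shows "ensures (RECORD z) s (\<lambda>s'.
    if 0 < iv s vOK \<and> obeys cls (open_cells s) caps \<rho> \<and> (iv s vHB = 0 \<or> cost < rv s rGB)
    then iv s' vHB = 1 \<and> rv s' rGB = cost \<and>
      (\<forall>i. fst s' OUTS i = (if 0 \<le> i \<and> i < int n then fst s aSV i else fst s OUTS i)) \<and>
      (\<forall>v<n. fst s' OUTR (int v) = \<rho> v)
    else iv s' vHB = iv s vHB \<and> rv s' rGB = rv s rGB \<and> fst s' OUTS = fst s OUTS \<and> fst s' OUTR = fst s OUTR)"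
  unfolding RECORD_def block.simps(2,3) ensures_simps(4)
proof (rule ensures_conseq[OF ensures_map_loop[where m = n and g = \<rho>]], goal_cases)
  case (4 s1)
  let ?s2 = "iupdate vCC 0 (int n) s1"
  have p1: "params s1" using s by (simp add: params_agree[OF 4(2)])
  then have p2: "params ?s2" by simp
  have eqs: "iv s1 vOK = iv s vOK" "iv s1 vHB = iv s vHB" "rv s1 rGB = rv s rGB"
      "fst s1 OUTS = fst s OUTS" "fst s1 OUTR = fst s OUTR" "fst s1 aSV = fst s aSV" "dval s1 = dval s"
    using 4(2) by (simp_all add: agree_def dval_def fun_eq_iff)
  have r: "fst ?s2 aRHO2 (int v) = \<rho> v" if "v \<in> cls" for v
    using 4(1) that cls_pts pts_n by auto
  have A: "{v \<in> cls. int v < iv ?s2 vCC} = cls" using cls_pts pts_n by auto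
  have w: "wcost ?s2 = wcost s" "open_cells ?s2 = open_cells s"
    by (simp_all add: wcost_def open_cells_def eqs fun_eq_iff)
  have oc: "obeys cls (open_cells s) caps (\<lambda>v. fst ?s2 aRHO2 (int v)) = obeys cls (open_cells s) caps \<rho>"
      "assign_cost (wcost s) cls (\<lambda>v. fst ?s2 aRHO2 (int v)) = cost"
    unfolding cost_def by (rule obeys_cong assign_cost_cong; use r in simp)+
  note ch = CHECK[OF p2, unfolded A w oc]
  have e: "iupdate vCC (ival (IConst 0) s1) (ival (IV vN) s1) s1 = ?s2"
    using scalars(1)[OF p1] by simp
  show ?case
    unfolding ensures_simps(2) e
  proof (rule ensures_conseq[OF ch], goal_cases)
    case (1 s3)
    have e3: "iv s3 vOK = iv s vOK" "iv s3 vHB = iv s vHB" "rv s3 rGB = rv s rGB"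
        "fst s3 OUTS = fst s OUTS" "fst s3 OUTR = fst s OUTR" "fst s3 aSV = fst s aSV" "iv s3 vN = int n"
        "fst s3 aRHO2 = fst ?s2 aRHO2"
      using 1(2) eqs scalars(1)[OF p1] by (simp_all add: agree_def)
    let ?b = "BAnd (BAnd (BPos (IV vOK)) (BPos (IV vVAL))) (BOr (BEq (IV vHB) (IConst 0)) (RLess (RV rCOST) (RV rGB)))"
    have b: "bval ?b s3 \<longleftrightarrow> 0 < iv s vOK \<and> obeys cls (open_cells s) caps \<rho> \<and> (iv s vHB = 0 \<or> cost < rv s rGB)"
      using 1(1) by (simp add: e3)
    show ?case
    proof (cases "bval ?b s3")
      case False
      show ?thesis
        unfolding ensures_simps(5) if_not_P[OF False] if_not_P[OF False[unfolded b]] by (simp add: e3)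
    next
      case True
      show ?thesis
        unfolding ensures_simps(5) if_P[OF True] if_P[OF True[unfolded b]] ensures_simps
      proof (rule ensures_conseq[OF ensures_map_loop[where m = n and g = "\<lambda>v. fst s aSV (int v)"]], goal_cases)
        case (4 s4)
        have o4: "fst s4 OUTS i = (if 0 \<le> i \<and> i < int n then fst s aSV i else fst s OUTS i)" for i
          using 4(1) by (simp add: e3)
        have e4: "iv s4 vHB = 1" "rv s4 rGB = cost" "iv s4 vN = int n" "fst s4 aRHO2 = fst ?s2 aRHO2"
          using 4(2) 1(1) e3 by (simp_all add: agree_def)
        show ?case
        proof (rule ensures_conseq[OF ensures_map_loop[where m = n and g = \<rho>]], goal_cases)
          case (3 i s5)
          have "fst s1 aRHO2 (int i) = \<rho> i" using \<open>fst s1 aRHO2 = _\<close> 3(1) by simp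
          then show ?case using 3 e4 by (simp add: agree_def)
        next
          case (4 s5)
          then show ?case using o4 e4 by (simp add: agree_def)
        qed (use e4 in auto)
      qed (use e3 in \<open>auto simp: agree_def\<close>)
    qed
  qed
qed (use scalars(1)[OF s] in \<open>auto simp: agree_def \<rho>_def\<close>)

section \<open>From program states to feasible solutions\<close>

definition objective :: "(nat \<Rightarrow> nat) \<Rightarrow> real" where
  "objective \<rho> = (\<Sum>c\<in>cls. dis c (\<rho> c) ^ z)"

definition within_ranges :: "nat set \<Rightarrow> bool" where
  "within_ranges S \<longleftrightarrow> (\<forall>i<t. lower_bound I i \<le> int (card (S \<inter> group_set I i)) \<and>
     int (card (S \<inter> group_set I i)) \<le> upper_bound I i)"

lemma feasible_iff_obeys:
  assumes "S \<subseteq> facs" "card S \<le> k"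
  shows "feasible I S \<rho> \<longleftrightarrow> within_ranges S \<and> obeys cls (int ` S) caps (\<lambda>c. int (\<rho> c))"
proof -
  have "\<rho> \<in> cls \<rightarrow> S \<longleftrightarrow> (\<lambda>c. int (\<rho> c)) ` cls \<subseteq> int ` S" by auto
  moreover have "load cls (\<lambda>c. int (\<rho> c)) (int f) = card {c \<in> cls. \<rho> c = f}" for f
    by (simp add: load_def)
  moreover have "caps (int f) = capacity I f" if "f \<in> S" for f
    using that assms(1) by (auto simp: caps_def)
  ultimately show ?thesis
    using assms by (auto simp: feasible_def obeys_def within_ranges_def)
qed

lemma objective_eq:
  assumes "params s" "\<And>c. c \<in> cls \<Longrightarrow> \<rho> c \<in> facs"
  shows "assign_cost (wcost s) cls (\<lambda>c. int (\<rho> c)) = objective \<rho>"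
  unfolding assign_cost_def objective_def wcost_def
proof (rule sum.cong)
  fix c assume "c \<in> cls"
  then have "c \<in> pts" "\<rho> c \<in> pts" using assms(2) cls_pts facs_pts by auto
  then show "dval s (int c) (int (\<rho> c)) ^ z = dis c (\<rho> c) ^ z" by (simp add: dval_val[OF assms(1)])
qed simp

text \<open>The invariant of the trials. As \<open>out_centers\<close> inspects all cells of an
  unbounded array, the cells outside the range of vertices have to be known to be 0.\<close>

definition consistent :: "state \<Rightarrow> bool" where
  "consistent s \<longleftrightarrow> params s \<and> (\<forall>i. \<not> (0 \<le> i \<and> i < int n) \<longrightarrow> fst s aSV i = 0 \<and> fst s OUTS i = 0) \<and>
     (iv s vHB = 0 \<or> iv s vHB = 1 \<and> feasible I (out_centers s) (out_assignment s) \<and>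
        rv s rGB = objective (out_assignment s))"

definition slots_ok :: "state \<Rightarrow> bool" where
  "slots_ok s \<longleftrightarrow> (\<forall>j<k. fst s aF (int j) = -1 \<or> 0 \<le> fst s aF (int j) \<and> nat (fst s aF (int j)) \<in> facs)"

definition chosen :: "state \<Rightarrow> nat set" where
  "chosen s = {v. \<exists>j<k. fst s aF (int j) = int v}"

definition distinct_slots :: "state \<Rightarrow> bool" where
  "distinct_slots s \<longleftrightarrow> (\<forall>j<k. \<forall>j'<k. fst s aF (int j) = fst s aF (int j') \<longrightarrow>
     0 \<le> fst s aF (int j) \<longrightarrow> j = j')"

text \<open>Two claims of different strength: whatever the slots contain, what is recorded remains
  feasible and does not get worse; if moreover no facility occupies two slots, it becomes at least
  as good as any assignment to the chosen facilities.\<close>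

lemma EVAL:
  assumes s: "consistent s" and slots: "slots_ok s"
  shows "ensures (EVAL z) s (\<lambda>s'. consistent s' \<and>
    (iv s vHB = 1 \<longrightarrow> iv s' vHB = 1 \<and> rv s' rGB \<le> rv s rGB) \<and>
    (distinct_slots s \<longrightarrow> (\<forall>\<rho>. feasible I (chosen s) \<rho> \<longrightarrow>
       iv s' vHB = 1 \<and> rv s' rGB \<le> objective \<rho>)))"
proof -
  let ?S = "chosen s"
  have p: "params s" using s by (simp add: consistent_def)
  have out0: "fst s aSV i = 0" "fst s OUTS i = 0" if "\<not> (0 \<le> i \<and> i < int n)" for i
    using s that by (auto simp: consistent_def)
  have F: "fst s aF (int j) < int n" if "j < k" for j
    using slots that facs_pts pts_n[of "nat (fst s aF (int j))"] by (fastforce simp: slots_ok_def)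
  have Sf: "?S \<subseteq> facs" using slots by (force simp: chosen_def slots_ok_def)
  have "?S \<subseteq> (\<lambda>j. nat (fst s aF (int j))) ` {..<k}" by (force simp: chosen_def)
  then have Sk: "card ?S \<le> k" using surj_card_le[of "{..<k}" ?S] by simp
  have Sn: "v < n" if "v \<in> ?S" for v using that Sf facs_pts pts_n by auto
  show ?thesis
    unfolding EVAL_def block.simps ensures_simps
  proof (rule ensures_conseq[OF CENTERS[OF p F]], assumption, goal_cases)
    case (1 s1)
    have SV: "fst s1 aSV i = of_bool (i \<in> int ` ?S)" for i
    proof (cases "0 \<le> i \<and> i < int n")
      case True
      then have "(\<exists>j<k. fst s aF (int j) = i) \<longleftrightarrow> i \<in> int ` ?S"
        by (auto simp: chosen_def image_iff) (metis nonneg_int_cases)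
      then show ?thesis using 1(1) True by simp
    next
      case False
      then have "i \<notin> int ` ?S" using Sn by auto
      moreover have "fst s1 aSV i = fst s aSV i" using 1(1) False by auto
      ultimately show ?thesis using out0(1)[OF False] by simp
    qed
    have p1: "params s1" using p by (simp add: params_agree[OF 1(2)])
    have G: "{v. v < n \<and> 0 < fst s1 aSV (int v) \<and> v \<in> group_set I i} = ?S \<inter> group_set I i" for i
      using Sn by (auto simp: SV)
    have e1: "fst s1 aF = fst s aF" "iv s1 vHB = iv s vHB" "rv s1 rGB = rv s rGB"
        "fst s1 OUTS = fst s OUTS" "fst s1 OUTR = fst s OUTR"
      using 1(2) by (simp_all add: agree_def)
    show ?case
    proof (rule ensures_conseq[OF GROUPS[OF p1]], goal_cases)
      case (1 s2)
      have p2: "params s2" using p1 by (simp add: params_agree[OF 1(2)])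
      have OK: "iv s2 vOK = of_bool (within_ranges ?S)"
        using 1(1) unfolding G by (simp add: within_ranges_def)
      have e2: "fst s2 aF = fst s aF" "iv s2 vHB = iv s vHB" "rv s2 rGB = rv s rGB"
          "fst s2 OUTS = fst s OUTS" "fst s2 OUTR = fst s OUTR" "fst s2 aSV = fst s1 aSV"
        using 1(2) e1 by (simp_all add: agree_def)
      have O2: "open_cells s2 = int ` ?S" by (auto simp: open_cells_def e2 SV)
      have sited: "sited s2" if "distinct_slots s"
        unfolding sited_def O2 e2
      proof (intro conjI)
        show "\<forall>j<k. fst s aF (int j) \<in> insert (-1) (int ` ?S)"
        proof (intro allI impI)
          fix j assume j: "j < k"
          show "fst s aF (int j) \<in> insert (-1) (int ` ?S)"
          proof (cases "fst s aF (int j) = -1")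
            case False
            then obtain v where "fst s aF (int j) = int v"
              using slots j by (metis slots_ok_def nonneg_int_cases)
            then show ?thesis using j by (auto simp: chosen_def)
          qed simp
        qed
      qed (use that in \<open>auto simp: chosen_def distinct_slots_def\<close>)
      \<comment> \<open>If slots coincide or no admissible assignment exists, nothing is claimed
        about the result of \<open>ASSIGN\<close>; the check in \<open>RECORD\<close> takes care of
        this case.\<close>
      have "ensures (ASSIGN z) s2 (\<lambda>s3. distinct_slots s \<and> (\<exists>\<rho>. obeys cls (int ` ?S) caps \<rho>) \<longrightarrow> assigned cls s3)"
      proof (cases "distinct_slots s \<and> (\<exists>\<rho>. obeys cls (int ` ?S) caps \<rho>)")
        case True
        then obtain \<rho>0 where "obeys cls (open_cells s2) caps \<rho>0" using O2 by auto
        from ASSIGN[OF p2 sited this] True show ?thesis by simp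
      next
        case False
        then show ?thesis unfolding ensures_def by blast
      qed
      then show ?case
      proof (rule ensures_conseq, goal_cases)
        case (1 s3)
        have p3: "params s3" using p2 by (simp add: params_agree[OF 1(2)])
        have e3: "fst s3 aSV = fst s1 aSV" "iv s3 vHB = iv s vHB" "rv s3 rGB = rv s rGB"
            "fst s3 OUTS = fst s OUTS" "fst s3 OUTR = fst s OUTR" "iv s3 vOK = iv s2 vOK"
          using 1(2) e2 by (simp_all add: agree_def)
        have O3: "open_cells s3 = int ` ?S" by (auto simp: open_cells_def e3 SV)
        define \<rho>3 where "\<rho>3 = (\<lambda>v. fst s3 aRHO (int v))"
        define cost where "cost = assign_cost (wcost s3) cls \<rho>3"
        define acc where "acc \<longleftrightarrow> 0 < iv s3 vOK \<and> obeys cls (int ` ?S) caps \<rho>3 \<and> (iv s3 vHB = 0 \<or> cost < rv s3 rGB)"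
        show ?case
        proof (rule ensures_conseq[OF RECORD[OF p3]], goal_cases)
          case (1 s4)
          note rec = 1(1)[folded \<rho>3_def, unfolded O3, folded cost_def, folded acc_def]
          have p4: "params s4" using p3 by (simp add: params_agree[OF 1(2)])
          have SV4: "fst s4 aSV = fst s1 aSV" using 1(2) e3 by (simp add: agree_def)
          have HB: "iv s vHB = 0 \<or> iv s vHB = 1" using s by (auto simp: consistent_def)
          have best: "iv s4 vHB = 1 \<and> rv s4 rGB \<le> objective \<rho>"
            if d: "distinct_slots s" and f: "feasible I ?S \<rho>" for \<rho>
          proof -
            have ob: "within_ranges ?S" "obeys cls (int ` ?S) caps (\<lambda>c. int (\<rho> c))"
              using f feasible_iff_obeys[OF Sf Sk] by auto
            then have "assigned cls s3" using \<open>distinct_slots s \<and> _ \<longrightarrow> _\<close> d by blast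
            then have ob3: "obeys cls (int ` ?S) caps \<rho>3" and "cost \<le> assign_cost (wcost s3) cls (\<lambda>c. int (\<rho> c))"
              using ob(2) unfolding assigned_def O3 \<rho>3_def[symmetric] cost_def by auto
            moreover have "\<rho> c \<in> facs" if "c \<in> cls" for c
              using f that by (auto simp: feasible_def)
            ultimately have "cost \<le> objective \<rho>" using objective_eq[OF p3, of \<rho>] by simp
            then show ?thesis
              using rec ob3 ob(1) HB by (auto simp: acc_def e3 OK split: if_splits)
          qed
          have mono: "iv s vHB = 1 \<longrightarrow> iv s4 vHB = 1 \<and> rv s4 rGB \<le> rv s rGB"
            using rec by (auto simp: acc_def e3 split: if_splits)
          have "consistent s4"
          proof (cases acc)
            case False
            then have "iv s4 vHB = iv s vHB" "rv s4 rGB = rv s rGB" "fst s4 OUTS = fst s OUTS" "fst s4 OUTR = fst s OUTR"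
              using rec e3 by auto
            moreover from this have "out_centers s4 = out_centers s" "out_assignment s4 = out_assignment s"
              by (simp_all add: out_centers_def out_assignment_def fun_eq_iff)
            ultimately show ?thesis
              using s p4 Sn by (auto simp: consistent_def SV4 SV)
          next
            case True
            have r4: "iv s4 vHB = 1" "rv s4 rGB = cost"
              "\<And>i. fst s4 OUTS i = (if 0 \<le> i \<and> i < int n then fst s3 aSV i else fst s3 OUTS i)"
              "\<And>v. v < n \<Longrightarrow> fst s4 OUTR (int v) = \<rho>3 v"
              using rec True by (auto simp: \<rho>3_def)
            have "out_centers s4 = ?S"
              using Sn by (auto simp: out_centers_def r4(3) e3 SV out0 split: if_splits)
            moreover have oa: "int (out_assignment s4 c) = \<rho>3 c" if "c \<in> cls" for c
            proof -
              have "\<rho>3 c \<in> int ` ?S" using True that by (auto simp: acc_def obeys_def)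
              moreover have "c < n" using that cls_pts pts_n by auto
              ultimately show ?thesis by (auto simp: out_assignment_def r4(4))
            qed
            have ob: "obeys cls (int ` ?S) caps (\<lambda>c. int (out_assignment s4 c))"
              using True obeys_cong[of cls "\<lambda>c. int (out_assignment s4 c)" \<rho>3] oa by (simp add: acc_def)
            moreover have "within_ranges ?S" using True by (simp add: acc_def e3 OK split: if_splits)
            ultimately have feas: "feasible I (out_centers s4) (out_assignment s4)"
              using feasible_iff_obeys[OF Sf Sk] by simp
            have "out_assignment s4 c \<in> facs" if "c \<in> cls" for c
              using feas that by (auto simp: feasible_def)
            then have "objective (out_assignment s4) = assign_cost (wcost s3) cls (\<lambda>c. int (out_assignment s4 c))"
              using objective_eq[OF p3, of "out_assignment s4"] by simp
            also have "\<dots> = cost"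
              unfolding cost_def by (rule assign_cost_cong) (rule oa)
            finally have "rv s4 rGB = objective (out_assignment s4)" by (simp add: r4)
            moreover have "\<forall>i. \<not> (0 \<le> i \<and> i < int n) \<longrightarrow> fst s4 aSV i = 0 \<and> fst s4 OUTS i = 0"
              using Sn by (auto simp: SV4 SV r4(3) e3 out0)
            ultimately show ?thesis using p4 feas r4(1) by (simp add: consistent_def)
          qed
          with mono best show ?case by blast
        qed
      qed
    qed
  qed
qed

section \<open>Success probability of a trial\<close>

definition prefix_weight :: "state \<Rightarrow> nat \<Rightarrow> real" where
  "prefix_weight s m = (\<Sum>c | c < m \<and> c \<in> cls. snd s rMINW (int c))"

text \<open>Each client owns a half-open interval of the cumulative weights. Once the scan has
  passed the interval that contains the random point, the accumulated weight exceeds this point, and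
  the selection does not change any more.\<close>

lemma SCAN:
  assumes s: "params s" and nonneg: "\<And>c. c \<in> cls \<Longrightarrow> 0 \<le> snd s rMINW (int c)"
  shows "ensures SCAN s (\<lambda>s'. (iv s' vSEL = iv s aLD \<or> (\<exists>c\<in>cls. iv s' vSEL = int c)) \<and>
    (\<forall>c\<in>cls. prefix_weight s c * iv s vNN \<le> iv s vR * rv s rTOT \<longrightarrow>
       iv s vR * rv s rTOT < (prefix_weight s c + snd s rMINW (int c)) * iv s vNN \<longrightarrow> iv s' vSEL = int c))"
proof -
  define hit where "hit c \<longleftrightarrow> prefix_weight s c * iv s vNN \<le> iv s vR * rv s rTOT \<and>
    iv s vR * rv s rTOT < (prefix_weight s c + snd s rMINW (int c)) * iv s vNN" for c
  have pre_Suc: "prefix_weight s (Suc m) = prefix_weight s m + (if m \<in> cls then snd s rMINW (int m) else 0)" for m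
    by (simp add: prefix_weight_def sum_less_Suc_Collect)
  have NN: "0 \<le> real_of_int (iv s vNN)" using scalars(7)[OF s] by simp
  have hit_done: "iv s vR * rv s rTOT < prefix_weight s m * iv s vNN" if "hit c" "c < m" "c \<in> cls" for c m
  proof -
    have "prefix_weight s (Suc c) \<le> prefix_weight s m"
      unfolding prefix_weight_def using that nonneg finite_pts by (intro sum_mono2) auto
    then have "prefix_weight s (Suc c) * iv s vNN \<le> prefix_weight s m * iv s vNN"
      using NN by (rule mult_right_mono)
    then show ?thesis using that by (simp add: hit_def pre_Suc)
  qed
  have "ensures SCAN s (\<lambda>s'. (iv s' vSEL = iv s aLD \<or> (\<exists>c\<in>cls. iv s' vSEL = int c)) \<and>
      (\<forall>c\<in>cls. hit c \<longrightarrow> iv s' vSEL = int c))"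
    unfolding SCAN_def block.simps ensures_simps
  proof (rule ensures_PFor[where m = n and I = "\<lambda>m s'. rv s' rACC = prefix_weight s m \<and>
      (iv s' vSEL = iv s aLD \<or> (\<exists>c\<in>cls. iv s' vSEL = int c)) \<and>
      (\<forall>c\<in>cls. c < m \<longrightarrow> hit c \<longrightarrow> iv s' vSEL = int c)"], goal_cases)
    case 1
    then show ?case by (simp add: scalars(1)[OF s])
  next
    case 2
    then show ?case by (simp add: prefix_weight_def)
  next
    case (3 m s1)
    have p1: "params s1" using s by (simp add: params_agree[OF 3(4)])
    have e1: "fst s1 vR = fst s vR" "snd s1 rTOT = snd s rTOT" "fst s1 vNN = fst s vNN" "snd s1 rMINW = snd s rMINW"
      using 3(4) by (simp_all add: agree_def)
    have b: "bval (BPos (IGet CL (IV iV))) s1 \<longleftrightarrow> m \<in> cls" using CL_val[OF p1 3(1)] 3(3) by simp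
    show ?case
    proof (cases "m \<in> cls")
      case False
      then show ?thesis
        unfolding ensures_simps b using 3(2) by (auto simp: pre_Suc less_Suc_eq)
    next
      case True
      let ?b = "RLess (RMul (ROfInt (IV vR)) (RV rTOT)) (RMul (RV rACC) (ROfInt (IV vNN)))"
      have b2: "bval ?b s1 \<longleftrightarrow> iv s vR * rv s rTOT < prefix_weight s m * iv s vNN"
        using 3(2) by (simp add: e1)
      show ?thesis
      proof (cases "bval ?b s1")
        case skip: True
        have "\<not> hit m" using skip unfolding b2 by (simp add: hit_def)
        then show ?thesis
          unfolding ensures_simps b if_P[OF True] if_P[OF skip]
          using 3(2,3) True by (auto simp: pre_Suc e1 less_Suc_eq)
      next
        case take: False
        then have "\<not> hit c" if "c < m" "c \<in> cls" for c using hit_done[OF _ that] unfolding b2 by auto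
        then show ?thesis
          unfolding ensures_simps b if_P[OF True] if_not_P[OF take]
          using 3(2,3) True by (auto simp: pre_Suc e1 less_Suc_eq)
      qed
    qed
  next
    case (4 s1)
    then show ?case using cls_pts pts_n by blast
  qed
  then show ?thesis by (rule ensures_conseq) (simp add: hit_def)
qed

lemma consistent_agree:
  assumes "agree X Y s s'" "X \<inter> ({..8} \<union> {10..22} \<union> {aSV, vHB}) = {}" "Y \<inter> {0, rGB} = {}"
  shows "consistent s' = consistent s"
proof -
  have "fst s' x = fst s x" if "x \<in> {OUTS, OUTR, aSV, vHB}" for x
    by (rule agree_fst[OF assms(1)]) (use assms(2) that in auto)
  moreover have "snd s' rGB = snd s rGB" by (rule agree_snd[OF assms(1)]) (use assms(3) in auto)
  moreover have "params s' = params s"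
    by (rule params_agree[OF assms(1)]) (use assms(2,3) in auto)
  ultimately show ?thesis
    by (simp add: consistent_def out_centers_def out_assignment_def[abs_def])
qed

end

text \<open>The price of replacing a uniform real by a grid point: at most one point per
  interval.\<close>

lemma card_int_interval_ge: "B - A - 1 \<le> real (card {r::int. A \<le> real_of_int r \<and> real_of_int r < B})"
proof -
  have "{r::int. A \<le> real_of_int r \<and> real_of_int r < B} = {\<lceil>A\<rceil>..<\<lceil>B\<rceil>}"
    by (auto simp: ceiling_le_iff less_ceiling_iff)
  then have "card {r::int. A \<le> real_of_int r \<and> real_of_int r < B} = nat (\<lceil>B\<rceil> - \<lceil>A\<rceil>)" by simp
  then show ?thesis by linarith
qed

section \<open>Adaptive sampling, measured against a fixed feasible solution\<close>

locale cfr_solution = cfr +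
  fixes S :: "nat set" and \<rho> :: "nat \<Rightarrow> nat"
  assumes feas: "feasible I S \<rho>"
begin

lemma S_facs: "S \<subseteq> facs" and card_S: "card S \<le> k" and \<rho>S: "c \<in> cls \<Longrightarrow> \<rho> c \<in> S"
  using feas by (auto simp: feasible_def)

lemma finite_S: "finite S"
  using S_facs finite_pts finite_subset by blast

sublocale cl: clustering pts dis cls S \<rho> z "1 / real q"
proof -
  interpret Metric_space pts dis by (rule metric)
  show "clustering pts dis cls S \<rho> z (1 / real q)"
    by unfold_locales
      (use finite_pts cls_pts finite_S S_facs facs_pts \<rho>S z q in auto)
qed

lemma total_objective: "cl.total = objective \<rho>"
  by (simp add: cl.total_def cl.rad_def objective_def)

definition leadset :: "nat \<Rightarrow> state \<Rightarrow> nat set" where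
  "leadset j s = (\<lambda>i. nat (fst s aLD (int i))) ` {..j}"

text \<open>Either every step so far was a hit, and each has removed a bad center, or the excess is
  already small. The second alternative persists, since further leaders only reduce the
  excess.\<close>

definition sampled :: "nat \<Rightarrow> state \<Rightarrow> bool" where
  "sampled j s \<longleftrightarrow> (\<forall>i\<le>j. \<exists>v\<in>pts. fst s aLD (int i) = int v) \<and>
     (\<forall>v\<in>pts. snd s rMINW (int v) = cl.near (leadset j s) v ^ z) \<and>
     (card (cl.bad (leadset j s)) + j \<le> card S \<or>
      cl.excess (leadset j s) \<le> (1 + 2 * (1 / real q)) * cl.total)"

lemma leaders_leadset: "\<forall>i\<le>j. \<exists>v\<in>pts. fst s aLD (int i) = int v \<Longrightarrow> cl.leaders (leadset j s)"
  by (force simp: cl.leaders_def leadset_def)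

definition scaled :: "state \<Rightarrow> bool" where
  "scaled s \<longleftrightarrow> 0 < rv s rR0 \<and>
     (\<forall>u\<in>pts. \<forall>v\<in>pts. u \<noteq> v \<longrightarrow> rv s rR0 \<le> dis u v \<and> dis u v \<le> rv s rR0 * real n ^ a)"

text \<open>If there is a single point, the pair consists of this point twice and the condition is
  vacuous; the program then uses 1 as unit.\<close>

lemma ex_closest_pair:
  assumes "pts \<noteq> {}"
  obtains u v where "u \<in> pts" "v \<in> pts"
    "\<forall>x\<in>pts. \<forall>y\<in>pts. x \<noteq> y \<longrightarrow> 0 < dis u v \<and> dis u v \<le> dis x y \<and> dis x y \<le> dis u v * real n ^ a"
proof (cases "pairwise_distances I = {}")
  case True
  from assms obtain u where "u \<in> pts" by auto
  then show ?thesis using True by (intro that[of u u]) (auto simp: pairwise_distances_def)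
next
  case False
  let ?D = "pairwise_distances I"
  have "?D \<subseteq> (\<lambda>(x, y). dis x y) ` (pts \<times> pts)" by (auto simp: pairwise_distances_def)
  then have fin: "finite ?D" using finite_pts finite_subset by blast
  have "Min ?D \<in> ?D" using fin False by simp
  then obtain u v where uv: "u \<in> pts" "v \<in> pts" "u \<noteq> v" "Min ?D = dis u v"
    by (auto simp: pairwise_distances_def)
  have pos_uv: "0 < dis u v" using cl.nonneg[of u v] cl.zero[OF uv(1,2)] uv(3) by (simp add: order.strict_iff_order)
  have "Max ?D / Min ?D \<le> real n ^ a"
    using aspect False by (simp add: aspect_ratio_bounded_def aspect_ratio_def)
  then have max: "Max ?D \<le> dis u v * real n ^ a"
    using pos_uv by (simp add: uv(4) pos_divide_le_eq mult.commute)
  show ?thesis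
  proof (rule that[OF uv(1,2)], intro ballI impI)
    fix x y assume "x \<in> pts" "y \<in> pts" "x \<noteq> y"
    then have "dis x y \<in> ?D" by (auto simp: pairwise_distances_def)
    then have "Min ?D \<le> dis x y" "dis x y \<le> Max ?D" using fin by auto
    then show "0 < dis u v \<and> dis u v \<le> dis x y \<and> dis x y \<le> dis u v * real n ^ a"
      using max pos_uv uv(4) by simp
  qed
qed

text \<open>Any point could be the first leader, but a random vertex need not be a point. So each of
  the three vertices is simply required to have a prescribed value.\<close>

lemma GUESS:
  assumes s: "params s" and ne: "S \<noteq> {}"
  shows "likely ((1 / n) ^ 3) (GUESS z) s (\<lambda>s'. sampled 0 s' \<and> scaled s')"
proof -
  have "pts \<noteq> {}" using ne S_facs facs_pts by auto
  then obtain u v where uv: "u \<in> pts" "v \<in> pts" and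
    close: "\<forall>x\<in>pts. \<forall>y\<in>pts. x \<noteq> y \<longrightarrow> 0 < dis u v \<and> dis u v \<le> dis x y \<and> dis x y \<le> dis u v * real n ^ a"
    by (rule ex_closest_pair)
  have N: "iv s vN = int n" by (rule scalars(1)[OF s])
  define s1 where "s1 = iupdate aLD 0 (int u) s"
  define s2 where "s2 = iupdate vU 0 (int u) s1"
  define s3 where "s3 = iupdate vV 0 (int v) s2"
  define s4 where "s4 = rupdate rR0 0 (dis u v) s3"
  define s5 where "s5 = (if 0 < dis u v then s4 else rupdate rR0 0 1 s4)"
  have p: "params s1" "params s2" "params s3" "params s4" "params s5"
    by (simp_all add: s1_def s2_def s3_def s4_def s5_def s)
  have rest: "ensures (PSeq (PRV rR0 (Dx (IV vU) (IV vV)))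
      (PSeq (PIf (RLess (ROfInt (IConst 0)) (RV rR0)) PSkip (PRV rR0 (ROfInt (IConst 1))))
        (PFor iV vN (PR rMINW (IV iV) (Wx z (IV iV) (IV aLD)))))) s3 (\<lambda>s'. sampled 0 s' \<and> scaled s')"
  proof -
    have "iv s3 vU = int u" "iv s3 vV = int v" by (simp_all add: s1_def s2_def s3_def)
    then have e: "rupdate rR0 (ival (IConst 0) s3) (rval (Dx (IV vU) (IV vV)) s3) s3 = s4"
      using uv by (simp add: s4_def dval_val[OF p(3)])
    have f: "ensures (PIf (RLess (ROfInt (IConst 0)) (RV rR0)) PSkip (PRV rR0 (ROfInt (IConst 1)))) s4 Q = Q s5" for Q
      by (simp add: s5_def s4_def)
    have LD5: "iv s5 aLD = int u" by (simp add: s5_def s4_def s3_def s2_def s1_def)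
    show ?thesis
      unfolding ensures_simps(4)
      unfolding ensures_simps(3) e
      unfolding f
    proof (rule ensures_conseq[OF ensures_rmap_loop[where m = n and g = "\<lambda>v. dval s5 (int v) (int u) ^ z"]], goal_cases)
      case 1
      then show ?case by (simp add: scalars(1)[OF p(5)])
    next
      case (2 i s')
      have "iv s' aLD = int u" "dval s' = dval s5"
        using 2(2) LD5 by (simp_all add: agree_def dval_def fun_eq_iff)
      then show ?case using 2(3) z by simp
    next
      case (3 s')
      have LD: "iv s' aLD = int u" and R0: "rv s' rR0 = rv s5 rR0"
        using 3(2) LD5 by (simp_all add: agree_def)
      have set: "leadset 0 s' = {u}" by (simp add: leadset_def LD)
      have "card (cl.bad {u}) \<le> card S" by (intro card_mono finite_S) (auto simp: cl.bad_def)
      moreover have "snd s' rMINW (int x) = cl.near {u} x ^ z" if "x \<in> pts" for x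
        using 3(1) pts_n[OF that] dval_val[OF p(5) that uv(1)] by (simp add: cl.near_def)
      ultimately have "sampled 0 s'" using uv by (simp add: sampled_def set LD)
      moreover have "scaled s'"
        using close by (auto simp: scaled_def R0 s5_def s4_def)
      ultimately show ?case by simp
    qed
  qed
  have 3: "likely (1 / n) (PSeq (PRand vV vN) (PSeq (PRV rR0 (Dx (IV vU) (IV vV)))
      (PSeq (PIf (RLess (ROfInt (IConst 0)) (RV rR0)) PSkip (PRV rR0 (ROfInt (IConst 1))))
        (PFor iV vN (PR rMINW (IV iV) (Wx z (IV iV) (IV aLD))))))) s2 (\<lambda>s'. sampled 0 s' \<and> scaled s')"
  proof (rule likely_PSeq_ensures)
    have "likely (1 / iv s2 vN) (PRand vV vN) s2 (\<lambda>s'. s' = s3)"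
      by (rule likely_PRand[of "int v"]) (use uv pts_n scalars(1)[OF p(2)] in \<open>auto simp: s3_def\<close>)
    then show "likely (1 / n) (PRand vV vN) s2 (\<lambda>s'. s' = s3)"
      using scalars(1)[OF p(2)] by simp
  qed (use rest in auto)
  have 2: "likely (1 / n * (1 / n)) (PSeq (PRand vU vN) (PSeq (PRand vV vN) (PSeq (PRV rR0 (Dx (IV vU) (IV vV)))
      (PSeq (PIf (RLess (ROfInt (IConst 0)) (RV rR0)) PSkip (PRV rR0 (ROfInt (IConst 1))))
        (PFor iV vN (PR rMINW (IV iV) (Wx z (IV iV) (IV aLD)))))))) s1 (\<lambda>s'. sampled 0 s' \<and> scaled s')"
  proof (rule likely_PSeq)
    have "likely (1 / iv s1 vN) (PRand vU vN) s1 (\<lambda>s'. s' = s2)"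
      by (rule likely_PRand[of "int u"]) (use uv pts_n scalars(1)[OF p(1)] in \<open>auto simp: s2_def\<close>)
    then show "likely (1 / n) (PRand vU vN) s1 (\<lambda>s'. s' = s2)"
      using scalars(1)[OF p(1)] by simp
  qed (use 3 in auto)
  have "likely (1 / n * (1 / n * (1 / n))) (GUESS z) s (\<lambda>s'. sampled 0 s' \<and> scaled s')"
    unfolding GUESS_def block.simps
  proof (rule likely_PSeq)
    have "likely (1 / iv s vN) (PRand aLD vN) s (\<lambda>s'. s' = s1)"
      by (rule likely_PRand[of "int u"]) (use uv pts_n N in \<open>auto simp: s1_def\<close>)
    then show "likely (1 / n) (PRand aLD vN) s (\<lambda>s'. s' = s1)" using N by simp
  qed (use 2 in auto)
  then show ?thesis by (simp add: power3_eq_cube mult.assoc)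
qed

definition EXTEND :: prog where
  "EXTEND = PSeq (PI aLD (IAdd (IV iJ) (IConst 1)) (IV vSEL))
     (PFor iV vN (PIf (RLess (Wx z (IV iV) (IV vSEL)) (RGet rMINW (IV iV)))
       (PR rMINW (IV iV) (Wx z (IV iV) (IV vSEL))) PSkip))"

lemma near_insert:
  assumes "cl.leaders L"
  shows "cl.near (insert c L) v ^ z = min (dis v c ^ z) (cl.near L v ^ z)"
proof -
  have "cl.near (insert c L) v = min (dis v c) (cl.near L v)"
    using assms by (simp add: cl.near_def cl.leaders_def)
  moreover have "0 \<le> dis v c" "0 \<le> cl.near L v" using cl.near_nonneg[OF assms] by simp_all
  ultimately show ?thesis using z by (auto simp: min_def power_mono_iff)
qed

lemma EXTEND:
  assumes s: "params s" and j: "iv s iJ = int j" and sam: "sampled j s"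
    and c: "iv s vSEL = int c" "c \<in> pts"
    and ok: "c \<in> cl.hits (leadset j s) \<or> cl.excess (leadset j s) \<le> (1 + 2 * (1 / real q)) * cl.total"
  shows "ensures EXTEND s (sampled (Suc j))"
proof -
  let ?L = "leadset j s"
  have LD: "\<forall>i\<le>j. \<exists>v\<in>pts. fst s aLD (int i) = int v" using sam by (simp add: sampled_def)
  have L: "cl.leaders ?L" by (rule leaders_leadset[OF LD])
  have L': "cl.leaders (insert c ?L)" using L c(2) by (auto simp: cl.leaders_def)
  define s1 where "s1 = iupdate aLD (int (Suc j)) (int c) s"
  have p1: "params s1" by (simp add: s1_def s)
  have M1: "snd s1 rMINW (int v) = cl.near ?L v ^ z" if "v \<in> pts" for v
    using sam that by (simp add: sampled_def s1_def)
  have s1: "iupdate aLD (ival (IAdd (IV iJ) (IConst 1)) s) (ival (IV vSEL) s) s = s1"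
    by (simp add: s1_def j c add.commute)
  show ?thesis
    unfolding EXTEND_def ensures_simps(4)
    unfolding ensures_simps(2) s1
  proof (rule ensures_PFor[where m = n and I = "\<lambda>m s'. \<forall>v\<in>pts. snd s' rMINW (int v) =
      (if v < m then cl.near (insert c ?L) v ^ z else cl.near ?L v ^ z)"], goal_cases)
    case 1
    then show ?case by (simp add: scalars(1)[OF p1])
  next
    case 2
    then show ?case using M1 by simp
  next
    case (3 i s2)
    have e: "iv s2 vSEL = int c" "dval s2 = dval s1"
      using 3(4) c by (simp_all add: agree_def dval_def fun_eq_iff s1_def)
    show ?case
    proof (cases "i \<in> pts")
      case True
      have "dval s2 (int i) (int c) = dis i c" unfolding e by (rule dval_val[OF p1 True c(2)])
      moreover have "snd s2 rMINW (int i) = cl.near ?L i ^ z" using 3(2) True by simp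
      ultimately show ?thesis
        using 3(2,3) z by (auto simp: e near_insert[OF L] less_Suc_eq)
    next
      case False
      then show ?thesis using 3(2,3) by (auto simp: less_Suc_eq)
    qed
  next
    case (4 s2)
    have LD2: "fst s2 aLD = (fst s aLD)(int (Suc j) := int c)"
      using 4(2) by (simp add: agree_def s1_def)
    have set: "leadset (Suc j) s2 = insert c ?L"
      by (auto simp: leadset_def LD2 atMost_Suc image_iff)
    have "card (cl.bad (insert c ?L)) + Suc j \<le> card S \<or>
        cl.excess (insert c ?L) \<le> (1 + 2 * (1 / real q)) * cl.total"
    proof (cases "cl.excess ?L \<le> (1 + 2 * (1 / real q)) * cl.total")
      case True
      moreover have "cl.excess (insert c ?L) \<le> cl.excess ?L"
        by (rule cl.excess_anti[OF L L']) auto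
      ultimately show ?thesis by simp
    next
      case False
      then have "card (cl.bad ?L) + j \<le> card S" "c \<in> cl.hits ?L" using sam ok by (auto simp: sampled_def)
      moreover from this have "card (cl.bad (insert c ?L)) < card (cl.bad ?L)" by (intro cl.card_bad_hit[OF L])
      ultimately show ?thesis by simp
    qed
    then show ?case
      using 4(1) pts_n LD c(2) by (auto simp: sampled_def set LD2 le_Suc_eq)
  qed
qed

text \<open>By \<open>hits_heavy\<close> the intervals of the hits have total length at least
  \<open>2 * n\<close> in grid units. Rounding costs at most one grid point for each of the at most
  \<open>n\<close> hits, so \<open>n\<close> of the \<open>4608 * q ^ 4 * n\<close> grid points
  remain. If the excess is small already, every outcome is fine.\<close>

lemma SAMPLE:
  assumes s: "params s" and j: "iv s iJ = int j" and sam: "sampled j s"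
  shows "likely (1 / (4608 * real q ^ 4)) (SAMPLE z) s (sampled (Suc j))"
proof -
  let ?L = "leadset j s" and ?NN = "4608 * real q ^ 4 * n"
  define w where "w c = cl.near ?L c ^ z" for c
  define W where "W = (\<Sum>c\<in>cls. w c)"
  have L: "cl.leaders ?L" using sam by (intro leaders_leadset) (simp add: sampled_def)
  have M: "snd s rMINW (int v) = w v" if "v \<in> pts" for v
    using sam that by (simp add: sampled_def w_def)
  have w0: "0 \<le> w c" for c by (simp add: w_def cl.near_nonneg[OF L])
  have p0: "0 < 1 / (4608 * real q ^ 4)" using q by simp
  define rest where "rest = PSeq (PRand vR vNN) (PSeq SCAN EXTEND)"
  have tot: "ensures (PSeq (PRV rTOT (ROfInt (IConst 0)))
      (PFor iV vN (PIf (BPos (IGet CL (IV iV))) (PRV rTOT (RAdd (RV rTOT) (RGet rMINW (IV iV)))) PSkip))) s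
      (\<lambda>s'. rv s' rTOT = W)"
    unfolding ensures_simps(4) ensures_simps(3)
  proof (rule ensures_conseq[OF ensures_sum_loop[where m = n and Q = "\<lambda>v. v \<in> cls" and
        g = "\<lambda>v. snd s rMINW (int v)"]], goal_cases)
    case (2 i s')
    have "params s'" using s by (simp add: params_agree[OF 2(2)])
    moreover have "snd s' rMINW = snd s rMINW" using 2(2) by (simp add: agree_def)
    ultimately show ?case using CL_val[of s' i] 2 by auto
  next
    case (3 s')
    have "{c. c < n \<and> c \<in> cls} = cls" using cls_pts pts_n by auto
    moreover have "(\<Sum>c\<in>cls. snd s rMINW (int c)) = W"
      unfolding W_def using M cls_pts by (intro sum.cong) auto
    ultimately show ?case using 3(1) by simp
  qed (simp add: scalars(1)[OF s])
  have main: "likely (1 / (4608 * real q ^ 4)) rest s1 (sampled (Suc j))"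
    if W1: "rv s1 rTOT = W" and a1: "agree {iV} {rTOT} s s1" for s1
  proof -
    have p1: "params s1" using s by (simp add: params_agree[OF a1])
    have NN: "iv s1 vNN = 4608 * int q ^ 4 * int n" by (rule scalars(7)[OF p1])
    have M1: "snd s1 rMINW = snd s rMINW" using a1 by (simp add: agree_def)
    define pre where "pre c = (\<Sum>u | u < c \<and> u \<in> cls. w u)" for c
    have prefix: "prefix_weight s2 c = pre c" if "snd s2 rMINW = snd s rMINW" for s2 c
      unfolding prefix_weight_def pre_def that by (rule sum.cong) (use M cls_pts in auto)
    have sam_agree: "sampled j s2 \<and> leadset j s2 = ?L \<and> iv s2 iJ = int j"
      if "fst s2 aLD = fst s aLD" "snd s2 rMINW = snd s rMINW" "fst s2 iJ = fst s iJ" for s2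
      using sam j that by (simp add: sampled_def leadset_def)
    define hit where "hit r c \<longleftrightarrow> pre c * ?NN \<le> real_of_int r * W \<and>
        real_of_int r * W < (pre c + w c) * ?NN" for r c
    have after: "ensures (PSeq SCAN EXTEND) (iupdate vR 0 r s1) (sampled (Suc j))"
      if r: "cl.excess ?L \<le> (1 + 2 * (1 / real q)) * cl.total \<or> (\<exists>c\<in>cl.hits ?L. hit r c)" for r
    proof -
      let ?s2 = "iupdate vR 0 r s1"
      have p2: "params ?s2" using p1 by simp
      have nonneg: "0 \<le> snd ?s2 rMINW (int c)" if "c \<in> cls" for c
        using M[of c] that cls_pts w0 by (auto simp: M1)
      show ?thesis
        unfolding ensures_simps(4)
      proof (rule ensures_conseq[OF SCAN[OF p2 nonneg]], assumption, goal_cases)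
        case (1 s3)
        have a3: "agree (insert vSEL (insert vR {iV})) (insert rACC {rTOT}) s s3"
          using 1(2) a1 by (simp add: agree_def)
        have p3: "params s3" using s by (simp add: params_agree[OF a3])
        have sam3: "sampled j s3 \<and> leadset j s3 = ?L \<and> iv s3 iJ = int j"
          by (rule sam_agree) (use a3 in \<open>simp_all add: agree_def\<close>)
        have found: "iv s3 vSEL = int c" if "c \<in> cls" "hit r c" for c
          using 1(1) that M[of c] cls_pts NN by (auto simp: hit_def prefix M1 W1)
        obtain c where c: "c \<in> pts" "iv s3 vSEL = int c"
        proof -
          have "iv ?s2 aLD = iv s aLD" using a1 by (simp add: agree_def)
          moreover obtain v where "v \<in> pts" "fst s aLD 0 = int v" using sam by (force simp: sampled_def)
          ultimately show ?thesis using 1(1) that cls_pts by fastforce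
        qed
        have ok: "c \<in> cl.hits ?L \<or> cl.excess ?L \<le> (1 + 2 * (1 / real q)) * cl.total"
        proof (cases "cl.excess ?L \<le> (1 + 2 * (1 / real q)) * cl.total")
          case False
          then obtain c' where c': "c' \<in> cl.hits ?L" "hit r c'" using r by auto
          then have "c' \<in> cls" by (simp add: cl.hits_def)
          from found[OF this c'(2)] c(2) c'(1) show ?thesis by simp
        qed simp
        show ?case
          by (rule EXTEND[OF p3 _ _ c(2,1)]) (use sam3 ok in auto)
      qed
    qed
    define R where "R = {r \<in> {0..<iv s1 vNN}. cl.excess ?L \<le> (1 + 2 * (1 / real q)) * cl.total \<or> (\<exists>c\<in>cl.hits ?L. hit r c)}"
    have finR: "finite R" by (rule finite_subset[of _ "{0..<iv s1 vNN}"]) (auto simp: R_def)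
    have NN0: "0 < iv s1 vNN" "0 < ?NN" using NN pos q by simp_all
    have cardR: "real n \<le> real (card R)"
    proof (cases "cl.excess ?L \<le> (1 + 2 * (1 / real q)) * cl.total")
      case True
      then have "R = {0..<iv s1 vNN}" by (auto simp: R_def)
      then have "card R = 4608 * q ^ 4 * n" by (simp add: NN nat_mult_distrib nat_power_eq)
      moreover have "1 * n \<le> 4608 * q ^ 4 * n" using q by (intro mult_right_mono) auto
      ultimately show ?thesis by (metis mult_1 of_nat_le_iff)
    next
      case False
      let ?H = "cl.hits ?L"
      have heavy: "(1 / real q) ^ 4 / 2304 * W \<le> (\<Sum>c\<in>?H. w c)" and W0: "0 < W"
        using cl.hits_heavy[OF L] False by (auto simp: W_def w_def)
      have H: "?H \<subseteq> cls" by (auto simp: cl.hits_def)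
      then have finH: "finite ?H" using finite_pts finite_subset by blast
      define Rc where "Rc c = {r::int. hit r c}" for c
      have Rc: "Rc c = {r::int. pre c * ?NN / W \<le> real_of_int r \<and> real_of_int r < (pre c + w c) * ?NN / W}" for c
        using W0 by (auto simp: Rc_def hit_def pos_divide_le_eq pos_less_divide_eq)
      have cardRc: "w c * ?NN / W - 1 \<le> card (Rc c)" for c
        using card_int_interval_ge[of "(pre c + w c) * ?NN / W" "pre c * ?NN / W"]
        unfolding Rc by (simp add: add_divide_distrib distrib_right)
      have finRc: "finite (Rc c)" for c
      proof -
        have "Rc c \<subseteq> {\<lceil>pre c * ?NN / W\<rceil>..<\<lceil>(pre c + w c) * ?NN / W\<rceil>}"
          unfolding Rc by (auto simp: ceiling_le_iff less_ceiling_iff)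
        then show ?thesis by (rule finite_subset) simp
      qed
      have pre_mono: "pre c + w c \<le> pre c'" if "c < c'" "c \<in> cls" for c c'
      proof -
        have "pre c + w c = (\<Sum>u | u < Suc c \<and> u \<in> cls. w u)"
          using that by (simp add: pre_def sum_less_Suc_Collect)
        also have "\<dots> \<le> pre c'"
          unfolding pre_def using that w0 finite_pts by (intro sum_mono2) auto
        finally show ?thesis .
      qed
      have disj0: "Rc c \<inter> Rc c' = {}" if "c < c'" "c \<in> cls" for c c'
      proof -
        have "(pre c + w c) * ?NN \<le> pre c' * ?NN"
          using pre_mono[OF that] NN0 by (intro mult_right_mono) auto
        then show ?thesis by (auto simp: Rc_def hit_def)
      qed
      have disj: "Rc c \<inter> Rc c' = {}" if "c \<in> ?H" "c' \<in> ?H" "c \<noteq> c'" for c c'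
        using that H disj0[of c c'] disj0[of c' c] by (cases c c' rule: linorder_cases) auto
      have "Rc c \<subseteq> R" if "c \<in> ?H" for c
      proof
        fix r assume r: "r \<in> Rc c"
        have "0 \<le> pre c" by (simp add: pre_def sum_nonneg w0)
        moreover have "pre c + w c \<le> W"
        proof -
          have "pre c + w c = (\<Sum>u | u < Suc c \<and> u \<in> cls. w u)"
            using that H by (auto simp: pre_def sum_less_Suc_Collect)
          also have "\<dots> \<le> W"
            unfolding W_def using w0 finite_pts by (intro sum_mono2) auto
          finally show ?thesis .
        qed
        ultimately have h: "0 \<le> pre c * ?NN" "(pre c + w c) * ?NN \<le> W * ?NN"
          using NN0(2) by (auto intro!: mult_right_mono mult_nonneg_nonneg)
        have h': "pre c * ?NN \<le> real_of_int r * W" "real_of_int r * W < (pre c + w c) * ?NN"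
          using r by (simp_all add: Rc_def hit_def)
        have "0 \<le> real_of_int r * W" by (rule order_trans[OF h(1) h'(1)])
        then have "0 \<le> real_of_int r" using W0 zero_le_mult_iff[of "real_of_int r" W] by linarith
        moreover have "real_of_int r * W < ?NN * W"
          using less_le_trans[OF h'(2) h(2)] by (simp only: mult.commute)
        then have "real_of_int r < ?NN" using W0 by (rule mult_right_less_imp_less[OF _ less_imp_le])
        moreover have "?NN = real_of_int (iv s1 vNN)" by (simp add: NN)
        ultimately have "0 \<le> r" "r < iv s1 vNN" by linarith+
        then show "r \<in> R" using r that by (auto simp: R_def Rc_def)
      qed
      then have "(\<Union>c\<in>?H. Rc c) \<subseteq> R" by blast
      then have "card (\<Union>c\<in>?H. Rc c) \<le> card R" by (rule card_mono[OF finR])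
      then have "(\<Sum>c\<in>?H. card (Rc c)) \<le> card R"
        using card_UN_disjoint[of ?H Rc] finH finRc disj by simp
      then have "(\<Sum>c\<in>?H. real (card (Rc c))) \<le> real (card R)"
        by (metis of_nat_le_iff of_nat_sum)
      moreover have "(\<Sum>c\<in>?H. w c * ?NN / W - 1) \<le> (\<Sum>c\<in>?H. real (card (Rc c)))"
        by (intro sum_mono cardRc)
      moreover have "(\<Sum>c\<in>?H. w c * ?NN / W - 1) = (\<Sum>c\<in>?H. w c) * (?NN / W) - card ?H"
        by (simp add: sum_subtractf sum_distrib_right sum_divide_distrib)
      moreover have "card ?H \<le> n"
        using card_mono[of "{..<n}" ?H] H cls_pts pts_n by fastforce
      \<comment> \<open>The factor 4608 of the grid is twice the 2304 of
        \<open>hits_heavy\<close>.\<close>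
      moreover have "2 * real n \<le> (\<Sum>c\<in>?H. w c) * (?NN / W)"
      proof -
        have "2 * real n = (1 / real q) ^ 4 / 2304 * W * (?NN / W)"
          using W0 q by (simp add: power_divide)
        also have "\<dots> \<le> (\<Sum>c\<in>?H. w c) * (?NN / W)"
          using heavy W0 NN0 by (intro mult_right_mono) auto
        finally show ?thesis .
      qed
      ultimately show ?thesis by linarith
    qed
    have "likely (real (card R) / iv s1 vNN) (PRand vR vNN) s1 (\<lambda>s2. \<exists>r\<in>R. s2 = iupdate vR 0 r s1)"
      by (rule likely_PRand_set[OF NN0(1) finR]) (auto simp: R_def)
    then have "likely (1 / (4608 * real q ^ 4)) (PRand vR vNN) s1 (\<lambda>s2. \<exists>r\<in>R. s2 = iupdate vR 0 r s1)"
    proof (rule likely_mono)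
      have "1 / (4608 * real q ^ 4) = real n / iv s1 vNN" using pos by (simp add: NN)
      also have "\<dots> \<le> real (card R) / iv s1 vNN"
        using cardR NN0 by (intro divide_right_mono) auto
      finally show "1 / (4608 * real q ^ 4) \<le> real (card R) / iv s1 vNN" .
    qed
    then show ?thesis
      unfolding rest_def
    proof (rule likely_PSeq_ensures)
      fix s2 assume "\<exists>r\<in>R. s2 = iupdate vR 0 r s1"
      then obtain r where "r \<in> R" "s2 = iupdate vR 0 r s1" by blast
      then show "ensures (PSeq SCAN EXTEND) s2 (sampled (Suc j))"
        using after[of r] unfolding R_def by blast
    qed (use p0 in simp)
  qed
  have "likely (1 / (4608 * real q ^ 4)) (PSeq (PSeq (PRV rTOT (ROfInt (IConst 0)))
      (PFor iV vN (PIf (BPos (IGet CL (IV iV))) (PRV rTOT (RAdd (RV rTOT) (RGet rMINW (IV iV)))) PSkip))) rest)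
      s (sampled (Suc j))"
    by (rule likely_ensures_PSeq[OF tot]) (use p0 main in auto)
  \<comment> \<open>Blocks associate to the right, whereas the computation of the total weight was
    treated as a unit above.\<close>
  moreover have "den (PSeq (PSeq p1 p2) p3) = den (PSeq p1 (PSeq p2 p3))" for p1 p2 p3
  proof -
    have "den (PSeq p p') = (\<lambda>s. bind_pmf (den p s) (den p'))" for p p' by (rule ext) simp
    then show ?thesis by (simp add: bind_assoc_pmf)
  qed
  ultimately show ?thesis
    by (simp only: likely_def SAMPLE_def block.simps rest_def EXTEND_def)
qed

end

section \<open>Trials with arbitrary guesses\<close>

context cfr
begin

lemma gmask_less: "gmask v < 2 ^ t"
  by (simp add: gmask_def bitmask_less)

text \<open>Valid for all guesses. The group type of the result is kept because it shows that the
  guess \<open>2 ^ t\<close>, which is the type of no facility, leaves the slot empty.\<close>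

lemma PICK_safe:
  assumes s: "params s" and j: "iv s iJ = int j"
  shows "ensures (PICK q') s (\<lambda>s'. \<exists>X. fst s' aF = (fst s aF)(int j := X) \<and>
    (X = -1 \<or> (\<exists>v\<in>facs. X = int v \<and> int (gmask v) = iv s vTY)))"
  unfolding PICK_def block.simps(2,3) ensures_simps(3,4)
proof (rule ensures_conseq[OF ensures_agree], goal_cases)
  case (1 s1)
  have a1: "agree {iV} {rRAD} s s1" using 1(1) by (simp add: agree_def)
  let ?s2 = "iupdate aF (ival (IV iJ) s1) (ival (IConst (-1)) s1) s1"
  have p1: "params s1" using s by (simp add: params_agree[OF a1])
  have e1: "iv s1 iJ = int j" "fst s1 aF = fst s aF" "fst s1 vTY = fst s vTY"
    using a1 j by (simp_all add: agree_def)
  show ?case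
    unfolding ensures_simps(2)
  proof (rule ensures_PFor[where m = n and I = "\<lambda>m s'. \<exists>X. fst s' aF = (fst s aF)(int j := X) \<and>
      (X = -1 \<or> (\<exists>v\<in>facs. X = int v \<and> int (gmask v) = iv s vTY))"], goal_cases)
    case 1
    then show ?case by (simp add: scalars(1)[OF p1])
  next
    case 2
    show ?case by (intro exI[of _ "-1"]) (simp add: e1)
  next
    case (3 i s3)
    have p3: "params s3" using p1 by (subst params_agree[OF 3(4)]) simp_all
    have e3: "iv s3 iJ = int j" "fst s3 vTY = fst s vTY"
      using 3(4) e1 by (simp_all add: agree_def)
    show ?case
    proof (cases "bval (CANDB iV) s3")
      case True
      then have i: "i \<in> facs" "int (gmask i) = iv s vTY"
        using FA_val[OF p3 3(1)] MASK_val[OF p3 3(1)] 3(3) by (auto simp: CANDB_def e3)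
      show ?thesis
        unfolding ensures_simps if_P[OF True]
      proof (rule ensures_conseq[OF ensures_agree], goal_cases)
        case (1 s4)
        have e4: "iv s4 iJ = int j" "fst s4 aF = fst s3 aF" "iv s4 iV = int i"
          using 1(1) e3 3(3) by (simp_all add: agree_def)
        obtain X where X: "fst s3 aF = (fst s aF)(int j := X)"
          "X = -1 \<or> (\<exists>v\<in>facs. X = int v \<and> int (gmask v) = iv s vTY)" using 3(2) by blast
        show ?case
        proof (cases "bval (BEq (IV vCNT) (IV vRK)) s4")
          case True
          then show ?thesis using i by (auto simp: e4 X(1))
        next
          case False
          then show ?thesis using X by (auto simp: e4)
        qed
      qed
    next
      case False
      then show ?thesis using 3(2) by simp
    qed
  qed
qed

lemma SELECT_safe:
  assumes s: "params s" and j: "iv s iJ = int j"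
  shows "ensures (SELECT q') s (\<lambda>s'. \<exists>X. fst s' aF = (fst s aF)(int j := X) \<and>
    (X = -1 \<or> (\<exists>v\<in>facs. X = int v)))"
  unfolding SELECT_def block.simps ensures_simps
proof (rule ensures_conseq[OF ensures_agree], rule ensures_conseq[OF ensures_agree], rule ensures_conseq[OF ensures_agree], rule ensures_conseq[OF ensures_agree], goal_cases)
  case (1 s1 s2 s3 s4)
  have a: "agree {vLI, vTY, vRK, vEX} {} s s4" using 1 by (simp add: agree_def)
  have p4: "params s4" using s by (simp add: params_agree[OF a])
  have "iv s4 iJ = int j" "fst s4 aF = fst s aF" using a j by (simp_all add: agree_def)
  note e4 = this
  show ?case by (rule ensures_conseq[OF PICK_safe[OF p4 e4(1)]]) (auto simp: e4(2))
qed

text \<open>No outcome of a trial destroys an earlier success; this is what makes repetition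
  work.\<close>

lemma TRIAL_safe:
  assumes s: "consistent s"
  shows "ensures (TRIAL z q') s (\<lambda>s'. consistent s' \<and>
    (iv s vHB = 1 \<longrightarrow> iv s' vHB = 1 \<and> rv s' rGB \<le> rv s rGB))"
  unfolding TRIAL_def block.simps ensures_simps
proof (rule ensures_conseq[OF ensures_agree], rule ensures_conseq[OF ensures_agree], goal_cases)
  case (1 s1 s2)
  have a: "agree (iw (GUESS z) \<union> insert iJ (iw (SAMPLE z))) (rw (GUESS z) \<union> rw (SAMPLE z)) s s2"
    using 1 by (simp add: agree_def)
  have c2: "consistent s2" using s by (simp add: consistent_agree[OF a])
  then have p2: "params s2" by (simp add: consistent_def)
  have e2: "iv s2 vHB = iv s vHB" "rv s2 rGB = rv s rGB" using a by (simp_all add: agree_def)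
  show ?case
  proof (rule ensures_PFor[where m = k and I = "\<lambda>m s'. \<forall>i<m. fst s' aF (int i) = -1 \<or>
      0 \<le> fst s' aF (int i) \<and> nat (fst s' aF (int i)) \<in> facs"], goal_cases)
    case 1
    then show ?case by (simp add: scalars(2)[OF p2])
  next
    case (3 i s3)
    have p3: "params s3" using p2 by (simp add: params_agree[OF 3(4)])
    show ?case
      by (rule ensures_conseq[OF SELECT_safe[OF p3 3(3)]]) (use 3(2) in \<open>auto simp: less_Suc_eq\<close>)
  next
    case (4 s3)
    have c3: "consistent s3" using c2 by (simp add: consistent_agree[OF 4(2)])
    have e3: "iv s3 vHB = iv s vHB" "rv s3 rGB = rv s rGB" using 4(2) e2 by (simp_all add: agree_def)
    have "slots_ok s3" using 4(1) by (simp add: slots_ok_def)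
    from EVAL[OF c3 this] show ?case by (rule ensures_conseq) (simp add: e3)
  qed simp
qed

end

section \<open>Trials with correct guesses\<close>

context cfr_solution
begin

text \<open>Ranks are injective on \<open>B\<close>. So among all candidates only \<open>f\<close>
  has the guessed rank, and the slot is written exactly once after it has been cleared.\<close>

lemma PICK:
  fixes s l T x defines "B \<equiv> {v \<in> facs. gmask v = T \<and> dis l v < rv s rR0 * (1 + 1 / real q) ^ x}"
  assumes s: "params s" and j: "iv s iJ = int j"
    and l: "fst s aLD (iv s vLI) = int l" "l \<in> pts"
    and T: "iv s vTY = int T" and x: "iv s vEX = int x" "x \<le> nrad"
    and f: "f \<in> B" "iv s vRK = int (rank_in (capacity I) B f)"
  shows "ensures (PICK (int q)) s (\<lambda>s'. fst s' aF = (fst s aF)(int j := int f))"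
  unfolding PICK_def block.simps(2,3) ensures_simps(3,4)
proof (rule ensures_PFor[where m = nrad and I = "\<lambda>m s'. rv s' rRAD = rv s rR0 * (1 + 1 / real q) ^ min m x"], goal_cases)
  case 1
  then show ?case by (simp add: scalars(6)[OF s])
next
  case (3 m s1)
  have "iv s1 vEX = int x" using 3(4) x by (simp add: agree_def)
  moreover have "(1 + real q) / real q = 1 + 1 / real q" using q by (simp add: field_simps)
  ultimately show ?case using 3(2,3) by (auto simp: min_def add.commute)
next
  case (4 s1)
  let ?b = "PIf (CANDB iV)
       (block [PIV vCNT (IConst 0),
          PFor iU vN (PIf (BAnd (CANDB iU) BETTERB) (PIV vCNT (IAdd (IV vCNT) (IConst 1))) PSkip),
          PIf (BEq (IV vCNT) (IV vRK)) (PI aF (IV iJ) (IV iV)) PSkip]) PSkip"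
  let ?s2 = "iupdate aF (ival (IV iJ) s1) (ival (IConst (-1)) s1) s1"
  let ?u = "capacity I"
  have a1: "agree {iV} {rRAD} s s1" using 4(2) by (simp add: agree_def)
  have p1: "params s1" using s by (simp add: params_agree[OF a1])
  have R1: "rv s1 rRAD = rv s rR0 * (1 + 1 / real q) ^ x" using 4(1) x by (simp add: min_def)
  have e1: "iv s1 iJ = int j" "fst s1 aF = fst s aF"
    using a1 j by (simp_all add: agree_def)
  have finB: "finite B" using finite_pts by (simp add: B_def)
  have Bn: "v < n" "v \<in> pts" "v \<in> facs" if "v \<in> B" for v using that facs_pts pts_n by (auto simp: B_def)
  have cand: "bval (CANDB y) s3 \<longleftrightarrow> v \<in> B"
    if a3: "agree {iV, aF, vCNT, iU} {rRAD} s s3" and "snd s3 rRAD = snd s1 rRAD"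
      "iv s3 y = int v" "v < n" for s3 v y
  proof -
    have p3: "params s3" using s by (simp add: params_agree[OF a3])
    have e: "fst s3 aLD (iv s3 vLI) = int l" "iv s3 vTY = int T"
      using a3 l T by (simp_all add: agree_def)
    show ?thesis
    proof (cases "v \<in> facs")
      case True
      then have "dval s3 (int l) (int v) = dis l v" using facs_pts by (intro dval_val[OF p3 l(2)]) auto
      then show ?thesis
        using that True FA_val[OF p3 that(4)] MASK_val[OF p3 that(4)] by (simp add: CANDB_def e B_def R1)
    next
      case False
      then show ?thesis using that FA_val[OF p3 that(4)] by (simp add: CANDB_def B_def)
    qed
  qed
  show ?case
    unfolding ensures_simps(2)
  proof (rule ensures_PFor[where m = n and I = "\<lambda>m s'. \<exists>X. fst s' aF = (fst s aF)(int j := X) \<and>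
      (f < m \<longrightarrow> X = int f)"], goal_cases)
    case 1
    then show ?case by (simp add: scalars(1)[OF p1])
  next
    case 2
    show ?case by (intro exI[of _ "-1"]) (simp add: e1)
  next
    case (3 i s3)
    have a3: "agree {iV, aF, vCNT, iU} {rRAD} s s3" and R3: "snd s3 rRAD = snd s1 rRAD"
      using 3(4) a1 by (auto simp: agree_def CANDB_def BETTERB_def)
    have p3: "params s3" using s by (simp add: params_agree[OF a3])
    have b: "bval (CANDB iV) s3 \<longleftrightarrow> i \<in> B" by (rule cand[OF a3 R3 3(3,1)])
    obtain X where X: "fst s3 aF = (fst s aF)(int j := X)" "f < i \<longrightarrow> X = int f" using 3(2) by blast
    show ?case
    proof (cases "i \<in> B")
      case False
      then have "f < Suc i \<longleftrightarrow> f < i" using f(1) by (auto simp: less_Suc_eq)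
      then show ?thesis unfolding ensures_simps b using False X by auto
    next
      case True
      then have bt: "bval (CANDB iV) s3" using b by simp
      have rank: "card {v. v < n \<and> v \<in> B \<and> better ?u v i} = rank_in ?u B i"
        unfolding rank_in_def using Bn by (intro arg_cong[where f = card]) auto
      show ?thesis
        unfolding ensures_simps(5) if_P[OF bt] block.simps ensures_simps
      proof (rule ensures_conseq[OF ensures_count_loop[where m = n and
            Q = "\<lambda>v. v \<in> B \<and> better ?u v i"]], goal_cases)
        case 2
        then show ?case by (simp add: scalars(1)[OF p3])
      next
        case (3 v s4)
        have a4: "agree {iV, aF, vCNT, iU} {rRAD} s s4" and "snd s4 rRAD = snd s1 rRAD" "iv s4 iV = int i"
          using 3(2) a3 R3 \<open>iv s3 iV = int i\<close> by (auto simp: agree_def)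
        then have "bval (CANDB iU) s4 \<longleftrightarrow> v \<in> B" using cand[of s4 iU v] 3 by blast
        moreover have "params s4" using s by (simp add: params_agree[OF a4])
        from CAP_val[OF this] have "v \<in> B \<Longrightarrow> bval BETTERB s4 \<longleftrightarrow> better ?u v i"
          using 3(3) \<open>iv s4 iV = int i\<close> Bn True by (simp add: BETTERB_def better_def)
        ultimately show ?case by auto
      next
        case (4 s4)
        have cnt: "iv s4 vCNT = int (rank_in ?u B i)" using 4(1) by (simp add: rank)
        have e4: "iv s4 vRK = int (rank_in ?u B f)" "iv s4 iJ = int j" "iv s4 iV = int i"
            "fst s4 aF = fst s3 aF"
          using 4(2) a3 f j \<open>iv s3 iV = int i\<close> by (simp_all add: agree_def)
        show ?case
        proof (cases "i = f")
          case True
          then show ?thesis by (auto simp: cnt e4 X(1))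
        next
          case False
          then have "rank_in ?u B i \<noteq> rank_in ?u B f" using rank_in_inj[OF finB True f(1)] by auto
          then show ?thesis using X False by (auto simp: cnt e4 less_Suc_eq)
        qed
      qed simp
    qed
  next
    case (4 s3)
    then show ?case using Bn(1)[OF f(1)] by auto
  qed
qed simp

definition fs :: "nat \<Rightarrow> nat" where
  "fs = (SOME f. bij_betw f {0..<card S} S)"

lemma fs: "bij_betw fs {0..<card S} S"
  unfolding fs_def by (rule someI_ex[OF ex_bij_betw_nat_finite[OF finite_S]])

lemma fsS: "i < card S \<Longrightarrow> fs i \<in> S"
  using fs by (auto simp: bij_betw_def)

lemma fs_inj: "i < card S \<Longrightarrow> j < card S \<Longrightarrow> fs i = fs j \<Longrightarrow> i = j"
  using fs by (auto simp: bij_betw_def inj_on_def)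

text \<open>The factor is 1 for the way from the center to its leader plus \<open>1 + 1 / q\<close>
  for the way from the leader to the replacement, the latter because of the rounded radius.\<close>

definition replaces :: "state \<Rightarrow> nat \<Rightarrow> nat \<Rightarrow> bool" where
  "replaces s i f \<longleftrightarrow> f \<in> facs \<and> gmask f = gmask (fs i) \<and> capacity I (fs i) \<le> capacity I f \<and>
     dis (fs i) f \<le> (2 + 1 / real q) * cl.near (leadset k s) (fs i)"

text \<open>A replacement must not be the center of a later slot. Thereby, when a slot is to be
  filled, its own center is still available and witnesses that a replacement exists. Slots that
  exceed the number of centers remain empty.\<close>

definition selected :: "nat \<Rightarrow> state \<Rightarrow> bool" where
  "selected j s \<longleftrightarrow>
     (\<forall>i<j. i < card S \<longrightarrow> (\<exists>f. fst s aF (int i) = int f \<and> replaces s i f \<and> (\<forall>i'<card S. j \<le> i' \<longrightarrow> f \<noteq> fs i'))) \<and>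
     (\<forall>i<j. card S \<le> i \<longrightarrow> fst s aF (int i) = -1) \<and>
     (\<forall>i<j. \<forall>i'<j. fst s aF (int i) = fst s aF (int i') \<longrightarrow> 0 \<le> fst s aF (int i) \<longrightarrow> i = i')"

lemma two_le_growth: "2 \<le> (1 + 1 / real q) ^ q"
proof -
  have "-1 \<le> 1 / real q" by (rule order_trans[of _ 0]) simp_all
  from Bernoulli_inequality[OF this, of q] show ?thesis using q by simp
qed

text \<open>The least exponent whose open ball around \<open>l\<close> contains \<open>v\<close> is
  taken. The preceding ball misses \<open>v\<close>, so the radius exceeds the distance by at most
  the factor \<open>1 + 1 / q\<close>.\<close>

lemma ex_radius:
  assumes r: "scaled s" and l: "l \<in> pts" "v \<in> pts"
  obtains x where "x < nrad" "dis l v < rv s rR0 * (1 + 1 / real q) ^ x"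
    "\<forall>f\<in>pts. dis l f < rv s rR0 * (1 + 1 / real q) ^ x \<longrightarrow> dis l f \<le> (1 + 1 / real q) * dis l v"
proof -
  let ?r = "rv s rR0" and ?g = "1 + 1 / real q"
  have r0: "0 < ?r" using r by (simp add: scaled_def)
  have g: "1 < ?g" using q by simp
  have "dis l v < ?r * ?g ^ (1 + q * a * lg)"
  proof (cases "l = v")
    case True
    then have "dis l v = 0" using l by simp
    also have "0 < ?r * ?g ^ (1 + q * a * lg)" using r0 order_less_trans[OF zero_less_one g]
      by (intro mult_pos_pos zero_less_power)
    finally show ?thesis .
  next
    case False
    have "n \<le> 2 ^ lg" unfolding lg_def by (rule LeastI[of _ n]) simp
    then have "real n \<le> 2 ^ lg" by (metis of_nat_le_iff of_nat_numeral of_nat_power)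
    then have "real n ^ a \<le> (2 ^ lg) ^ a" by (intro power_mono) auto
    also have "\<dots> = 2 ^ (a * lg)" by (simp add: power_mult[symmetric] mult.commute)
    also have "\<dots> \<le> (?g ^ q) ^ (a * lg)" using two_le_growth by (intro power_mono) auto
    also have "\<dots> = ?g ^ (q * a * lg)" by (simp add: power_mult[symmetric] mult.assoc)
    also have "\<dots> < ?g ^ (1 + q * a * lg)" using g by (intro power_strict_increasing) auto
    finally have "?r * real n ^ a < ?r * ?g ^ (1 + q * a * lg)" using r0 by simp
    moreover have "dis l v \<le> ?r * real n ^ a" using r l False by (auto simp: scaled_def)
    ultimately show ?thesis by simp
  qed
  define x where "x = (LEAST x. dis l v < ?r * ?g ^ x)"
  have x: "dis l v < ?r * ?g ^ x" unfolding x_def by (rule LeastI) fact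
  have "x \<le> 1 + q * a * lg" unfolding x_def by (rule Least_le) fact
  then have "x < nrad" by (simp add: nrad_def)
  moreover have "dis l f \<le> ?g * dis l v" if f: "f \<in> pts" "dis l f < ?r * ?g ^ x" for f
  proof (cases x)
    \<comment> \<open>The smallest ball has the smallest distance as its radius; being open, it
      contains no point besides its center.\<close>
    case 0
    then have "l = f" using f l r by (fastforce simp: scaled_def)
    then show ?thesis using l g by (simp add: cl.nonneg)
  next
    case (Suc y)
    then have "\<not> dis l v < ?r * ?g ^ y" using not_less_Least[of y "\<lambda>x. dis l v < ?r * ?g ^ x"]
      by (simp add: x_def)
    then have "?g * (?r * ?g ^ y) \<le> ?g * dis l v" using g by (intro mult_left_mono) auto
    then show ?thesis using f(2) Suc by (simp add: mult.left_commute)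
  qed
  ultimately show thesis using that x by blast
qed

text \<open>Whether the slot is to be filled or to remain empty, one value of each of the four
  guesses is right, and these are hit with the product of the inverse ranges.\<close>

lemma SELECT:
  assumes s: "params s" and j: "iv s iJ = int j" "j < k"
    and lead: "S \<noteq> {} \<longrightarrow> sampled k s \<and> scaled s" and sel: "selected j s"
  shows "likely (1 / real ((k + 1) * (2 ^ t + 1) * k * nrad)) (SELECT (int q)) s (selected (Suc j))"
proof -
  obtain li T r x where bounds: "0 \<le> li" "li < int (k + 1)" "T \<le> 2 ^ t" "r < k" "x < nrad" and
    pick: "\<And>s'. agree {vLI, vTY, vRK, vEX} {} s s' \<Longrightarrow> iv s' vLI = li \<Longrightarrow> iv s' vTY = int T \<Longrightarrow>
      iv s' vRK = int r \<Longrightarrow> iv s' vEX = int x \<Longrightarrow> ensures (PICK (int q)) s' (selected (Suc j))"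
  proof (cases "j < card S")
    case False
    show thesis
    \<comment> \<open>For a slot that is to remain empty the impossible group type is guessed; the
      other guesses are then arbitrary.\<close>
    proof (rule that[of 0 "2 ^ t" 0 0])
      fix s' assume a: "agree {vLI, vTY, vRK, vEX} {} s s'" and T: "iv s' vTY = int (2 ^ t)"
      have p': "params s'" using s by (simp add: params_agree[OF a])
      have j': "iv s' iJ = int j" and e: "fst s' aF = fst s aF" using a j by (simp_all add: agree_def)
      show "ensures (PICK (int q)) s' (selected (Suc j))"
      proof (rule ensures_conseq[OF PICK_safe[OF p' j']], goal_cases)
        case (1 s'')
        then obtain X where X: "fst s'' aF = (fst s aF)(int j := X)"
          "X = -1 \<or> (\<exists>v\<in>facs. X = int v \<and> int (gmask v) = iv s' vTY)" unfolding e by blast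
        have "X = -1"
        proof (rule ccontr)
          assume "X \<noteq> -1"
          then obtain v where "int (gmask v) = iv s' vTY" using X(2) by blast
          then have "gmask v = 2 ^ t" unfolding T by (simp only: of_nat_eq_iff)
          then show False using gmask_less[of v] by simp
        qed
        moreover have "leadset k s'' = leadset k s" using 1(2) a by (simp add: leadset_def agree_def)
        ultimately show ?case
          using sel False X(1) unfolding selected_def replaces_def by (auto simp: less_Suc_eq)
      qed
    qed (use pos in \<open>auto simp: nrad_def\<close>)
  next
    case True
    have "S \<noteq> {}" using True by auto
    then have sam: "sampled k s" and sc: "scaled s" using lead by auto
    let ?L = "leadset k s"
    have L: "cl.leaders ?L" using sam by (intro leaders_leadset) (simp add: sampled_def)
    have v: "fs j \<in> S" "fs j \<in> facs" "fs j \<in> pts" using fsS[OF True] S_facs facs_pts by auto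
    obtain l where l: "l \<in> ?L" "cl.near ?L (fs j) = dis (fs j) l" using cl.near_attained[OF L] .
    then obtain i where i: "i \<le> k" "l = nat (fst s aLD (int i))" by (auto simp: leadset_def)
    then have LDi: "fst s aLD (int i) = int l" "l \<in> pts" using sam by (force simp: sampled_def)+
    obtain x where x: "x < nrad" "dis l (fs j) < rv s rR0 * (1 + 1 / real q) ^ x"
      "\<forall>f\<in>pts. dis l f < rv s rR0 * (1 + 1 / real q) ^ x \<longrightarrow> dis l f \<le> (1 + 1 / real q) * dis l (fs j)"
      by (rule ex_radius[OF sc LDi(2) v(3)])
    define B where "B = {f \<in> facs. gmask f = gmask (fs j) \<and> dis l f < rv s rR0 * (1 + 1 / real q) ^ x}"
    \<comment> \<open>The facilities that are taken by earlier slots or reserved for later ones. The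
      center of the present slot is not among them, since earlier replacements avoided it.\<close>
    define X where "X = (\<lambda>i. nat (fst s aF (int i))) ` {..<j} \<union> fs ` {j<..<card S}"
    have "finite B" using finite_pts by (simp add: B_def)
    moreover have "fs j \<in> B" using v x by (simp add: B_def)
    moreover have "finite X" by (simp add: X_def)
    moreover have "fs j \<notin> X"
    proof
      assume "fs j \<in> X"
      then consider i where "i < j" "fs j = nat (fst s aF (int i))" | i where "j < i" "i < card S" "fs j = fs i"
        by (auto simp: X_def)
      then show False
      proof cases
        case 1
        then have "i < card S" using True by simp
        then obtain f' where "fst s aF (int i) = int f'" "\<forall>i'<card S. j \<le> i' \<longrightarrow> f' \<noteq> fs i'"
          using sel 1(1) unfolding selected_def by blast
        then show ?thesis using 1(2) True by auto
      next
        case 2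
        then show ?thesis using fs_inj[of j i] True by simp
      qed
    qed
    \<comment> \<open>There are at most \<open>j\<close> taken and \<open>card S - j - 1\<close>
      reserved facilities.\<close>
    moreover have "card X < k"
    proof -
      have "card X \<le> card {..<j} + card {j<..<card S}"
        unfolding X_def by (intro order_trans[OF card_Un_le] add_mono card_image_le) auto
      then show ?thesis using True card_S by simp
    qed
    ultimately obtain f where f: "f \<in> B" "f \<notin> X" "capacity I (fs j) \<le> capacity I f"
      "rank_in (capacity I) B f < k" by (rule ex_replacement)
    show thesis
    proof (rule that[of "int i" "gmask (fs j)" "rank_in (capacity I) B f" x])
      fix s' assume a: "agree {vLI, vTY, vRK, vEX} {} s s'" and ids: "iv s' vLI = int i" "iv s' vTY = int (gmask (fs j))"
        "iv s' vRK = int (rank_in (capacity I) B f)" "iv s' vEX = int x"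
      have p': "params s'" using s by (simp add: params_agree[OF a])
      have e: "iv s' iJ = int j" "fst s' aF = fst s aF" "rv s' rR0 = rv s rR0" "fst s' aLD (iv s' vLI) = int l"
        using a j LDi ids by (simp_all add: agree_def)
      have "ensures (PICK (int q)) s' (\<lambda>s''. fst s'' aF = (fst s aF)(int j := int f))"
        using PICK[OF p' e(1) e(4) LDi(2) ids(2,4), of f] x(1) f(1) ids(3) unfolding e B_def by simp
      then show "ensures (PICK (int q)) s' (selected (Suc j))"
      proof (rule ensures_conseq, goal_cases)
        case (1 s'')
        have lead'': "leadset k s'' = leadset k s" using 1(2) a by (simp add: leadset_def agree_def)
        have "dis (fs j) f \<le> dis (fs j) l + dis l f"
          by (rule cl.triangle) (use v LDi f facs_pts in \<open>auto simp: B_def\<close>)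
        also have "dis l f \<le> (1 + 1 / real q) * dis l (fs j)"
          using x(3) f(1) facs_pts by (auto simp: B_def)
        finally have "dis (fs j) f \<le> (2 + 1 / real q) * cl.near ?L (fs j)"
          by (simp add: l(2) cl.commute[of l] algebra_simps)
        then have rep: "replaces s'' j f"
          using f by (simp add: replaces_def lead'' B_def)
        have repl: "replaces s'' i f' \<longleftrightarrow> replaces s i f'" for i f' by (simp add: replaces_def lead'')
        have notf: "fst s aF (int i) \<noteq> int f" if "i < j" for i
        proof
          assume "fst s aF (int i) = int f"
          then have "f = nat (fst s aF (int i))" by simp
          then have "f \<in> X" using that unfolding X_def by blast
          then show False using f(2) by simp
        qed
        have notfs: "f \<noteq> fs i'" if "i' < card S" "Suc j \<le> i'" for i'
          using f(2) that by (auto simp: X_def)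
        show ?case
          unfolding selected_def
        proof (intro conjI allI impI)
          fix i assume i: "i < Suc j" "i < card S"
          show "\<exists>f. fst s'' aF (int i) = int f \<and> replaces s'' i f \<and> (\<forall>i'<card S. Suc j \<le> i' \<longrightarrow> f \<noteq> fs i')"
          proof (cases "i = j")
            case True
            then show ?thesis using 1(1) rep notfs by auto
          next
            case False
            then have "i < j" using i by simp
            then obtain f' where "fst s aF (int i) = int f'" "replaces s i f'" "\<forall>i'<card S. j \<le> i' \<longrightarrow> f' \<noteq> fs i'"
              using sel i by (auto simp: selected_def)
            then show ?thesis using 1(1) False repl by (intro exI[of _ f']) auto
          qed
        next
          fix i assume "i < Suc j" "card S \<le> i"
          then show "fst s'' aF (int i) = -1" using True by simp
        next
          fix i i' assume ii: "i < Suc j" "i' < Suc j" "fst s'' aF (int i) = fst s'' aF (int i')" "0 \<le> fst s'' aF (int i)"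
          show "i = i'"
          proof (cases "i = j \<or> i' = j")
            case True
            then show ?thesis using ii 1(1) notf[of i] notf[of i'] by (auto simp: less_Suc_eq split: if_splits)
          next
            case False
            then show ?thesis using ii 1(1) sel by (auto simp: selected_def less_Suc_eq)
          qed
        qed
      qed
    qed (use i x(1) f(4) gmask_less[of "fs j"] in auto)
  qed
  define s1 where "s1 = iupdate vLI 0 li s"
  define s2 where "s2 = iupdate vTY 0 (int T) s1"
  define s3 where "s3 = iupdate vRK 0 (int r) s2"
  define s4 where "s4 = iupdate vEX 0 (int x) s3"
  have p: "params s1" "params s2" "params s3" by (simp_all add: s1_def s2_def s3_def s)
  have e4: "ensures (PICK (int q)) s4 (selected (Suc j))"
    by (rule pick) (simp_all add: s1_def s2_def s3_def s4_def agree_def)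
  have l4: "likely (1 / real nrad) (PSeq (PRand vEX vRR) (PICK (int q))) s3 (selected (Suc j))"
  proof (rule likely_PSeq_ensures)
    show "likely (1 / real nrad) (PRand vEX vRR) s3 (\<lambda>s'. s' = s4)"
      using likely_PRand[of "int x" s3 vRR "\<lambda>s'. s' = s4"] scalars(6)[OF p(3)] bounds by (simp add: s4_def)
  qed (use e4 in auto)
  have l3: "likely (1 / real k * (1 / real nrad)) (PSeq (PRand vRK vK) (PSeq (PRand vEX vRR) (PICK (int q)))) s2
      (selected (Suc j))"
  proof (rule likely_PSeq)
    show "likely (1 / real k) (PRand vRK vK) s2 (\<lambda>s'. s' = s3)"
      using likely_PRand[of "int r" s2 vK "\<lambda>s'. s' = s3"] scalars(2)[OF p(2)] bounds by (simp add: s3_def)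
  qed (use l4 in auto)
  have l2: "likely (1 / real (2 ^ t + 1) * (1 / real k * (1 / real nrad)))
      (PSeq (PRand vTY vP2) (PSeq (PRand vRK vK) (PSeq (PRand vEX vRR) (PICK (int q))))) s1 (selected (Suc j))"
  proof (rule likely_PSeq)
    have "int T < 2 ^ t + 1" using bounds(3) by (metis le_imp_less_Suc of_nat_Suc of_nat_less_iff of_nat_numeral of_nat_power add.commute)
    then show "likely (1 / real (2 ^ t + 1)) (PRand vTY vP2) s1 (\<lambda>s'. s' = s2)"
      using likely_PRand[of "int T" s1 vP2 "\<lambda>s'. s' = s2" vTY] scalars(5)[OF p(1)]
      by (simp add: s2_def add.commute)
  qed (use l3 in auto)
  have "likely (1 / real (k + 1) * (1 / real (2 ^ t + 1) * (1 / real k * (1 / real nrad))))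
      (SELECT (int q)) s (selected (Suc j))"
    unfolding SELECT_def block.simps
  proof (rule likely_PSeq)
    show "likely (1 / real (k + 1)) (PRand vLI vK1) s (\<lambda>s'. s' = s1)"
      using likely_PRand[of li s vK1 "\<lambda>s'. s' = s1"] scalars(4)[OF s] bounds by (simp add: s1_def)
  qed (use l2 in auto)
  moreover have "1 / real (k + 1) * (1 / real (2 ^ t + 1) * (1 / real k * (1 / real nrad)))
      = 1 / real ((k + 1) * (2 ^ t + 1) * k * nrad)"
    by (simp only: of_nat_mult times_divide_times_eq mult_1 mult.assoc)
  ultimately show ?thesis by metis
qed

text \<open>Replacement is a bijection between the centers and the chosen facilities that preserves
  group types. So each group contains equally many of both, and if clients follow their centers, the
  loads are the old ones and the capacities no smaller.\<close>

lemma selected_solution: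
  assumes sel: "selected k s" and lead: "S \<noteq> {} \<longrightarrow> sampled k s"
  obtains \<rho>' where "distinct_slots s" "feasible I (chosen s) \<rho>'"
    "objective \<rho>' \<le> (3 ^ z + 31 / real q) * objective \<rho>"
proof -
  let ?L = "leadset k s"
  have "\<forall>i<card S. \<exists>f. fst s aF (int i) = int f \<and> replaces s i f"
    using sel card_S by (force simp: selected_def)
  then obtain ff where ff: "\<And>i. i < card S \<Longrightarrow> fst s aF (int i) = int (ff i)" "\<And>i. i < card S \<Longrightarrow> replaces s i (ff i)"
    by metis
  have empty: "fst s aF (int i) = -1" if "i < k" "card S \<le> i" for i using sel that by (simp add: selected_def)
  have dist: "distinct_slots s" using sel by (simp add: selected_def distinct_slots_def)
  have ch: "chosen s = ff ` {0..<card S}"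
  proof -
    have "v \<in> ff ` {0..<card S}" if "j < k" "fst s aF (int j) = int v" for j v
      using that ff(1)[of j] empty[of j] by (cases "j < card S") auto
    moreover have "ff i \<in> chosen s" if "i < card S" for i
      using that ff(1) card_S by (auto simp: chosen_def intro!: exI[of _ i])
    ultimately show ?thesis by (auto simp: chosen_def)
  qed
  have inj: "inj_on ff {0..<card S}"
  proof (rule inj_onI)
    fix i j assume ij: "i \<in> {0..<card S}" "j \<in> {0..<card S}" "ff i = ff j"
    then have "fst s aF (int i) = fst s aF (int j)" "0 \<le> fst s aF (int i)" using ff(1) by auto
    then show "i = j" using dist ij card_S unfolding distinct_slots_def by fastforce
  qed
  define idx where "idx = the_inv_into {0..<card S} fs"
  have idx: "idx v < card S" "fs (idx v) = v" if "v \<in> S" for v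
    using that fs f_the_inv_into_f_bij_betw[OF fs that] the_inv_into_into[of fs "{0..<card S}" v "{0..<card S}"]
    by (auto simp: idx_def bij_betw_def)
  define g where "g v = ff (idx v)" for v
  have g_eq: "g v = ff i \<longleftrightarrow> v = fs i" if "v \<in> S" "i < card S" for v i
    using that idx[OF that(1)] inj_onD[OF inj, of "idx v" i] fs_inj[of "idx v" i] by (auto simp: g_def)
  have mem: "ff i \<in> group_set I h \<longleftrightarrow> fs i \<in> group_set I h" if "i < card S" "h < t" for i h
    using ff(2)[OF that(1)] that(2)
      bitmask_inj[of "\<lambda>h. ff i \<in> group_set I h" t "\<lambda>h. fs i \<in> group_set I h" h]
    by (simp add: replaces_def gmask_def)
  have card_group: "card (chosen s \<inter> group_set I h) = card (S \<inter> group_set I h)" if "h < t" for h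
  proof -
    let ?J = "{i \<in> {0..<card S}. fs i \<in> group_set I h}"
    have "chosen s \<inter> group_set I h = ff ` ?J" using mem that by (auto simp: ch)
    moreover have "fs ` {0..<card S} \<inter> group_set I h = fs ` ?J" by auto
    then have "S \<inter> group_set I h = fs ` ?J" unfolding bij_betw_imp_surj_on[OF fs] .
    moreover have "inj_on ff ?J" by (rule inj_on_subset[OF inj]) auto
    moreover have "inj_on fs ?J" using fs by (auto simp: bij_betw_def intro: inj_on_subset)
    ultimately show ?thesis by (simp add: card_image)
  qed
  have "feasible I (chosen s) (\<lambda>c. g (\<rho> c))"
    unfolding feasible_def
  proof (intro conjI allI ballI impI)
    show "chosen s \<subseteq> facs" using ff(2) by (auto simp: ch replaces_def)
    show "card (chosen s) \<le> k" using card_image_le[of "{0..<card S}" ff] card_S by (simp add: ch)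
    show "(\<lambda>c. g (\<rho> c)) \<in> cls \<rightarrow> chosen s" using \<rho>S idx by (auto simp: g_def ch)
    show "lower_bound I h \<le> int (card (chosen s \<inter> group_set I h))"
      "int (card (chosen s \<inter> group_set I h)) \<le> upper_bound I h" if "h < t" for h
      using feas that by (auto simp: feasible_def card_group)
    fix f assume "f \<in> chosen s"
    then obtain i where i: "i < card S" "f = ff i" by (auto simp: ch)
    have "{c \<in> cls. g (\<rho> c) = f} = {c \<in> cls. \<rho> c = fs i}" using g_eq[OF \<rho>S i(1)] i(2) by auto
    then have "card {c \<in> cls. g (\<rho> c) = f} \<le> capacity I (fs i)"
      using feas fsS[OF i(1)] by (simp add: feasible_def)
    also have "\<dots> \<le> capacity I f" using ff(2)[OF i(1)] i(2) by (simp add: replaces_def)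
    finally show "card {c \<in> cls. g (\<rho> c) = f} \<le> capacity I f" .
  qed
  moreover have "objective (\<lambda>c. g (\<rho> c)) \<le> (3 ^ z + 31 / real q) * objective \<rho>"
  proof (cases "S = {}")
    case True
    then have "cls = {}" using \<rho>S by auto
    then show ?thesis by (simp add: objective_def)
  next
    case False
    then have sam: "sampled k s" using lead by simp
    then have L: "cl.leaders ?L" by (intro leaders_leadset) (simp add: sampled_def)
    \<comment> \<open>If the excess were not small, all \<open>k\<close> steps would have been hits.
      As there are at most \<open>k\<close> centers, none would be bad any more, and this makes the
      excess small after all.\<close>
    have "cl.excess ?L \<le> (1 + 2 * (1 / real q)) * cl.total"
    proof (cases "cl.excess ?L \<le> (1 + 2 * (1 / real q)) * cl.total")
      case no: False
      then have "card (cl.bad ?L) + k \<le> card S" using sam by (simp add: sampled_def)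
      then have "card (cl.bad ?L) = 0" using card_S by simp
      moreover have "finite (cl.bad ?L)" using finite_S by (simp add: cl.bad_def)
      ultimately have "cl.excess ?L \<le> (1 + 1 / real q) * cl.total" by (intro cl.excess_no_bad) simp
      also have "\<dots> \<le> (1 + 2 * (1 / real q)) * cl.total"
        using cl.total_nonneg by (intro mult_right_mono) (auto simp: divide_right_mono)
      finally show ?thesis .
    qed
    then have "(\<Sum>c\<in>cls. dis c (g (\<rho> c)) ^ z) \<le> (3 ^ z + 31 * (1 / real q)) * cl.total"
    proof (rule cl.moved_cost[OF L])
      show "g v \<in> pts" if "v \<in> S" for v
        using idx[OF that] ff(2) facs_pts by (auto simp: g_def replaces_def)
      show "dis v (g v) \<le> (2 + 1 / real q) * cl.near ?L v" if "v \<in> \<rho> ` cls" for v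
      proof -
        have "v \<in> S" using that \<rho>S by auto
        then show ?thesis using ff(2)[OF idx(1)] idx(2) by (simp add: replaces_def g_def)
      qed
    qed
    then show ?thesis unfolding total_objective by (simp add: objective_def)
  qed
  ultimately show thesis using that dist by blast
qed

section \<open>Repetition of the trials\<close>

definition goal :: "state \<Rightarrow> bool" where
  "goal s \<longleftrightarrow> iv s vHB = 1 \<and> rv s rGB \<le> (3 ^ z + 31 / real q) * objective \<rho>"

text \<open>The three parts of the probability belong to \<open>GUESS\<close>, to the
  \<open>k\<close> sampling steps and to the \<open>k\<close> selections; given their success,
  \<open>EVAL\<close> is certain to reach the goal.\<close>

lemma TRIAL:
  assumes s: "consistent s"
  shows "likely (1 / real (n ^ 3 * base ^ k)) (TRIAL z (int q)) s goal"
proof -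
  let ?p = "1 / (4608 * real q ^ 4)" and ?m = "(k + 1) * (2 ^ t + 1) * k * nrad"
  have p: "params s" using s by (simp add: consistent_def)
  have "likely ((1 / n) ^ 3 * (?p ^ k * (1 / real ?m) ^ k)) (TRIAL z (int q)) s goal"
    unfolding TRIAL_def block.simps
  proof (rule likely_PSeq[where R = "\<lambda>s'. S \<noteq> {} \<longrightarrow> sampled 0 s' \<and> scaled s'"], goal_cases)
    case 1
    show ?case
    proof (cases "S = {}")
      \<comment> \<open>A solution without centers has no clients. There may be no point at all to
        serve as leader, so nothing is demanded of the sampling in this case.\<close>
      case True
      have "(1 / real n) ^ 3 \<le> 1" using pos by (intro power_le_one) auto
      moreover have "likely 1 (GUESS z) s (\<lambda>_. True)" by (rule likely_ensures) (simp add: ensures_def)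
      ultimately show ?thesis by (rule_tac likely_mono) (use True in auto)
    next
      case False
      from GUESS[OF p False] show ?thesis by (rule likely_mono) auto
    qed
  next
    case 2
    show ?case by simp
  next
    case (3 s1)
    have c1: "consistent s1" using s by (simp add: consistent_agree[OF 3(2)])
    then have p1: "params s1" by (simp add: consistent_def)
    show ?case
    proof (rule likely_PSeq[where R = "\<lambda>s'. S \<noteq> {} \<longrightarrow> sampled k s' \<and> scaled s'"], goal_cases)
      case 1
      show ?case
      proof (rule likely_PFor[where m = k and I = "\<lambda>j s'. S \<noteq> {} \<longrightarrow> sampled j s' \<and> scaled s'"], goal_cases)
        case 1
        then show ?case by (simp add: scalars(2)[OF p1])
      next
        case 2
        then show ?case by simp
      next
        case 3
        then show ?case using \<open>S \<noteq> {} \<longrightarrow> _\<close> by (simp add: sampled_def leadset_def scaled_def)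
      next
        case (4 i s2)
        have p2: "params s2" using p1 by (simp add: params_agree[OF 4(4)])
        show ?case
        proof (cases "S = {}")
          case True
          have "1 \<le> real q ^ 4" using q by (intro one_le_power) simp
          then have "1 \<le> 4608 * real q ^ 4" by linarith
          then have "?p \<le> 1" by (rule divide_le_eq_1_pos[THEN iffD2, rotated]) (use q in simp)
          moreover have "likely 1 (SAMPLE z) s2 (\<lambda>_. True)" by (rule likely_ensures) (simp add: ensures_def)
          ultimately show ?thesis by (rule_tac likely_mono) (use True in auto)
        next
          case False
          with 4(2) have "sampled i s2" "scaled s2" by auto
          from SAMPLE[OF p2 4(3) this(1)] show ?thesis
          proof (rule likely_mono)
            fix s3 assume "s3 \<in> set_pmf (den (SAMPLE z) s2)" "sampled (Suc i) s3"
            moreover from den_agree[OF this(1)] have "rv s3 rR0 = rv s2 rR0" by (simp add: agree_def)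
            ultimately show "S \<noteq> {} \<longrightarrow> sampled (Suc i) (iupdate iJ 0 (int (Suc i)) s3) \<and>
                scaled (iupdate iJ 0 (int (Suc i)) s3)"
              using \<open>scaled s2\<close> by (simp add: sampled_def leadset_def scaled_def)
          qed simp
        qed
      qed
    next
      case 2
      then show ?case by simp
    next
      case (3 s2)
      have c2: "consistent s2" using c1 by (simp add: consistent_agree[OF 3(2)])
      then have p2: "params s2" by (simp add: consistent_def)
      show ?case
      proof (rule likely_PSeq_ensures[where R = "\<lambda>s'. selected k s'"], goal_cases)
        case 1
        show ?case
        proof (rule likely_PFor[where m = k and I = selected], goal_cases)
          case 1
          then show ?case by (simp add: scalars(2)[OF p2])
        next
          case 2
          then show ?case by simp
        next
          case 3
          then show ?case by (simp add: selected_def)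
        next
          case (4 i s3)
          have p3: "params s3" using p2 by (simp add: params_agree[OF 4(4)])
          have "fst s3 aLD = fst s2 aLD" "snd s3 rMINW = snd s2 rMINW" "snd s3 rR0 = snd s2 rR0"
            using 4(4) by (simp_all add: agree_def)
          then have "S \<noteq> {} \<longrightarrow> sampled k s3 \<and> scaled s3"
            using \<open>S \<noteq> {} \<longrightarrow> sampled k s2 \<and> scaled s2\<close> by (simp add: sampled_def leadset_def scaled_def)
          from SELECT[OF p3 4(3,1) this 4(2)] show ?case
            by (rule likely_mono) (simp_all add: selected_def replaces_def leadset_def)
        qed
      next
        case 2
        then show ?case by simp
      next
        case (3 s3)
        have c3: "consistent s3" using c2 by (simp add: consistent_agree[OF 3(2)])
        have "fst s3 aLD = fst s2 aLD" "snd s3 rMINW = snd s2 rMINW" using 3(2) by (simp_all add: agree_def)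
        then have "S \<noteq> {} \<longrightarrow> sampled k s3"
          using \<open>S \<noteq> {} \<longrightarrow> sampled k s2 \<and> scaled s2\<close> by (simp add: sampled_def leadset_def)
        then obtain \<rho>' where \<rho>': "distinct_slots s3" "feasible I (chosen s3) \<rho>'"
          "objective \<rho>' \<le> (3 ^ z + 31 / real q) * objective \<rho>"
          using selected_solution[OF 3(1)] by blast
        have "slots_ok s3"
          unfolding slots_ok_def
        proof (intro allI impI)
          fix j assume j: "j < k"
          show "fst s3 aF (int j) = -1 \<or> 0 \<le> fst s3 aF (int j) \<and> nat (fst s3 aF (int j)) \<in> facs"
          proof (cases "j < card S")
            case True
            then obtain f where "fst s3 aF (int j) = int f" "replaces s3 j f"
              using 3(1) j by (auto simp: selected_def)
            then show ?thesis by (simp add: replaces_def)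
          next
            case False
            then show ?thesis using 3(1) j by (simp add: selected_def)
          qed
        qed
        from EVAL[OF c3 this] show ?case
          by (rule ensures_conseq) (use \<rho>' in \<open>auto simp: goal_def intro: order_trans\<close>)
      qed
    qed
  qed
  moreover have "(1 / real n) ^ 3 * (?p ^ k * (1 / real ?m) ^ k) = 1 / real (n ^ 3 * base ^ k)"
  proof -
    have "?p * (1 / real ?m) = 1 / real base"
      unfolding base_def by (simp only: of_nat_mult of_nat_power of_nat_numeral times_divide_times_eq mult_1 mult.assoc)
    then have "?p ^ k * (1 / real ?m) ^ k = (1 / real base) ^ k"
      by (metis power_mult_distrib)
    then show ?thesis by (simp add: power_one_over)
  qed
  ultimately show ?thesis by metis
qed

lemma base_pos: "0 < base"
  using q pos by (simp add: base_def nrad_def)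

text \<open>The failure probability is at most \<open>exp (- 2)\<close>, and \<open>exp 2\<close> is
  at least 3 by \<open>1 + x \<le> exp x\<close>. Hence the factor 2 in
  \<open>trials\<close>.\<close>

lemma repeat_bound: "2 / 3 \<le> 1 - (1 - 1 / real N) ^ (2 * N)" if "0 < N" for N :: nat
proof -
  have "1 - 1 / real N \<le> exp (- (1 / real N))" using exp_ge_add_one_self[of "- (1 / real N)"] by simp
  then have "(1 - 1 / real N) ^ (2 * N) \<le> exp (- (1 / real N)) ^ (2 * N)"
    using that by (intro power_mono) auto
  also have "\<dots> = exp (- 2)" using that by (simp add: exp_of_nat_mult[symmetric])
  also have "\<dots> \<le> 1 / 3" using exp_ge_add_one_self[of 2] by (simp add: exp_minus field_simps)
  finally show ?thesis by simp
qed

theorem MAIN: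
  assumes s: "consistent s"
  shows "likely (2 / 3) (MAIN z (int q)) s goal"
proof -
  define N where "N = n ^ 3 * base ^ k"
  have N: "0 < N" "trials = 2 * N" using pos base_pos by (simp_all add: N_def trials_def)
  have "likely (1 - (1 - 1 / real N) ^ trials) (PFor iTRIAL vTRIALS (TRIAL z (int q))) s goal"
  proof (rule likely_PFor_repeat[where K = consistent])
    show "trials = nat (iv s vTRIALS)" using s scalars(9)[of s] by (simp add: consistent_def)
    show "0 \<le> 1 / real N" by simp
    show "1 / real N \<le> 1" using N by simp
    show "consistent (iupdate iTRIAL 0 m s')" if "consistent s'" for s' m
      using that consistent_agree[OF agree_iupdate[of iTRIAL "{iTRIAL}" "{}" s' 0 m]] by simp
    show "goal (iupdate iTRIAL 0 m s')" if "goal s'" for s' m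
      using that by (simp add: goal_def)
    show "consistent s" by (rule s)
    show "ensures (TRIAL z (int q)) s' consistent" if "consistent s'" for s'
      using TRIAL_safe[OF that] by (rule ensures_conseq) simp
    show "ensures (TRIAL z (int q)) s' goal" if "consistent s'" "goal s'" for s'
      using TRIAL_safe[OF that(1)] by (rule ensures_conseq) (use that(2) in \<open>auto simp: goal_def\<close>)
    show "likely (1 / real N) (TRIAL z (int q)) s' goal" if "consistent s'" for s'
      unfolding N_def by (rule TRIAL[OF that])
  qed
  then show ?thesis
    unfolding MAIN_def
    by (rule likely_mono) (use repeat_bound[OF N(1)] N(2) in simp_all)
qed

end

lemma (in cfr) MAIN_safe:
  assumes s: "consistent s"
  shows "ensures (MAIN z q') s consistent"
  unfolding MAIN_def
proof (rule ensures_PFor[where I = "\<lambda>_. consistent", OF refl])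
  have upd: "consistent (iupdate iTRIAL 0 m s')" if "consistent s'" for s' m
    using that consistent_agree[OF agree_iupdate[of iTRIAL "{iTRIAL}" "{}" s' 0 m]] by simp
  show "consistent (iupdate iTRIAL 0 0 s)" by (rule upd[OF s])
  show "ensures (TRIAL z q') s' (\<lambda>s''. consistent (iupdate iTRIAL 0 (int (Suc i)) s''))" if "consistent s'" for s' i
    using TRIAL_safe[OF that] by (rule ensures_conseq) (use upd in blast)
qed

section \<open>Computation of the parameters\<close>

lemma ensures_MUL:
  assumes "x \<notin> {vTMP, iI}" "y \<notin> {vTMP, iI, x}" "0 \<le> iv s y"
  shows "ensures (MUL x y) s (\<lambda>s'. iv s' x = iv s x * iv s y)"
  unfolding MUL_def block.simps ensures_simps
  by (rule ensures_PFor[where m = "nat (iv s y)" and I = "\<lambda>m s'. iv s' vTMP = iv s x * int m"])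
    (use assms in \<open>auto simp: agree_fst algebra_simps\<close>)

lemma ensures_multiples:
  assumes "iv s y = int m" "fst s arr 0 = 0" "arr \<notin> {iI, vN}" "y \<notin> {iI, arr}" "iv s vN = int n"
  shows "ensures (PFor iI y (PI arr (IAdd (IV iI) (IConst 1)) (IAdd (IGet arr (IV iI)) (IV vN)))) s
    (\<lambda>s'. \<forall>u<m. fst s' arr (int u) = int (u * n))"
proof (rule ensures_PFor[where m = m and I = "\<lambda>m s'. \<forall>u\<le>m. fst s' arr (int u) = int (u * n)"], goal_cases)
  case (3 i s1)
  have "iv s1 vN = int n" using 3(4) assms(3,5) by (simp add: agree_def)
  then show ?case using 3 assms(3) by (auto simp: le_Suc_eq algebra_simps)
qed (use assms in auto)

context cfr
begin

definition WHOLE :: prog where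
  "WHOLE = PSeq SETUP0 (PSeq (SETUP1 (int a) (int q)) (PSeq (SETUP2 (int q)) (PSeq SETUP3 (MAIN z (int q)))))"

text \<open>What the computation of the parameters has to leave alone: the input, and the arrays
  whose initial zeros \<open>consistent\<close> relies on.\<close>

definition started :: "state \<Rightarrow> bool" where
  "started s \<longleftrightarrow> (\<forall>x\<le>6. fst s x = encode_ints I x) \<and> snd s 0 = encode_reals I 0 \<and>
     fst s aSV = (\<lambda>_. 0) \<and> fst s OUTS = (\<lambda>_. 0) \<and> iv s vHB = 0"

lemma started_agree:
  assumes "agree X Y s s'" "X \<inter> ({..7} \<union> {aSV, vHB}) = {}" "0 \<notin> Y"
  shows "started s' = started s"
proof -
  have "fst s' x = fst s x" if "x \<le> 6 \<or> x \<in> {OUTS, aSV, vHB}" for x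
    by (rule agree_fst[OF assms(1)]) (use assms(2) that in auto)
  moreover have "snd s' 0 = snd s 0" by (rule agree_snd[OF assms(1,3)])
  ultimately show ?thesis by (simp add: started_def)
qed

definition setup0 :: "state \<Rightarrow> bool" where
  "setup0 s \<longleftrightarrow> started s \<and> iv s vN = int n \<and> iv s vK = int k \<and> iv s vT = int t \<and> iv s vK1 = int (k + 1)"

definition setup1 :: "state \<Rightarrow> bool" where
  "setup1 s \<longleftrightarrow> setup0 s \<and> iv s vP2 = int (2 ^ t + 1) \<and> iv s vRR = int nrad \<and> iv s vNN = int (4608 * q ^ 4 * n) \<and>
     (\<forall>u<n. fst s aROW (int u) = int (u * n)) \<and> (\<forall>i<t. fst s aGROW (int i) = int (i * n)) \<and>
     (\<forall>v<n. fst s aMASK (int v) = int (gmask v))"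

definition setup2 :: "state \<Rightarrow> bool" where
  "setup2 s \<longleftrightarrow> setup1 s \<and> iv s vB = int base"

lemma encode_zero: "6 < x \<Longrightarrow> fst (encode I) x = (\<lambda>_. 0)"
  by (simp add: encode_def encode_ints_def fun_eq_iff)

lemma started_encode: "started (encode I)"
  by (simp add: started_def encode_zero) (simp add: encode_def)

lemma setup0: "ensures SETUP0 (encode I) (\<lambda>s. setup0 s \<and> fst s aROW = (\<lambda>_. 0) \<and> fst s aGROW = (\<lambda>_. 0) \<and> fst s aMASK = (\<lambda>_. 0))"
proof (rule ensures_conseq[where R = "\<lambda>s. iv s vN = int n \<and> iv s vK = int k \<and> iv s vT = int t \<and> iv s vK1 = int (k + 1)"])
  show "ensures SETUP0 (encode I) (\<lambda>s. iv s vN = int n \<and> iv s vK = int k \<and> iv s vT = int t \<and> iv s vK1 = int (k + 1))"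
    by (simp add: SETUP0_def encode_def encode_ints_def vector_array_def numeral_2_eq_2)
next
  fix s assume "iv s vN = int n \<and> iv s vK = int k \<and> iv s vT = int t \<and> iv s vK1 = int (k + 1)"
    and a: "agree (iw SETUP0) (rw SETUP0) (encode I) s"
  moreover have "started s" using started_encode by (simp add: started_agree[OF a])
  moreover have "fst s aROW = (\<lambda>_. 0)" "fst s aGROW = (\<lambda>_. 0)" "fst s aMASK = (\<lambda>_. 0)"
    using a encode_zero by (simp_all add: agree_def)
  ultimately show "setup0 s \<and> fst s aROW = (\<lambda>_. 0) \<and> fst s aGROW = (\<lambda>_. 0) \<and> fst s aMASK = (\<lambda>_. 0)"
    by (simp add: setup0_def)
qed

lemma lg_le: "n \<le> 2 ^ lg" "lg \<le> n"
proof -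
  have "n \<le> 2 ^ n" by simp
  then show "n \<le> 2 ^ lg" "lg \<le> n" unfolding lg_def by (rule LeastI, rule Least_le)
qed

lemma less_lg: "2 ^ j < n \<longleftrightarrow> j < lg"
proof
  assume "2 ^ j < n"
  then have "(2::nat) ^ j < 2 ^ lg" using lg_le(1) by linarith
  then show "j < lg" by simp
next
  assume "j < lg"
  then show "2 ^ j < n" using not_less_Least[of j "\<lambda>l. n \<le> 2 ^ l"] by (simp add: lg_def)
qed

lemma setup1_mask:
  assumes "started s" "iv s vN = int n" "iv s vT = int t" "\<forall>i<t. fst s aGROW (int i) = int (i * n)"
    "fst s aMASK = (\<lambda>_. 0)"
  shows "ensures (PFor iV vN (PFor iJ vT (PI aMASK (IV iV)
       (IAdd (IAdd (IGet aMASK (IV iV)) (IGet aMASK (IV iV))) (IGet GR (IAdd (IGet aGROW (IV iJ)) (IV iV))))))) s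
    (\<lambda>s'. \<forall>v<n. fst s' aMASK (int v) = int (gmask v))"
proof (rule ensures_PFor[where m = n and I = "\<lambda>m s'. \<forall>v. fst s' aMASK (int v) = (if v < m then int (gmask v) else 0)"], goal_cases)
  case (3 v s1)
  have e1: "iv s1 vT = int t" "fst s1 GR = fst s GR" "fst s1 aGROW = fst s aGROW"
    using 3(4) assms(3) by (simp_all add: agree_def)
  show ?case
  proof (rule ensures_PFor[where m = t and I = "\<lambda>i s'. fst s' aMASK =
      (fst s1 aMASK)(int v := int (bitmask (\<lambda>i. v \<in> group_set I i) i))"], goal_cases)
    case 1
    then show ?case by (simp add: e1)
  next
    case 2
    then show ?case using 3(2) by (simp add: fun_eq_iff)
  next
    case (3 i s2)
    have "iv s2 iV = int v" "fst s2 GR = fst s GR" "fst s2 aGROW = fst s aGROW"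
      using 3(4) e1 \<open>iv s1 iV = int v\<close> by (simp_all add: agree_def)
    moreover have "fst s GR (int (i * n) + int v) = of_bool (v \<in> group_set I i)"
      using matrix_array_int[OF 3(1) \<open>v < n\<close>, of "\<lambda>i v. of_bool (v \<in> group_set I i) :: int"] assms(1)
      by (simp add: started_def encode_ints_def)
    ultimately show ?case using 3(2,3) assms(4) \<open>i < t\<close> by (simp add: fun_eq_iff)
  next
    case (4 s2)
    then show ?case using 3(2) by (auto simp: gmask_def less_Suc_eq)
  qed
qed (use assms in auto)

lemma setup1:
  assumes s: "setup0 s" "fst s aROW = (\<lambda>_. 0)" "fst s aGROW = (\<lambda>_. 0)" "fst s aMASK = (\<lambda>_. 0)"
  shows "ensures (SETUP1 (int a) (int q)) s setup1"
proof -
  have "ensures (SETUP1 (int a) (int q)) s (\<lambda>s'. iv s' vP2 = int (2 ^ t + 1) \<and> iv s' vRR = int nrad \<and>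
      iv s' vNN = int (4608 * q ^ 4 * n) \<and> (\<forall>u<n. fst s' aROW (int u) = int (u * n)) \<and>
      (\<forall>i<t. fst s' aGROW (int i) = int (i * n)) \<and> (\<forall>v<n. fst s' aMASK (int v) = int (gmask v)))"
    unfolding SETUP1_def block.simps ensures_simps
  proof (rule ensures_conseq[OF ensures_multiples[where m = n and n = n]], goal_cases)
    case (6 s1)
    have s1: "started s1" "iv s1 vN = int n" "iv s1 vT = int t" "fst s1 aGROW = (\<lambda>_. 0)" "fst s1 aMASK = (\<lambda>_. 0)"
      using 6(2) s by (auto simp: setup0_def started_agree[OF 6(2)] agree_def)
    note r1 = 6(1)
    show ?case
    proof (rule ensures_conseq[OF ensures_multiples[where m = t and n = n]], goal_cases)
      case (6 s2)
      have s2: "started s2" "iv s2 vN = int n" "iv s2 vT = int t" "fst s2 aMASK = (\<lambda>_. 0)" "fst s2 aROW = fst s1 aROW"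
        using 6(2) s1 by (auto simp: started_agree[OF 6(2)] agree_def)
      note r2 = 6(1)
      show ?case
      proof (rule ensures_conseq[OF setup1_mask[OF s2(1,2,3) r2 s2(4)]], goal_cases)
        case (1 s3)
        have s3: "iv s3 vN = int n" "iv s3 vT = int t" "fst s3 aROW = fst s1 aROW" "fst s3 aGROW = fst s2 aGROW"
          using 1(2) s2 by (simp_all add: agree_def)
        note r3 = 1(1)
        show ?case
        proof (rule ensures_PFor[where m = t and I = "\<lambda>m s'. iv s' vP2 = 2 ^ m"], goal_cases)
          case (4 s4)
          have s4: "iv s4 vN = int n" "fst s4 aROW = fst s1 aROW" "fst s4 aGROW = fst s2 aGROW" "fst s4 aMASK = fst s3 aMASK"
            using 4(2) s3 by (simp_all add: agree_def)
          note r4 = 4(1)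
          show ?case
          \<comment> \<open>The doubling stops when \<open>n\<close> is reached, that is, after
            \<open>lg\<close> rounds; as \<open>lg\<close> is at most \<open>n\<close>, a loop of
            \<open>n\<close> rounds is long enough.\<close>
          proof (rule ensures_PFor[where m = n and I = "\<lambda>m s'. iv s' vPP = 2 ^ min m lg \<and> iv s' vRR = 2 + int q * int a * int (min m lg)"], goal_cases)
            case (3 i s5)
            have N: "iv s5 vN = int n" using 3(4) s4 by (simp add: agree_def)
            have "(2 ^ min i lg < int n) \<longleftrightarrow> min i lg < lg"
              using less_lg[of "min i lg"] by (metis of_nat_less_iff of_nat_numeral of_nat_power)
            then show ?case using 3(2) N by (auto simp: min_def algebra_simps)
          next
            case (4 s5)
            have s5: "iv s5 vN = int n" "fst s5 aROW = fst s1 aROW" "fst s5 aGROW = fst s2 aGROW" "fst s5 aMASK = fst s3 aMASK"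
              "iv s5 vP2 = 2 ^ t + 1"
              using 4(2) s4 r4 by (simp_all add: agree_def)
            have RR: "iv s5 vRR = int nrad" using 4(1) lg_le(2) by (simp add: nrad_def min_def)
            show ?case
            proof (rule ensures_PFor[where m = n and I = "\<lambda>m s'. iv s' vNN = 4608 * int q ^ 4 * int m"], goal_cases)
              case (4 s6)
              then show ?case
                using s5 RR r1 r2 r3 by (simp add: agree_def add.commute)
            qed (use s5 in \<open>auto simp: algebra_simps\<close>)
          qed (use s4 in auto)
        qed (use s3 in auto)
      qed
    qed (use s1 in auto)
  qed (use s in \<open>auto simp: setup0_def\<close>)
  then show ?thesis
  proof (rule ensures_conseq, goal_cases)
    case (1 s')
    have "setup0 s'" using s 1(2) by (auto simp: setup0_def started_agree[OF 1(2)] agree_def)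
    then show ?case using 1(1) by (simp add: setup1_def)
  qed
qed

lemma setup1_agree:
  assumes "agree X Y s s'" "X \<inter> ({..7} \<union> {10..16} \<union> {20..22} \<union> {aSV, vHB}) = {}" "0 \<notin> Y"
  shows "setup1 s' = setup1 s"
proof -
  have "fst s' x = fst s x" if "x \<in> {10..16} \<union> {20..22}" for x
    by (rule agree_fst[OF assms(1)]) (use assms(2) that in auto)
  moreover have "started s' = started s"
    by (rule started_agree[OF assms(1)]) (use assms(2,3) in auto)
  ultimately show ?thesis by (simp add: setup1_def setup0_def)
qed

lemma setup2:
  assumes s: "setup1 s"
  shows "ensures (SETUP2 (int q)) s setup2"
proof -
  have vals: "iv s vK1 = int (k + 1)" "iv s vP2 = int (2 ^ t + 1)" "iv s vK = int k" "iv s vRR = int nrad"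
    using s by (simp_all add: setup1_def setup0_def)
  have "ensures (SETUP2 (int q)) s (\<lambda>s'. iv s' vB = int base)"
    unfolding SETUP2_def block.simps ensures_simps
  proof (rule ensures_conseq[OF ensures_MUL], goal_cases)
    case (4 s1)
    have s1: "iv s1 vB = int (4608 * q ^ 4) * int (k + 1)" "iv s1 vP2 = int (2 ^ t + 1)" "iv s1 vK = int k" "iv s1 vRR = int nrad"
      using 4 vals by (simp_all add: agree_def)
    show ?case
    proof (rule ensures_conseq[OF ensures_MUL], goal_cases)
      case (4 s2)
      have s2: "iv s2 vB = int (4608 * q ^ 4) * int (k + 1) * int (2 ^ t + 1)" "iv s2 vK = int k" "iv s2 vRR = int nrad"
        using 4 s1 by (simp_all add: agree_def)
      show ?case
      proof (rule ensures_conseq[OF ensures_MUL], goal_cases)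
        case (4 s3)
        have s3: "iv s3 vB = int (4608 * q ^ 4) * int (k + 1) * int (2 ^ t + 1) * int k" "iv s3 vRR = int nrad"
          using 4 s2 by (simp_all add: agree_def)
        show ?case
        proof (rule ensures_conseq[OF ensures_MUL], goal_cases)
          case (4 s4)
          then show ?case unfolding s3 base_def by (simp only: of_nat_mult)
        qed (use s3 in auto)
      qed (use s2 in auto)
    qed (use s1 in auto)
  qed (use vals in auto)
  then show ?thesis
    by (rule ensures_conseq) (use s in \<open>simp add: setup2_def setup1_agree\<close>)
qed

lemma setup3:
  assumes s: "setup2 s"
  shows "ensures SETUP3 s consistent"
proof -
  have vals: "iv s vK1 = int (k + 1)" "iv s vK = int k" "iv s vN = int n" "iv s vB = int base"
    using s by (simp_all add: setup2_def setup1_def setup0_def)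
  have "ensures SETUP3 s (\<lambda>s'. iv s' vCODES = int (k ^ (k + 1)) \<and> iv s' vTRIALS = int trials)"
    unfolding SETUP3_def block.simps ensures_simps
  proof (rule ensures_PFor[where m = "k + 1" and I = "\<lambda>m s'. iv s' vCODES = int (k ^ m)"], goal_cases)
    case (3 i s1)
    have "iv s1 vK = int k" using 3(4) vals by (simp add: agree_def)
    then show ?case by (intro ensures_conseq[OF ensures_MUL]) (use 3(2) in simp_all)
  next
    case (4 s1)
    have s1: "iv s1 vCODES = int (k ^ (k + 1))" "iv s1 vK = int k" "iv s1 vN = int n" "iv s1 vB = int base"
      using 4 vals by (simp_all add: agree_def)
    show ?case
    proof (rule ensures_conseq[OF ensures_MUL], goal_cases)
      case (4 s2)
      have s2: "iv s2 vTRIALS = int (2 * n)" "iv s2 vCODES = int (k ^ (k + 1))" "iv s2 vK = int k" "iv s2 vN = int n" "iv s2 vB = int base"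
        using 4 s1 by (simp_all add: agree_def)
      show ?case
      proof (rule ensures_conseq[OF ensures_MUL], goal_cases)
        case (4 s3)
        have s3: "iv s3 vTRIALS = int (2 * n * n)" "iv s3 vCODES = int (k ^ (k + 1))" "iv s3 vK = int k" "iv s3 vN = int n" "iv s3 vB = int base"
          using 4 s2 by (simp_all add: agree_def)
        show ?case
        proof (rule ensures_conseq[OF ensures_MUL], goal_cases)
          case (4 s4)
          have s4: "iv s4 vTRIALS = int (2 * n ^ 3)" "iv s4 vCODES = int (k ^ (k + 1))" "iv s4 vK = int k" "iv s4 vB = int base"
            using 4 s3 by (simp_all add: agree_def power3_eq_cube)
          show ?case
          proof (rule ensures_PFor[where m = k and I = "\<lambda>m s'. iv s' vTRIALS = int (2 * n ^ 3 * base ^ m)"], goal_cases)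
            case (3 i s5)
            have "iv s5 vB = int base" using 3(4) s4 by (simp add: agree_def)
            then show ?case by (intro ensures_conseq[OF ensures_MUL]) (use 3(2) in simp_all)
          next
            case (4 s5)
            then show ?case using s4 by (simp add: trials_def agree_def)
          qed (use s4 in auto)
        qed (use s3 in auto)
      qed (use s2 in auto)
    qed (use s1 in auto)
  qed (use vals in auto)
  then show ?thesis
  proof (rule ensures_conseq, goal_cases)
    case (1 s')
    have "setup1 s'" using s by (simp add: setup2_def setup1_agree[OF 1(2)])
    then show ?case using 1(1)
      by (simp add: consistent_def params_def setup1_def setup0_def started_def)
  qed
qed

lemma ensures_PSeqI: "ensures p s R \<Longrightarrow> (\<And>s'. R s' \<Longrightarrow> ensures p' s' Q) \<Longrightarrow> ensures (PSeq p p') s Q"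
  by (auto simp: ensures_def)

lemma WHOLE_safe: "ensures WHOLE (encode I) consistent"
  unfolding WHOLE_def
  by (rule ensures_PSeqI[OF setup0], rule ensures_PSeqI[OF setup1], blast+,
      rule ensures_PSeqI[OF setup2], assumption, rule ensures_PSeqI[OF setup3], assumption, rule MAIN_safe)

end

lemma (in cfr_solution) WHOLE_likely: "likely (2 / 3) WHOLE (encode I) goal"
  unfolding WHOLE_def
  by (rule likely_ensures_PSeq[OF setup0], simp, rule likely_ensures_PSeq[OF setup1], blast+, simp,
      rule likely_ensures_PSeq[OF setup2], assumption, simp, rule likely_ensures_PSeq[OF setup3], assumption, simp,
      rule MAIN)

section \<open>Running time\<close>

lemma runs_PSeq:
  assumes "runs (compile p) s (den p s) T" "\<And>s'. s' \<in> set_pmf (den p s) \<Longrightarrow> runs (compile p') s' (den p' s') T'"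
  shows "runs (compile (PSeq p p')) s (den (PSeq p p') s) (T + T')"
  unfolding compile.simps den.simps using assms by (intro runs_Seq) auto

context cfr
begin

definition maxbound :: nat where
  "maxbound = trials + k ^ (k + 1)"

text \<open>Most parameters divide \<open>base\<close>, and \<open>base\<close> is at most
  \<open>base ^ k\<close> since \<open>k\<close> is positive. The rest is at most
  \<open>n * base\<close>, hence at most \<open>trials\<close>, apart from the number of reroutings,
  which is a summand of \<open>maxbound\<close>.\<close>

lemma bounds:
  "n \<le> maxbound" "t \<le> maxbound" "k + 1 \<le> maxbound" "2 ^ t + 1 \<le> maxbound" "k \<le> maxbound"
  "nrad \<le> maxbound" "base \<le> maxbound" "trials \<le> maxbound" "k ^ (k + 1) \<le> maxbound"
  "4608 * q ^ 4 * n \<le> maxbound"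
proof -
  have q4: "1 \<le> q ^ 4" "1 \<le> k" "1 \<le> nrad" "1 \<le> n" using q pos by (simp_all add: nrad_def)
  have b: "4608 * q ^ 4 \<le> base" "k + 1 \<le> base" "2 ^ t + 1 \<le> base" "k \<le> base" "nrad \<le> base"
  proof -
    have "0 < base" using q pos by (simp add: base_def nrad_def)
    note le = dvd_imp_le[OF _ this]
    show "4608 * q ^ 4 \<le> base"
      by (rule le) (unfold base_def, rule dvd_mult2, rule dvd_mult2, rule dvd_mult2, rule dvd_mult2, rule dvd_refl)
    show "k + 1 \<le> base"
      by (rule le) (unfold base_def, rule dvd_mult2, rule dvd_mult2, rule dvd_mult2, rule dvd_triv_right)
    show "2 ^ t + 1 \<le> base"
      by (rule le) (unfold base_def, rule dvd_mult2, rule dvd_mult2, rule dvd_triv_right)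
    show "k \<le> base" by (rule le) (unfold base_def, rule dvd_mult2, rule dvd_triv_right)
    show "nrad \<le> base" by (rule le) (unfold base_def, rule dvd_triv_right)
  qed
  have b1: "1 \<le> base" using b(2) by simp
  have "base * 1 \<le> base * base ^ (k - 1)" using b1 by (intro mult_left_mono) auto
  also have "\<dots> = base ^ k" using pos by (simp add: power_eq_if)
  finally have bk: "base \<le> base ^ k" by simp
  have n3: "n * 1 \<le> n * (n * n)" using q4(4) by (intro mult_left_mono) auto
  have nb: "n * base \<le> trials"
  proof -
    have "n * base \<le> n ^ 3 * base ^ k"
      using n3 bk by (intro mult_mono) (auto simp: power3_eq_cube)
    then show ?thesis by (simp add: trials_def)
  qed
  have "n * 1 \<le> n * base" using b1 by (intro mult_left_mono) auto
  then have "n \<le> trials" using nb by linarith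
  then show "n \<le> maxbound" by (simp add: maxbound_def)
  have "1 * base \<le> n * base" using q4 by (intro mult_right_mono) auto
  then have bt: "base \<le> trials" using nb by linarith
  then show "k + 1 \<le> maxbound" "2 ^ t + 1 \<le> maxbound" "k \<le> maxbound" "nrad \<le> maxbound" "base \<le> maxbound"
    using b by (simp_all add: maxbound_def)
  moreover have "t < 2 ^ t" by simp
  ultimately show "t \<le> maxbound" by linarith
  have "4608 * q ^ 4 * n \<le> base * n" using b(1) by (rule mult_right_mono) simp
  also have "\<dots> \<le> trials" using nb by (simp only: mult.commute)
  finally show "4608 * q ^ 4 * n \<le> maxbound" unfolding maxbound_def by linarith
qed (simp_all add: maxbound_def)

definition runtime :: nat where
  "runtime = ptime SETUP0 maxbound + (ptime (SETUP1 (int a) (int q)) maxbound +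
     (ptime (SETUP2 (int q)) maxbound + (ptime SETUP3 maxbound + ptime (MAIN z (int q)) maxbound)))"

lemma WHOLE_runs: "runs (compile WHOLE) (encode I) (den WHOLE (encode I)) runtime"
  unfolding WHOLE_def runtime_def
proof (rule runs_PSeq, goal_cases)
  case 1
  show ?case by (rule runs_compile) (simp_all add: psimple_programs bvars_programs)
next
  case (2 s1)
  have s1: "setup0 s1" "fst s1 aROW = (\<lambda>_. 0)" "fst s1 aGROW = (\<lambda>_. 0)" "fst s1 aMASK = (\<lambda>_. 0)"
    using ensuresD[OF setup0 2] by auto
  show ?case
  proof (rule runs_PSeq, goal_cases)
    case 1
    show ?case
    proof (rule runs_compile)
      fix y assume "y \<in> bvars (SETUP1 (int a) (int q))"
      then consider "iv s1 y = int n" | "iv s1 y = int t"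
        using s1(1) unfolding bvars_programs setup0_def by blast
      then show "\<bar>iv s1 y\<bar> \<le> int maxbound"
        using bounds(1,2) by cases (simp_all only: abs_of_nat of_nat_le_iff)
    qed (simp_all add: psimple_programs bvars_programs)
  next
    case (2 s2)
    have s2: "setup1 s2" using ensuresD[OF setup1[OF s1] 2] .
    show ?case
    proof (rule runs_PSeq, goal_cases)
      case 1
      show ?case
      proof (rule runs_compile)
        fix y assume "y \<in> bvars (SETUP2 (int q))"
        then consider "iv s2 y = int (k + 1)" | "iv s2 y = int (2 ^ t + 1)" | "iv s2 y = int k" | "iv s2 y = int nrad"
          using s2 unfolding bvars_programs setup1_def setup0_def by blast
        then show "\<bar>iv s2 y\<bar> \<le> int maxbound"
          using bounds by cases (simp_all only: abs_of_nat of_nat_le_iff)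
      qed (simp_all add: psimple_programs bvars_programs)
    next
      case (2 s3)
      have s3: "setup2 s3" using ensuresD[OF setup2[OF s2] 2] .
      show ?case
      proof (rule runs_PSeq, goal_cases)
        case 1
        show ?case
        proof (rule runs_compile)
          fix y assume "y \<in> bvars SETUP3"
          then consider "iv s3 y = int (k + 1)" | "iv s3 y = int k" | "iv s3 y = int n" | "iv s3 y = int base"
            using s3 unfolding bvars_programs setup2_def setup1_def setup0_def by blast
          then show "\<bar>iv s3 y\<bar> \<le> int maxbound"
            using bounds by cases (simp_all only: abs_of_nat of_nat_le_iff)
        qed (simp_all add: psimple_programs bvars_programs)
      next
        case (2 s4)
        have "params s4" using ensuresD[OF setup3[OF s3] 2] by (simp add: consistent_def)
        show ?case
        proof (rule runs_compile)
          show "psimple (MAIN z (int q))" using z by (rule psimple_programs)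
          show "bvars (MAIN z (int q)) \<inter> iw (MAIN z (int q)) = {}"
            by (simp add: bvars_programs iw_MAIN)
          fix y assume "y \<in> bvars (MAIN z (int q))"
          then consider "iv s4 y = int trials" | "iv s4 y = int n" | "iv s4 y = int k" | "iv s4 y = int (4608 * q ^ 4 * n)"
            | "iv s4 y = int (k + 1)" | "iv s4 y = int (2 ^ t + 1)" | "iv s4 y = int nrad" | "iv s4 y = int t"
            | "iv s4 y = int (k ^ (k + 1))"
            using \<open>params s4\<close> unfolding bvars_programs params_def by blast
          then show "\<bar>iv s4 y\<bar> \<le> int maxbound"
            using bounds by cases (simp_all only: abs_of_nat of_nat_le_iff)
        qed
      qed
    qed
  qed
qed

text \<open>Both objectives are included, so that one constant serves them; it depends neither on
  the instance nor on the accuracy.\<close>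

definition tconst :: nat where
  "tconst = tcoeff SETUP0 + tcoeff (SETUP1 0 0) + tcoeff (SETUP2 0) + tcoeff SETUP3 + tcoeff (MAIN 1 0) + tcoeff (MAIN 2 0)"

lemma runtime_le: "runtime \<le> tconst * (maxbound + 1) ^ 5"
proof -
  have "(maxbound + 1) ^ d \<le> (maxbound + 1) ^ 5" if "d \<le> 5" for d
    using that by (intro power_increasing) auto
  then have le: "ptime p maxbound \<le> tcoeff p * (maxbound + 1) ^ 5" if "depth p \<le> 5" for p
    using that by (simp add: ptime_def)
  have eqs: "tcoeff (SETUP1 (int a) (int q)) = tcoeff (SETUP1 0 0)" "tcoeff (SETUP2 (int q)) = tcoeff (SETUP2 0)"
    "tcoeff (MAIN z (int q)) = tcoeff (MAIN z 0)"
    by (rule tcoeff_programs)+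
  have "runtime \<le> tcoeff SETUP0 * (maxbound + 1) ^ 5 + (tcoeff (SETUP1 0 0) * (maxbound + 1) ^ 5 +
     (tcoeff (SETUP2 0) * (maxbound + 1) ^ 5 + (tcoeff SETUP3 * (maxbound + 1) ^ 5 + tcoeff (MAIN z 0) * (maxbound + 1) ^ 5)))"
    unfolding runtime_def using le[of SETUP0] le[of "SETUP1 (int a) (int q)"] le[of "SETUP2 (int q)"]
      le[of SETUP3] le[of "MAIN z (int q)"]
    unfolding depth_programs eqs by (intro add_mono) simp_all
  also have "\<dots> = (tcoeff SETUP0 + tcoeff (SETUP1 0 0) + tcoeff (SETUP2 0) + tcoeff SETUP3 + tcoeff (MAIN z 0)) * (maxbound + 1) ^ 5"
    by (simp only: add_mult_distrib add.assoc)
  also have "\<dots> \<le> tconst * (maxbound + 1) ^ 5"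
    unfolding tconst_def using z by (intro mult_right_mono) auto
  finally show ?thesis .
qed

text \<open>The coefficient in the bound on \<open>base\<close>: \<open>32 ^ 4\<close> stems from
  the bound on \<open>q\<close>, the factors 2 from \<open>k + 1\<close> and
  \<open>2 ^ t + 1\<close>, and the last factor from \<open>nrad\<close>, with 64 as 32 times
  2.\<close>

definition K0 :: real where
  "K0 = 4608 * 32 ^ 4 * 2 * 2 * (2 + 64 * real a)"

text \<open>In terms of the bracket \<open>X\<close> of the time bound, \<open>base\<close> is at
  most \<open>K0 * X ^ 8\<close>: four powers for \<open>q ^ 4\<close> and one each for
  \<open>k + 1\<close>, \<open>2 ^ t + 1\<close>, \<open>k\<close> and \<open>nrad\<close>. Over
  \<open>k\<close> rounds this is \<open>X ^ (8 * k)\<close>, and the five nested loops raise it to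
  \<open>X ^ (40 * k)\<close> and \<open>n ^ 3\<close> to \<open>n ^ 15\<close>.\<close>

lemma runtime_time_bound:
  assumes \<epsilon>: "0 < \<epsilon>" and q_le: "real q \<le> 32 * max 1 (1 / \<epsilon>)"
  shows "real runtime \<le> time_bound (1024 * real tconst * K0) 40 15 \<epsilon> I"
proof -
  define \<mu> where "\<mu> = max 1 (1 / \<epsilon>)"
  define l where "l = log 2 (real n + 1)"
  define X where "X = 2 ^ t * real k * \<mu> * l"
  have \<mu>1: "1 \<le> \<mu>" by (simp add: \<mu>_def)
  have l1: "1 \<le> l"
    unfolding l_def using pos by (subst one_le_log_cancel_iff) auto
  have k1: "1 \<le> real k" using pos by simp
  have t2: "(1::real) \<le> 2 ^ t" by simp
  have tk: "1 \<le> 2 ^ t * real k" using mult_mono[OF t2 k1] by simp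
  have ml: "1 \<le> \<mu> * l" using mult_mono[OF \<mu>1 l1] \<mu>1 by simp
  have X: "X = (2 ^ t * real k) * (\<mu> * l)" by (simp add: X_def mult.assoc)
  have Xml: "\<mu> * l \<le> X" using mult_right_mono[OF tk, of "\<mu> * l"] ml by (simp add: X)
  have Xtk: "2 ^ t * real k \<le> X" using mult_left_mono[OF ml, of "2 ^ t * real k"] tk by (simp add: X)
  have X1: "1 \<le> X" using ml Xml by linarith
  have "\<mu> * 1 \<le> \<mu> * l" using l1 \<mu>1 by (intro mult_left_mono) auto
  then have X\<mu>: "\<mu> \<le> X" using Xml by simp
  have "1 * real k \<le> 2 ^ t * real k" by (intro mult_right_mono) auto
  then have Xk: "real k \<le> X" using Xtk by simp
  have "2 ^ t * 1 \<le> 2 ^ t * real k" using k1 by (intro mult_left_mono) auto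
  then have Xt: "2 ^ t \<le> X" using Xtk by linarith
  have q1: "real q \<le> 32 * \<mu>" using q_le by (simp add: \<mu>_def)
  \<comment> \<open>The factor 2 pays for rounding the logarithm up.\<close>
  have lg: "real lg \<le> 2 * l"
  proof (cases lg)
    case 0
    then show ?thesis using l1 by simp
  next
    case (Suc m)
    then have "2 ^ m < n" using less_lg[of m] by simp
    then have "2 ^ m < real n" by (metis of_nat_less_iff of_nat_numeral of_nat_power)
    then have "2 ^ m \<le> real n + 1" by linarith
    then have "2 powr real m \<le> real n + 1" by (subst powr_realpow) simp_all
    then have "real m \<le> l" unfolding l_def by (subst le_log_iff) auto
    then show ?thesis using Suc l1 by simp
  qed
  have "real q * real lg \<le> (32 * \<mu>) * (2 * l)" using q1 lg \<mu>1 by (intro mult_mono) auto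
  then have "real q * real lg \<le> 64 * X" using Xml by simp
  then have "real a * (real q * real lg) \<le> real a * (64 * X)" by (rule mult_left_mono) simp
  then have "real nrad \<le> 2 * X + real a * (64 * X)" using X1 by (simp add: nrad_def mult.assoc mult.left_commute)
  then have rad: "real nrad \<le> (2 + 64 * real a) * X" by (simp add: algebra_simps)
  have q4: "real q ^ 4 \<le> (32 * X) ^ 4" using q1 X\<mu> by (intro power_mono) auto
  have base: "real base \<le> K0 * X ^ 8"
  proof -
    have "real base = 4608 * real q ^ 4 * (real k + 1) * (2 ^ t + 1) * real k * real nrad"
      unfolding base_def by (simp only: of_nat_mult of_nat_add of_nat_power of_nat_numeral of_nat_1)
    also have "\<dots> \<le> 4608 * (32 * X) ^ 4 * (2 * X) * (2 * X) * X * ((2 + 64 * real a) * X)"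
      using q4 Xk Xt X1 rad by (intro mult_mono) auto
    also have "\<dots> = K0 * (X ^ 4 * X * X * X * X)" by (simp only: K0_def power_mult_distrib mult_ac)
    also have "X ^ 4 * X * X * X * X = X ^ 8" by (simp only: power_Suc2[symmetric]) simp
    finally show ?thesis .
  qed
  have K1: "1 \<le> K0" by (simp add: K0_def)
  have n1: "1 \<le> real n" using pos by simp
  define Y where "Y = real n ^ 3 * (K0 ^ k * X ^ (8 * k))"
  have Xk8: "1 \<le> X ^ (8 * k)" "1 \<le> K0 ^ k" "1 \<le> real n ^ 3" using X1 K1 n1 by (simp_all add: one_le_power)
  have KX: "X ^ (8 * k) \<le> K0 ^ k * X ^ (8 * k)" using mult_right_mono[OF Xk8(2), of "X ^ (8 * k)"] Xk8(1) by simp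
  then have KX1: "1 \<le> K0 ^ k * X ^ (8 * k)" using Xk8(1) by linarith
  then have YKX: "K0 ^ k * X ^ (8 * k) \<le> Y"
    using mult_right_mono[OF Xk8(3), of "K0 ^ k * X ^ (8 * k)"] by (simp add: Y_def)
  have "real base ^ k \<le> (K0 * X ^ 8) ^ k" using base by (intro power_mono) auto
  also have "\<dots> = K0 ^ k * X ^ (8 * k)" by (simp add: power_mult_distrib power_mult)
  finally have "real n ^ 3 * real base ^ k \<le> Y" unfolding Y_def by (intro mult_left_mono) auto
  then have tr: "real trials \<le> 2 * Y" by (simp add: trials_def)
  have "real k ^ (k + 1) \<le> X ^ (k + 1)" using Xk by (intro power_mono) auto
  also have "\<dots> \<le> X ^ (8 * k)" using X1 pos by (intro power_increasing) auto
  finally have "real (k ^ (k + 1)) \<le> Y" using KX YKX by simp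
  \<comment> \<open>The 4 is composed of 2 for the trials, 1 for the number of reroutings and 1 for
    the successor; its fifth power is the 1024 in the constant.\<close>
  then have M: "real (maxbound + 1) \<le> 4 * Y" using tr KX1 YKX by (simp add: maxbound_def)
  define A where "A = 1024 * real tconst * K0"
  have tc: "1 \<le> real tconst" by (simp add: tconst_def SETUP0_def)
  have A1: "1024 * real tconst \<le> A" "K0 \<le> A" "1 \<le> A"
  proof -
    show 1: "1024 * real tconst \<le> A" using mult_left_mono[OF K1, of "1024 * real tconst"] by (simp add: A_def)
    show "K0 \<le> A" using mult_right_mono[of 1 "1024 * real tconst" K0] tc K1 by (simp add: A_def)
    then show "1 \<le> A" using K1 by simp
  qed
  have "real runtime \<le> real (tconst * (maxbound + 1) ^ 5)" using runtime_le by (simp only: of_nat_le_iff)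
  also have "\<dots> = real tconst * real (maxbound + 1) ^ 5" by simp
  also have "\<dots> \<le> real tconst * (4 * Y) ^ 5" using M by (intro mult_left_mono power_mono) auto
  also have "\<dots> = (1024 * real tconst) * K0 ^ (5 * k) * (X ^ (40 * k) * real n ^ 15)"
  proof -
    have "(real n ^ 3) ^ 5 = real n ^ 15" by (simp flip: power_mult)
    moreover have "(K0 ^ k) ^ 5 = K0 ^ (5 * k)" by (simp only: power_mult[symmetric] mult.commute)
    moreover have "(X ^ (8 * k)) ^ 5 = X ^ (40 * k)" by (simp only: power_mult[symmetric]) (simp add: mult.commute)
    moreover have "(4::real) ^ 5 = 1024" by simp
    ultimately show ?thesis by (simp only: Y_def power_mult_distrib mult_ac)
  qed
  \<comment> \<open>The constant in front of the power is moved into it. As \<open>A\<close> is at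
    least 1 and \<open>k\<close> is positive, the exponent \<open>5 * k + 1\<close> may be raised to
    \<open>40 * k\<close>.\<close>
  also have "\<dots> \<le> A ^ (40 * k) * (X ^ (40 * k) * real n ^ 15)"
  proof (rule mult_right_mono)
    have "(1024 * real tconst) * K0 ^ (5 * k) \<le> A * A ^ (5 * k)"
      using A1 K1 by (intro mult_mono power_mono) auto
    also have "\<dots> = A ^ (5 * k + 1)" by simp
    also have "\<dots> \<le> A ^ (40 * k)" using A1 pos by (intro power_increasing) auto
    finally show "1024 * real tconst * K0 ^ (5 * k) \<le> A ^ (40 * k)" .
  qed (use X1 in auto)
  also have "\<dots> = time_bound A 40 15 \<epsilon> I"
    by (simp add: time_bound_def power_mult_distrib X_def \<mu>_def l_def mult.assoc)
  finally show ?thesis by (simp add: A_def)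
qed

text \<open>Infinitely many functions are feasible assignments, but the cost depends only on their
  restriction to the clients, so there are finitely many costs and the infimum in \<open>opt\<close>
  is attained.\<close>

lemma ex_optimal:
  assumes "feasible I S \<rho>"
  obtains S' \<rho>' where "feasible I S' \<rho>'" "\<And>S \<rho>. feasible I S \<rho> \<Longrightarrow> objective \<rho>' \<le> objective \<rho>"
proof -
  define V where "V = {objective \<rho> | S \<rho>. feasible I S \<rho>}"
  have "V \<subseteq> objective ` (cls \<rightarrow>\<^sub>E facs)"
  proof
    fix x assume "x \<in> V"
    then obtain S \<rho> where \<rho>: "feasible I S \<rho>" "x = objective \<rho>" by (auto simp: V_def)
    have "objective (restrict \<rho> cls) = objective \<rho>" by (simp add: objective_def)
    moreover have "restrict \<rho> cls \<in> cls \<rightarrow>\<^sub>E facs" using \<rho>(1) by (auto simp: feasible_def)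
    ultimately show "x \<in> objective ` (cls \<rightarrow>\<^sub>E facs)" unfolding \<rho>(2) by (metis image_eqI)
  qed
  moreover have "finite (cls \<rightarrow>\<^sub>E facs)" using finite_pts by (intro finite_PiE) auto
  ultimately have fin: "finite V" using finite_subset by blast
  have "V \<noteq> {}" using assms by (auto simp: V_def)
  then have "Min V \<in> V" using fin by simp
  then obtain S' \<rho>' where opt: "feasible I S' \<rho>'" "Min V = objective \<rho>'" unfolding V_def by blast
  have "Min V \<le> objective \<rho>" if "feasible I S \<rho>" for S \<rho>
    using fin that by (intro Min_le) (auto simp: V_def)
  with opt show thesis by (intro that[of S' \<rho>']) simp_all
qed

theorem WHOLE_approximates:
  assumes obj: "\<And>\<rho>. obj I \<rho> = objective \<rho>" and r: "3 ^ z + 31 / real q \<le> r" and T: "real runtime \<le> T"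
  shows "\<exists>p. terminates (compile WHOLE) (encode I) p \<and> (\<forall>(s, \<tau>)\<in>set_pmf p. real \<tau> \<le> T) \<and>
    ((\<exists>S \<rho>. feasible I S \<rho>) \<longrightarrow> 2 / 3 \<le> measure_pmf.prob p {(s, \<tau>).
       feasible I (out_centers s) (out_assignment s) \<and> obj I (out_assignment s) \<le> r * opt obj I})"
proof -
  obtain p where p: "terminates (compile WHOLE) (encode I) p" "map_pmf fst p = den WHOLE (encode I)"
    "\<forall>(s', \<tau>)\<in>set_pmf p. \<tau> \<le> runtime"
    using WHOLE_runs unfolding runs_def by blast
  have "2 / 3 \<le> measure_pmf.prob p {(s, \<tau>). feasible I (out_centers s) (out_assignment s) \<and>
      obj I (out_assignment s) \<le> r * opt obj I}" if "\<exists>S \<rho>. feasible I S \<rho>"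
  proof -
    from that obtain S \<rho> where sol: "feasible I S \<rho>"
      "\<And>S' \<rho>'. feasible I S' \<rho>' \<Longrightarrow> objective \<rho> \<le> objective \<rho>'" by (elim exE) (erule ex_optimal, blast)
    have opt: "opt obj I = objective \<rho>"
      unfolding opt_def by (rule cInf_eq_minimum) (use sol in \<open>force simp: obj\<close>)+
    \<comment> \<open>The solution against which sampling and selection are measured is now taken to
      be an optimal one.\<close>
    interpret cfr_solution I a z q S \<rho> by unfold_locales (rule sol(1))
    have "likely (2 / 3) WHOLE (encode I) (\<lambda>s. feasible I (out_centers s) (out_assignment s) \<and>
        obj I (out_assignment s) \<le> r * opt obj I)"
    proof (rule likely_mono[OF WHOLE_likely])
      fix s assume s: "s \<in> set_pmf (den WHOLE (encode I))" and g: "goal s"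
      have "consistent s" by (rule ensuresD[OF WHOLE_safe s])
      with g have f: "feasible I (out_centers s) (out_assignment s)"
        "objective (out_assignment s) \<le> (3 ^ z + 31 / real q) * objective \<rho>"
        by (auto simp: consistent_def goal_def)
      have "(3 ^ z + 31 / real q) * objective \<rho> \<le> r * objective \<rho>"
        using r cl.total_nonneg by (intro mult_right_mono) (simp_all add: total_objective)
      with f show "feasible I (out_centers s) (out_assignment s) \<and> obj I (out_assignment s) \<le> r * opt obj I"
        by (simp add: opt obj)
    qed simp
    then show ?thesis
      unfolding likely_def p(2)[symmetric] by (simp add: vimage_def case_prod_unfold)
  qed
  moreover have "\<forall>(s, \<tau>)\<in>set_pmf p. real \<tau> \<le> T" using p(3) T by fastforce
  ultimately show ?thesis using p(1) by blast
qed

end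

theorem theorem5:
  fixes a :: nat
  shows "\<exists>(A::real) (B::nat) (D::nat). \<forall>\<epsilon>::real. \<epsilon> > 0 \<longrightarrow>
    (\<exists>P. randomized_approximation a kmedian_cost (3 + \<epsilon>) (time_bound A B D \<epsilon>) P) \<and>
    (\<exists>P. randomized_approximation a kmeans_cost (9 + \<epsilon>) (time_bound A B D \<epsilon>) P)"
proof (intro exI allI impI)
  fix \<epsilon> :: real assume \<epsilon>: "\<epsilon> > 0"
  \<comment> \<open>The least \<open>q\<close> with \<open>31 / q\<close> at most \<epsilon>.
    Rounding up adds at most 1, which gives 32 = 31 + 1 in the bound on \<open>q\<close>. The
    constants of the time bound are fixed by \<open>a\<close> alone.\<close>
  define q where "q = nat \<lceil>31 / \<epsilon>\<rceil>"
  have pos: "0 < 31 / \<epsilon>" using \<epsilon> by simp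
  then have q0: "0 < q" unfolding q_def by (simp add: zero_less_ceiling)
  have q: "31 / \<epsilon> \<le> real q" "real q \<le> 31 / \<epsilon> + 1" using pos unfolding q_def by linarith+
  have "31 / \<epsilon> \<le> 31 * max 1 (1 / \<epsilon>)" "1 \<le> max 1 (1 / \<epsilon>)" by simp_all
  then have q_le: "real q \<le> 32 * max 1 (1 / \<epsilon>)" using q(2) by linarith
  have "31 \<le> real q * \<epsilon>" using q(1) \<epsilon> by (simp add: pos_divide_le_eq)
  then have e: "31 / real q \<le> \<epsilon>" using q0 by (simp add: pos_divide_le_eq mult.commute)
  have approx: "randomized_approximation a obj (3 ^ z + \<epsilon>) (time_bound (1024 * real cfr.tconst * cfr.K0 a) 40 15 \<epsilon>)
      (compile (cfr.WHOLE a z q))"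
    if z: "z = 1 \<or> z = 2" and obj: "\<And>I \<rho>. obj I \<rho> = (\<Sum>c\<in>clients I. distance I c (\<rho> c) ^ z)" for z obj
    unfolding randomized_approximation_def
  proof (intro allI impI)
    fix I assume I: "wf_instance I \<and> aspect_ratio_bounded a I"
    interpret cfr I a z q using I z q0 by unfold_locales auto
    show "\<exists>p. terminates (compile WHOLE) (encode I) p \<and>
        (\<forall>(s, \<tau>)\<in>set_pmf p. real \<tau> \<le> time_bound (1024 * real tconst * K0) 40 15 \<epsilon> I) \<and>
        ((\<exists>S \<rho>. feasible I S \<rho>) \<longrightarrow> 2 / 3 \<le> measure_pmf.prob p {(s, \<tau>).
           feasible I (out_centers s) (out_assignment s) \<and>
           obj I (out_assignment s) \<le> (3 ^ z + \<epsilon>) * opt obj I})"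
      by (rule WHOLE_approximates) (use e runtime_time_bound[OF \<epsilon> q_le] in \<open>simp_all add: obj objective_def\<close>)
  qed
  show "(\<exists>P. randomized_approximation a kmedian_cost (3 + \<epsilon>) (time_bound (1024 * real cfr.tconst * cfr.K0 a) 40 15 \<epsilon>) P) \<and>
      (\<exists>P. randomized_approximation a kmeans_cost (9 + \<epsilon>) (time_bound (1024 * real cfr.tconst * cfr.K0 a) 40 15 \<epsilon>) P)"
    using approx[of 1 kmedian_cost] approx[of 2 kmeans_cost]
    by (auto simp: kmedian_cost_def kmeans_cost_def)
qed

end
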